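(* Let $\mathcal{P}$ be a nonsymmetric binary operad and $\mathcal{O}$ a symmetric binary operad. Let $k\geq0$ and let $A$ be an algebra over $\mathrm{BSu}^k(\mathcal{O})$. Any morphism of operads $\mathit{Reg}(\mathcal{P})\to\mathcal{O}$ induces a morphism of nonsymmetric operads $$\mathrm{BSu}^k(\mathcal{P})\longrightarrow\overline{\mathrm{BSu}^k(\mathcal{O})},$$ which endows the space $\mathcal{M}_n(A)$ of $n\times n$ matrices with coefficients in $A$, for every $n\geq1$, with a $\mathrm{BSu}^k(\mathcal{P})$-algebra structure.
   Context: Fix a field $\mathbf{k}$; operads are in $\mathbf{k}$-vector spaces. **Free operads.** For a vector space $V$ in arity 2, the free nonsymmetric (ns) operad $\mathcal{T}_{ns}(V)$ has in arity $n$ the span of planar binary rooted trees with $n$ leaves (numbered $1,\dots,n$ from left to right) with vertices labeled by elements of $V$, multilinearly. For an $\mathbb{S}_2$-module $V$, the free symmetric operad $\mathcal{T}(V)$ has in arity $n$ the span of such trees with leaves labeled by any bijection with $\{1,\dots,n\}$, modulo: exchanging the left and right subtrees of a vertex labeled $\omega$ gives the same element after replacing $\omega$ by $\omega^{(12)}$. A binary ns (resp. symmetric) operad is $\mathcal{T}_{ns}(V)/(R)$ (resp. $\mathcal{T}(V)/(R)$) with generators $V$ in arity 2 and $R$ spanned (as an $\mathbb S$-module in the symmetric case) by homogeneous elements, each of a single arity. **Bisuccessor.** $\widetilde V=V\otimes(\mathbf{k}\prec\oplus\,\mathbf{k}\succ)$, $\omega_\prec=\omega\otimes\prec$, $\omega_\succ=\omega\otimes\succ$,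 $\omega_\star=\omega_\prec+\omega_\succ$; in the symmetric case $(\omega_\prec)^{(12)}=(\omega^{(12)})_\succ$, $(\omega_\succ)^{(12)}=(\omega^{(12)})_\prec$. For a labeled tree $\tau$ and leaf $x$, $\mathrm{BSu}_x(\tau)$ is obtained by relabeling: a vertex labeled $\omega$ on the path from the root to $x$ gets $\omega_\prec$ if the path turns left there and $\omega_\succ$ if it turns right; a vertex labeled $\omega$ off the path gets $\omega_\star$. Extend linearly. $\mathrm{BSu}(\mathcal{P})=\mathcal{T}_{(ns)}(\widetilde V)/(\mathrm{BSu}_x(r): r\in R \text{ homogeneous of arity } m,\ 1\le x\le m)$. $\mathrm{BSu}^k$ is the $k$-fold iterate, $\mathrm{BSu}^0(\mathcal P)=\mathcal P$. **Forgetful and regularization functors.** For a symmetric operad $\mathcal Q$, $\overline{\mathcal Q}$ is the ns operad with $\overline{\mathcal Q}_m=\mathcal Q(m)$ (forget the symmetric group actions). Its left adjoint is $\mathit{Reg}$, with $\mathit{Reg}(\mathcal P)(m)=\mathcal P_m\otimes\mathbf k[\mathbb S_m]$; if $\mathcal P=\mathcal T_{ns}(V)/(R)$ then $\mathit{Reg}(\mathcal P)=\mathcal T(V\otimes\mathbf k[\mathbb S_2])/(R_m\otimes\mathbf k[\mathbb S_m],\,m)$. **Matrices.** If $\mathcal{Q}$ is a symmetric operad (concentrated in arities $\geq 1$) and $A$ a $\mathcal{Q}$-algebra with structure map $\alpha_A$, then $\mathcal{M}_n(A)$ is a $\overline{\mathcal Q}$-algebra: $\mu\in\overline{\mathcal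 Q}_m$ acts by $\mu(M^1,\dots,M^m)_{i,j}=\sum_{k_1,\dots,k_{m-1}=1}^n\alpha_A(\mu)(M^1_{i,k_1},M^2_{k_1,k_2},\dots,M^m_{k_{m-1},j})$. **Meaning of "induces".** The induced morphism is the one determined by functoriality on generators: if $f:\mathit{Reg}(\mathcal P)\to\mathcal O$ is the given morphism, a generator $v\otimes\mu_1\otimes\cdots\otimes\mu_k$ ($v\in V$, $\mu_i\in\{\prec,\succ\}$) of $\mathrm{BSu}^k(\mathcal P)$ is sent to the class of $f(v)\otimes\mu_1\otimes\cdots\otimes\mu_k$ (a lift of $f(v)\in\mathcal O(2)$ to the generators of $\mathcal O$ being used). The $\mathrm{BSu}^k(\mathcal P)$-structure on $\mathcal M_n(A)$ is the pullback of its $\overline{\mathrm{BSu}^k(\mathcal O)}$-structure. *)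

theory Defs
  imports
    "HOL-Analysis.Finite_Cartesian_Product"
    "HOL-Combinatorics.Permutations"
    "HOL-Library.Poly_Mapping"
    "HOL-Library.Function_Algebras"
    "HOL-Library.Product_Plus"
    "HOL-Library.FuncSet"
begin

section \<open>Operads, morphisms, quotients, algebras\<close>

text \<open>
  An operad is given by its spaces of operations and its partial compositions:
  \<open>pcomp Q m i n p q\<close> is \<open>p \<circ>\<^sub>i q\<close> for \<open>p\<close> of arity \<open>m\<close>, \<open>q\<close> of arity \<open>n\<close> and \<open>1 \<le> i \<le> m\<close>.
  All operations carry the arities as arguments because an element of a quotient (a coset) need not
  determine its arity.
\<close>

record ('k, 'q) ns_operad =
  ops :: "nat \<Rightarrow> 'q set"
  oadd :: "nat \<Rightarrow> 'q \<Rightarrow> 'q \<Rightarrow> 'q"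
  oscale :: "nat \<Rightarrow> 'k \<Rightarrow> 'q \<Rightarrow> 'q"
  ozero :: "nat \<Rightarrow> 'q"
  ounit :: "'q"
  pcomp :: "nat \<Rightarrow> nat \<Rightarrow> nat \<Rightarrow> 'q \<Rightarrow> 'q \<Rightarrow> 'q"

text \<open>
  \<open>oact Q m \<sigma> p\<close> is \<open>p\<^sup>\<sigma>\<close>, the right action of a permutation \<open>\<sigma>\<close> of \<open>{1..m}\<close>; the convention
  is \<open>p\<^sup>\<sigma>(a\<^sub>1,\<dots>,a\<^sub>m) = p(b\<^sub>1,\<dots>,b\<^sub>m)\<close> with \<open>b\<^sub>j\<close> the argument \<open>a\<close> at position \<open>\<sigma>\<inverse>(j)\<close>.
\<close>

record ('k, 'q) sym_operad = "('k, 'q) ns_operad" +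
  oact :: "nat \<Rightarrow> (nat \<Rightarrow> nat) \<Rightarrow> 'q \<Rightarrow> 'q"

definition forget :: "('k, 'q) sym_operad \<Rightarrow> ('k, 'q) ns_operad" where
  "forget Q = ns_operad.truncate Q"

definition ns_operad_hom ::
    "('k, 'p, 'y) ns_operad_scheme \<Rightarrow> ('k, 'q, 'z) ns_operad_scheme \<Rightarrow> (nat \<Rightarrow> 'p \<Rightarrow> 'q) \<Rightarrow> bool" where
  "ns_operad_hom P Q f \<longleftrightarrow>
     (\<forall>m. \<forall>p\<in>ops P m. f m p \<in> ops Q m) \<and>
     (\<forall>m. \<forall>p\<in>ops P m. \<forall>p'\<in>ops P m. f m (oadd P m p p') = oadd Q m (f m p) (f m p')) \<and>
     (\<forall>m c. \<forall>p\<in>ops P m. f m (oscale P m c p) = oscale Q m c (f m p)) \<and>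
     f 1 (ounit P) = ounit Q \<and>
     (\<forall>m n. \<forall>i\<in>{1..m}. \<forall>p\<in>ops P m. \<forall>q\<in>ops P n.
        f (m + n - 1) (pcomp P m i n p q) = pcomp Q m i n (f m p) (f n q))"

definition sym_operad_hom ::
    "('k, 'p) sym_operad \<Rightarrow> ('k, 'q) sym_operad \<Rightarrow> (nat \<Rightarrow> 'p \<Rightarrow> 'q) \<Rightarrow> bool" where
  "sym_operad_hom P Q f \<longleftrightarrow>
     ns_operad_hom P Q f \<and>
     (\<forall>m \<sigma>. \<sigma> permutes {1..m} \<longrightarrow> (\<forall>p\<in>ops P m. f m (oact P m \<sigma> p) = oact Q m \<sigma> (f m p)))"

inductive ns_ideal :: "('k, 'q, 'z) ns_operad_scheme \<Rightarrow> (nat \<Rightarrow> 'q set) \<Rightarrow> nat \<Rightarrow> 'q \<Rightarrow> bool"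
  for Q S where
  ns_zero: "ns_ideal Q S m (ozero Q m)"
| ns_gen: "r \<in> S m \<Longrightarrow> ns_ideal Q S m r"
| ns_add: "ns_ideal Q S m p \<Longrightarrow> ns_ideal Q S m p' \<Longrightarrow> ns_ideal Q S m (oadd Q m p p')"
| ns_scale: "ns_ideal Q S m p \<Longrightarrow> ns_ideal Q S m (oscale Q m c p)"
| ns_comp_left: "ns_ideal Q S m p \<Longrightarrow> q \<in> ops Q n \<Longrightarrow> i \<in> {1..m} \<Longrightarrow>
    ns_ideal Q S (m + n - 1) (pcomp Q m i n p q)"
| ns_comp_right: "p \<in> ops Q m \<Longrightarrow> ns_ideal Q S n q \<Longrightarrow> i \<in> {1..m} \<Longrightarrow>
    ns_ideal Q S (m + n - 1) (pcomp Q m i n p q)"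

inductive sym_ideal :: "('k, 'q) sym_operad \<Rightarrow> (nat \<Rightarrow> 'q set) \<Rightarrow> nat \<Rightarrow> 'q \<Rightarrow> bool"
  for Q S where
  sym_zero: "sym_ideal Q S m (ozero Q m)"
| sym_gen: "r \<in> S m \<Longrightarrow> sym_ideal Q S m r"
| sym_add: "sym_ideal Q S m p \<Longrightarrow> sym_ideal Q S m p' \<Longrightarrow> sym_ideal Q S m (oadd Q m p p')"
| sym_scale: "sym_ideal Q S m p \<Longrightarrow> sym_ideal Q S m (oscale Q m c p)"
| sym_act: "sym_ideal Q S m p \<Longrightarrow> \<sigma> permutes {1..m} \<Longrightarrow> sym_ideal Q S m (oact Q m \<sigma> p)"
| sym_comp_left: "sym_ideal Q S m p \<Longrightarrow> q \<in> ops Q n \<Longrightarrow> i \<in> {1..m} \<Longrightarrow>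
    sym_ideal Q S (m + n - 1) (pcomp Q m i n p q)"
| sym_comp_right: "p \<in> ops Q m \<Longrightarrow> sym_ideal Q S n q \<Longrightarrow> i \<in> {1..m} \<Longrightarrow>
    sym_ideal Q S (m + n - 1) (pcomp Q m i n p q)"

definition coset ::
    "('k, 'q, 'z) ns_operad_scheme \<Rightarrow> (nat \<Rightarrow> 'q \<Rightarrow> bool) \<Rightarrow> nat \<Rightarrow> 'q \<Rightarrow> 'q set" where
  "coset Q I m p = {oadd Q m p z | z. I m z}"

definition ns_quotient ::
    "('k, 'q, 'z) ns_operad_scheme \<Rightarrow> (nat \<Rightarrow> 'q \<Rightarrow> bool) \<Rightarrow> ('k, 'q set) ns_operad" where
  "ns_quotient Q I = \<lparr>
     ops = (\<lambda>m. coset Q I m ` ops Q m),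
     oadd = (\<lambda>m X Y. \<Union>x\<in>X. \<Union>y\<in>Y. coset Q I m (oadd Q m x y)),
     oscale = (\<lambda>m c X. \<Union>x\<in>X. coset Q I m (oscale Q m c x)),
     ozero = (\<lambda>m. coset Q I m (ozero Q m)),
     ounit = coset Q I 1 (ounit Q),
     pcomp = (\<lambda>m i n X Y. \<Union>x\<in>X. \<Union>y\<in>Y. coset Q I (m + n - 1) (pcomp Q m i n x y))\<rparr>"

definition sym_quotient ::
    "('k, 'q) sym_operad \<Rightarrow> (nat \<Rightarrow> 'q \<Rightarrow> bool) \<Rightarrow> ('k, 'q set) sym_operad" where
  "sym_quotient Q I = ns_operad.extend (ns_quotient Q I)
     (sym_operad.fields (\<lambda>m \<sigma> X. \<Union>x\<in>X. coset Q I m (oact Q m \<sigma> x)))"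

text \<open>
  An algebra over an operad on the vector space \<open>'a\<close> with scalar multiplication \<open>s\<close>:
  \<open>\<alpha> m \<mu>\<close> is the \<open>m\<close>-ary operation by which \<open>\<mu>\<close> acts, as a function on lists of length \<open>m\<close>.
\<close>

definition ns_algebra ::
    "('k::field, 'q, 'z) ns_operad_scheme \<Rightarrow> ('k \<Rightarrow> 'a::ab_group_add \<Rightarrow> 'a) \<Rightarrow>
     (nat \<Rightarrow> 'q \<Rightarrow> 'a list \<Rightarrow> 'a) \<Rightarrow> bool" where
  "ns_algebra Q s \<alpha> \<longleftrightarrow>
     vector_space s \<and>
     (\<forall>m. \<forall>\<mu>\<in>ops Q m. \<forall>xs. length xs = m \<longrightarrow>
        (\<forall>i<m. Vector_Spaces.linear s s (\<lambda>x. \<alpha> m \<mu> (xs[i := x])))) \<and>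
     (\<forall>m. \<forall>\<mu>\<in>ops Q m. \<forall>\<nu>\<in>ops Q m. \<forall>xs. length xs = m \<longrightarrow>
        \<alpha> m (oadd Q m \<mu> \<nu>) xs = \<alpha> m \<mu> xs + \<alpha> m \<nu> xs) \<and>
     (\<forall>m c. \<forall>\<mu>\<in>ops Q m. \<forall>xs. length xs = m \<longrightarrow>
        \<alpha> m (oscale Q m c \<mu>) xs = s c (\<alpha> m \<mu> xs)) \<and>
     (\<forall>x. \<alpha> 1 (ounit Q) [x] = x) \<and>
     (\<forall>m n. \<forall>i\<in>{1..m}. \<forall>\<mu>\<in>ops Q m. \<forall>\<nu>\<in>ops Q n. \<forall>xs ys zs.
        length xs = i - 1 \<and> length ys = n \<and> length zs = m - i \<longrightarrow>
        \<alpha> (m + n - 1) (pcomp Q m i n \<mu> \<nu>) (xs @ ys @ zs) = \<alpha> m \<mu> (xs @ [\<alpha> n \<nu> ys] @ zs))"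

definition sym_algebra ::
    "('k::field, 'q) sym_operad \<Rightarrow> ('k \<Rightarrow> 'a::ab_group_add \<Rightarrow> 'a) \<Rightarrow>
     (nat \<Rightarrow> 'q \<Rightarrow> 'a list \<Rightarrow> 'a) \<Rightarrow> bool" where
  "sym_algebra Q s \<alpha> \<longleftrightarrow>
     ns_algebra Q s \<alpha> \<and>
     (\<forall>m \<sigma>. \<sigma> permutes {1..m} \<longrightarrow> (\<forall>\<mu>\<in>ops Q m. \<forall>xs. length xs = m \<longrightarrow>
        \<alpha> m (oact Q m \<sigma> \<mu>) xs = \<alpha> m \<mu> (map (\<lambda>j. xs ! (inv \<sigma> j - 1)) [1..<Suc m])))"

definition pullback ::
    "(nat \<Rightarrow> 'p \<Rightarrow> 'q) \<Rightarrow> (nat \<Rightarrow> 'q \<Rightarrow> 'a list \<Rightarrow> 'a) \<Rightarrow> nat \<Rightarrow> 'p \<Rightarrow> 'a list \<Rightarrow> 'a" where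
  "pullback F \<alpha> = (\<lambda>m \<mu>. \<alpha> m (F m \<mu>))"

section \<open>Matrices\<close>

definition matrix_scale :: "('k \<Rightarrow> 'a \<Rightarrow> 'a) \<Rightarrow> 'k \<Rightarrow> 'a^'n^'n \<Rightarrow> 'a^'n^'n" where
  "matrix_scale s c M = (\<chi> i j. s c (M $ i $ j))"

definition matrix_action ::
    "(nat \<Rightarrow> 'q \<Rightarrow> 'a::ab_group_add list \<Rightarrow> 'a) \<Rightarrow> nat \<Rightarrow> 'q \<Rightarrow> ('a^'n::finite^'n) list \<Rightarrow> 'a^'n^'n" where
  "matrix_action \<alpha> m \<mu> Ms = (\<chi> i j. \<Sum>ks | length ks = m - 1.
     \<alpha> m \<mu> (map (\<lambda>l. Ms ! l $ ((i # ks @ [j]) ! l) $ ((i # ks @ [j]) ! Suc l)) [0..<m]))"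

section \<open>Trees and operads of trees\<close>

datatype ('g, 'l) ptree = Leaf 'l | Node 'g "('g, 'l) ptree" "('g, 'l) ptree"

fun leaves :: "('g, 'l) ptree \<Rightarrow> 'l list" where
  "leaves (Leaf x) = [x]"
| "leaves (Node w l r) = leaves l @ leaves r"

fun vlabels :: "('g, 'l) ptree \<Rightarrow> 'g set" where
  "vlabels (Leaf x) = {}"
| "vlabels (Node w l r) = insert w (vlabels l \<union> vlabels r)"

definition ns_trees :: "'g set \<Rightarrow> nat \<Rightarrow> ('g, nat) ptree set" where
  "ns_trees G m = {t. vlabels t \<subseteq> G \<and> leaves t = [1..<Suc m]}"

definition sym_trees :: "'g set \<Rightarrow> nat \<Rightarrow> ('g, nat) ptree set" where
  "sym_trees G m = {t. vlabels t \<subseteq> G \<and> distinct (leaves t) \<and> set (leaves t) = {1..m}}"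

text \<open>
  \<open>graft i s t\<close> is \<open>s \<circ>\<^sub>i t\<close>: the root of \<open>t\<close> replaces the leaf of \<open>s\<close> labelled \<open>i\<close>, with the usual
  renumbering of leaves.  On \<^const>\<open>ns_trees\<close> it preserves the left-to-right numbering.
\<close>

fun graft :: "nat \<Rightarrow> ('g, nat) ptree \<Rightarrow> ('g, nat) ptree \<Rightarrow> ('g, nat) ptree" where
  "graft i (Leaf j) t =
     (if j < i then Leaf j
      else if j = i then map_ptree id (\<lambda>x. x + i - 1) t
      else Leaf (j + length (leaves t) - 1))"
| "graft i (Node w l r) t = Node w (graft i l t) (graft i r t)"

type_synonym ('k, 'g) tcomb = "('g, nat) ptree \<Rightarrow>\<^sub>0 'k"

definition lc_scale :: "'k::field \<Rightarrow> ('t \<Rightarrow>\<^sub>0 'k) \<Rightarrow> ('t \<Rightarrow>\<^sub>0 'k)" where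
  "lc_scale c p = Poly_Mapping.map ((*) c) p"

definition lc_map :: "('t \<Rightarrow> 'u) \<Rightarrow> ('t \<Rightarrow>\<^sub>0 'k::field) \<Rightarrow> ('u \<Rightarrow>\<^sub>0 'k)" where
  "lc_map h p = (\<Sum>t\<in>Poly_Mapping.keys p. Poly_Mapping.single (h t) (Poly_Mapping.lookup p t))"

definition lc_graft :: "nat \<Rightarrow> ('k::field, 'g) tcomb \<Rightarrow> ('k, 'g) tcomb \<Rightarrow> ('k, 'g) tcomb" where
  "lc_graft i p q = (\<Sum>s\<in>Poly_Mapping.keys p. \<Sum>t\<in>Poly_Mapping.keys q.
     Poly_Mapping.single (graft i s t) (Poly_Mapping.lookup p s * Poly_Mapping.lookup q t))"

definition tree :: "('g, nat) ptree \<Rightarrow> ('k::field, 'g) tcomb" where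
  "tree t = Poly_Mapping.single t 1"

definition corolla :: "'g \<Rightarrow> ('k::field, 'g) tcomb" where
  "corolla w = tree (Node w (Leaf 1) (Leaf 2))"

text \<open>
  The operads freely spanned by trees whose vertices are labelled by elements of the \<^emph>\<open>set\<close> \<open>G\<close>:
  neither linearity in the labels nor the exchange of subtrees is imposed yet.
\<close>

definition ns_tree_operad :: "'g set \<Rightarrow> ('k::field, ('k, 'g) tcomb) ns_operad" where
  "ns_tree_operad G = \<lparr>
     ops = (\<lambda>m. {p. Poly_Mapping.keys p \<subseteq> ns_trees G m}),
     oadd = (\<lambda>_. (+)),
     oscale = (\<lambda>_. lc_scale),
     ozero = (\<lambda>_. 0),
     ounit = tree (Leaf 1),
     pcomp = (\<lambda>_ i _. lc_graft i)\<rparr>"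

definition sym_tree_operad :: "'g set \<Rightarrow> ('k::field, ('k, 'g) tcomb) sym_operad" where
  "sym_tree_operad G = \<lparr>
     ops = (\<lambda>m. {p. Poly_Mapping.keys p \<subseteq> sym_trees G m}),
     oadd = (\<lambda>_. (+)),
     oscale = (\<lambda>_. lc_scale),
     ozero = (\<lambda>_. 0),
     ounit = tree (Leaf 1),
     pcomp = (\<lambda>_ i _. lc_graft i),
     oact = (\<lambda>_ \<sigma>. lc_map (map_ptree id (inv \<sigma>)))\<rparr>"

section \<open>Binary operads given by generators and relations\<close>

text \<open>
  The spaces of generators must be closed under \<open>V \<mapsto> V \<otimes> (\<^bold>k\<prec> \<oplus> \<^bold>k\<succ>)\<close> without leaving the type.
  They are therefore subspaces of the space of functions from words in \<open>\<prec>, \<succ>\<close> to a \<open>\<^bold>k\<close>-vector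
  space \<open>'v\<close>.  A vector space \<open>V = 'v\<close> itself appears as the functions supported on the
  empty word, and then \<open>V \<otimes> (\<^bold>k\<prec> \<oplus> \<^bold>k\<succ>)\<^bsup>\<otimes>k\<^esup>\<close> as the functions supported on the words of length \<open>k\<close>.
  For any subspace \<open>V\<close>, the maps \<open>\<omega> \<mapsto> \<omega> \<otimes> \<prec>\<close> and \<open>\<omega> \<mapsto> \<omega> \<otimes> \<succ>\<close> below are injective on \<open>V\<close> with images in
  direct sum.
\<close>

datatype side = Prec | Succ

type_synonym 'v label = "side list \<Rightarrow> 'v"

definition tens :: "side \<Rightarrow> 'v::zero label \<Rightarrow> 'v label" where
  "tens s w = (\<lambda>l. if l \<noteq> [] \<and> last l = s then w (butlast l) else 0)"

definition tens_word :: "'v::zero label \<Rightarrow> side list \<Rightarrow> 'v label" where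
  "tens_word w \<mu> = foldl (\<lambda>u s. tens s u) w \<mu>"

text \<open>
  \<open>vscale\<close> is the scalar multiplication of \<open>'v\<close>; labels are scaled pointwise.  The set \<open>rel P m\<close>
  consists of formal combinations of trees, representing homogeneous relations of arity \<open>m\<close> in the free
  operad.  The relations need only span \<open>R\<close> (as an \<open>\<bbbS>\<close>-module in the symmetric case); the whole space
  of homogeneous elements of \<open>R\<close> is allowed too.  \<open>twist\<close> is \<open>\<omega> \<mapsto> \<omega>\<^sup>(\<^sup>1\<^sup>2\<^sup>)\<close>.
\<close>

record (overloaded) ('k::zero, 'v) ns_pres =
  vscale :: "'k \<Rightarrow> 'v \<Rightarrow> 'v"
  gen :: "'v label set"
  rel :: "nat \<Rightarrow> ('k, 'v label) tcomb set"

record (overloaded) ('k::zero, 'v) sym_pres = "('k, 'v) ns_pres" +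
  twist :: "'v label \<Rightarrow> 'v label"

definition lscale :: "('k::zero, 'v, 'z) ns_pres_scheme \<Rightarrow> 'k \<Rightarrow> 'v label \<Rightarrow> 'v label" where
  "lscale P c w = (\<lambda>l. vscale P c (w l))"

definition ns_presentation :: "('k::field, 'v::ab_group_add) ns_pres \<Rightarrow> bool" where
  "ns_presentation P \<longleftrightarrow>
     vector_space (vscale P) \<and>
     module.subspace (lscale P) (gen P) \<and>
     (\<forall>m. rel P m \<subseteq> ops (ns_tree_operad (gen P)) m)"

definition sym_presentation :: "('k::field, 'v::ab_group_add) sym_pres \<Rightarrow> bool" where
  "sym_presentation P \<longleftrightarrow>
     vector_space (vscale P) \<and>
     module.subspace (lscale P) (gen P) \<and>
     (\<forall>a\<in>gen P. twist P a \<in> gen P \<and> twist P (twist P a) = a) \<and>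
     (\<forall>a\<in>gen P. \<forall>b\<in>gen P. twist P (a + b) = twist P a + twist P b) \<and>
     (\<forall>c. \<forall>a\<in>gen P. twist P (lscale P c a) = lscale P c (twist P a)) \<and>
     (\<forall>m. rel P m \<subseteq> ops (sym_tree_operad (gen P)) m)"

text \<open>
  Linearity in the label and the exchange of subtrees are imposed on the one-vertex trees of arity 2;
  the operadic ideal generated by these relations imposes them at every vertex of every tree.  The free
  operads \<open>\<T>\<^sub>n\<^sub>s(V)\<close> and \<open>\<T>(V)\<close> are the operads presented by \<open>gen = V\<close> and \<open>rel = (\<lambda>_. {})\<close>.
\<close>

definition linearity_rel ::
    "('k::field, 'v::ab_group_add, 'z) ns_pres_scheme \<Rightarrow> nat \<Rightarrow> ('k, 'v label) tcomb set" where
  "linearity_rel P m = (if m = 2 then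
       {corolla (a + b) - corolla a - corolla b | a b. a \<in> gen P \<and> b \<in> gen P} \<union>
       {corolla (lscale P c a) - lc_scale c (corolla a) | c a. a \<in> gen P}
     else {})"

definition exchange_rel ::
    "('k::field, 'v::ab_group_add) sym_pres \<Rightarrow> nat \<Rightarrow> ('k, 'v label) tcomb set" where
  "exchange_rel P m = (if m = 2 then
       {corolla a - tree (Node (twist P a) (Leaf 2) (Leaf 1)) | a. a \<in> gen P}
     else {})"

definition ns_rel_ideal ::
    "('k::field, 'v::ab_group_add) ns_pres \<Rightarrow> nat \<Rightarrow> ('k, 'v label) tcomb \<Rightarrow> bool" where
  "ns_rel_ideal P = ns_ideal (ns_tree_operad (gen P)) (\<lambda>m. linearity_rel P m \<union> rel P m)"

definition sym_rel_ideal ::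
    "('k::field, 'v::ab_group_add) sym_pres \<Rightarrow> nat \<Rightarrow> ('k, 'v label) tcomb \<Rightarrow> bool" where
  "sym_rel_ideal P = sym_ideal (sym_tree_operad (gen P))
     (\<lambda>m. linearity_rel P m \<union> exchange_rel P m \<union> rel P m)"

definition ns_presented ::
    "('k::field, 'v::ab_group_add) ns_pres \<Rightarrow> ('k, ('k, 'v label) tcomb set) ns_operad" where
  "ns_presented P = ns_quotient (ns_tree_operad (gen P)) (ns_rel_ideal P)"

definition sym_presented ::
    "('k::field, 'v::ab_group_add) sym_pres \<Rightarrow> ('k, ('k, 'v label) tcomb set) sym_operad" where
  "sym_presented P = sym_quotient (sym_tree_operad (gen P)) (sym_rel_ideal P)"

definition ns_gen_class ::
    "('k::field, 'v::ab_group_add) ns_pres \<Rightarrow> 'v label \<Rightarrow> ('k, 'v label) tcomb set" where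
  "ns_gen_class P w = coset (ns_tree_operad (gen P)) (ns_rel_ideal P) 2 (corolla w)"

definition sym_gen_class ::
    "('k::field, 'v::ab_group_add) sym_pres \<Rightarrow> 'v label \<Rightarrow> ('k, 'v label) tcomb set" where
  "sym_gen_class P w = coset (sym_tree_operad (gen P)) (sym_rel_ideal P) 2 (corolla w)"

section \<open>Bisuccessor and regularization\<close>

fun bsu_tree :: "nat \<Rightarrow> ('v::ab_group_add label, nat) ptree \<Rightarrow> ('v label, nat) ptree" where
  "bsu_tree x (Leaf y) = Leaf y"
| "bsu_tree x (Node w l r) =
     Node (if x \<in> set (leaves l) then tens Prec w
           else if x \<in> set (leaves r) then tens Succ w
           else tens Prec w + tens Succ w)
       (bsu_tree x l) (bsu_tree x r)"

definition ns_BSu ::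
    "('k::field, 'v::ab_group_add, 'z) ns_pres_scheme \<Rightarrow> ('k, 'v, 'z) ns_pres_scheme" where
  "ns_BSu P = P\<lparr>
     gen := {tens Prec a + tens Succ b | a b. a \<in> gen P \<and> b \<in> gen P},
     rel := (\<lambda>m. {lc_map (bsu_tree x) r | x r. x \<in> {1..m} \<and> r \<in> rel P m})\<rparr>"

text \<open>The two functions under \<open>twist P\<close> are the components \<open>a\<close>, \<open>b\<close> of \<open>w = a \<otimes> \<prec> + b \<otimes> \<succ>\<close>.\<close>

definition sym_BSu ::
    "('k::field, 'v::ab_group_add) sym_pres \<Rightarrow> ('k, 'v) sym_pres" where
  "sym_BSu P = (ns_BSu P)\<lparr>
     twist := (\<lambda>w. tens Succ (twist P (\<lambda>l. w (l @ [Prec]))) + tens Prec (twist P (\<lambda>l. w (l @ [Succ]))))\<rparr>"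

text \<open>\<open>V \<otimes> \<^bold>k[\<bbbS>\<^sub>2]\<close> is \<open>V \<times> V\<close>, with \<open>(a, b)\<close> standing for \<open>a \<otimes> id + b \<otimes> (12)\<close>.\<close>

definition reg_id :: "'v::zero label \<Rightarrow> ('v \<times> 'v) label" where
  "reg_id w = (\<lambda>l. (w l, 0))"

definition Reg :: "('k::field, 'v::ab_group_add) ns_pres \<Rightarrow> ('k, 'v \<times> 'v) sym_pres" where
  "Reg P = \<lparr>
     vscale = (\<lambda>c (a, b). (vscale P c a, vscale P c b)),
     gen = {\<lambda>l. (a l, b l) | a b. a \<in> gen P \<and> b \<in> gen P},
     rel = (\<lambda>m. lc_map (map_ptree reg_id id) ` rel P m),
     twist = (\<lambda>w l. prod.swap (w l))\<rparr>"

section \<open>The induced morphism\<close>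

text \<open>
  The requirement on generators is imposed for every lift \<open>w\<close> of \<open>f(v)\<close>.
  Values outside the spaces of operations are fixed by extensionality.
\<close>

definition induced_morphism ::
    "nat \<Rightarrow> ('k::field, 'v::ab_group_add) ns_pres \<Rightarrow> ('k, 'w::ab_group_add) sym_pres \<Rightarrow>
     (nat \<Rightarrow> ('k, ('v \<times> 'v) label) tcomb set \<Rightarrow> ('k, 'w label) tcomb set) \<Rightarrow>
     (nat \<Rightarrow> ('k, 'v label) tcomb set \<Rightarrow> ('k, 'w label) tcomb set) \<Rightarrow> bool" where
  "induced_morphism k P Q f F \<longleftrightarrow>
     ns_operad_hom (ns_presented ((ns_BSu ^^ k) P)) (forget (sym_presented ((sym_BSu ^^ k) Q))) F \<and>
     (\<forall>m. F m \<in> extensional (ops (ns_presented ((ns_BSu ^^ k) P)) m)) \<and>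
     (\<forall>v\<in>gen P. \<forall>w\<in>gen Q. f 2 (sym_gen_class (Reg P) (reg_id v)) = sym_gen_class Q w \<longrightarrow>
        (\<forall>\<mu>. length \<mu> = k \<longrightarrow>
           F 2 (ns_gen_class ((ns_BSu ^^ k) P) (tens_word v \<mu>)) =
             sym_gen_class ((sym_BSu ^^ k) Q) (tens_word w \<mu>)))"

end

theory Submission
  imports Defs
begin

text \<open>
  Everything rests on functoriality of the bisuccessor: \<open>bsu_tree x\<close> maps the ideal of
  relations of \<open>\<O>\<close> into that of \<open>BSu(\<O>)\<close>.  The bisuccessor of a composite at a leaf
  is a composite of bisuccessors in which the factor not containing the leaf carries \<open>\<star>\<close>
  everywhere, so the ideal is preserved once \<open>\<star>\<close>-versions of relations are
  relations; they are, being the sum of the bisuccessors at all leaves.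

  The induced morphism is obtained from a choice of lifts \<open>\<phi>(v)\<close> of \<open>f(v)\<close>.  The
  choice is linear only modulo the relations of \<open>\<O>\<close>, but functoriality transports this
  congruence, and independence of the lift, to every iterate.  Uniqueness holds because
  every tree is a composite of one-vertex trees.  A matrix operation sums over the paths of
  indices through its arguments, and a path through a composite is a path through the outer operation
  with one edge replaced by a path through the inner one.
\<close>

section \<open>Linear combinations of trees\<close>

text \<open>The obstacle that shapes the proof: trees carry labels from a set, with linearity
  imposed only in the quotient. A choice of lifts \<phi> thus acts on trees at once, but nothing
  makes it additive on labels. Its extension to bisuccessors is taken componentwise. That this
  extension commutes with \<open>bsu_tree\<close> as an identity of trees, and not just modulo
  relations, requires \<phi> to send 0 to 0, because \<open>tens Prec w\<close> is a sum whose other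
  component is 0. Its linearity modulo relations is recovered from the bisuccessors at the two
  leaves of a corolla, which carry a congruence between labels to each component.

  The factor of a composite that misses the leaf is described by the leaf number 0, which no tree of
  the operads uses. Hence preservation of the ideal is proved for every natural number as leaf,
  although the bisuccessor imposes relations at actual leaves only.

  A lift of f(v) exists because each operation of arity two is the class of one corolla; without
  this the condition on generators would be empty. Arity 0, where sums over paths of indices do not
  fit, contains only the zero class.\<close>

lemma lookup_lc_scale: "Poly_Mapping.lookup (lc_scale c p) t = c * Poly_Mapping.lookup p t"
  unfolding lc_scale_def by (simp add: Poly_Mapping.map.rep_eq when_def)

lemma lc_scale_simps [simp]:
  "lc_scale c 0 = 0"
  "lc_scale 0 p = 0"
  "lc_scale (- 1) p = - p"
  "lc_scale c (Poly_Mapping.single t d) = Poly_Mapping.single t (c * d)"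
  by (rule poly_mapping_eqI, simp add: lookup_lc_scale lookup_single when_def)+

lemma lc_scale_add: "lc_scale c (p + q) = lc_scale c p + lc_scale c q"
  by (rule poly_mapping_eqI) (simp add: lookup_lc_scale lookup_add algebra_simps)

lemma lc_scale_diff: "lc_scale c (p - q) = lc_scale c p - lc_scale c q"
  by (rule poly_mapping_eqI) (simp add: lookup_lc_scale lookup_minus algebra_simps)

lemma lc_scale_sum: "lc_scale c (sum g A) = (\<Sum>x\<in>A. lc_scale c (g x))"
  by (induction A rule: infinite_finite_induct) (auto simp: lc_scale_add)

lemma keys_lc_scale: "Poly_Mapping.keys (lc_scale c p) \<subseteq> Poly_Mapping.keys p"
  by (auto simp: in_keys_iff lookup_lc_scale)

lemma keys_tree [simp]: "Poly_Mapping.keys (tree t :: ('k::field, 'g) tcomb) = {t}"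
  by (simp add: tree_def)

lemma lc_scale_tree: "lc_scale c (tree t) = Poly_Mapping.single t c"
  by (simp add: tree_def)

text \<open>A combination is the finite sum of its monomials. The claim about partial sums also
  tracks their support, because the case \<open>add\<close> hands over the support of both
  summands.\<close>

lemma lc_induct [consumes 1, case_names zero add scale]:
  fixes p :: "('k::field, 'g) tcomb"
  assumes "Poly_Mapping.keys p \<subseteq> A"
    and "P 0"
    and "\<And>p q. Poly_Mapping.keys p \<subseteq> A \<Longrightarrow> Poly_Mapping.keys q \<subseteq> A \<Longrightarrow> P p \<Longrightarrow> P q \<Longrightarrow> P (p + q)"
    and "\<And>c t. t \<in> A \<Longrightarrow> P (lc_scale c (tree t))"
  shows "P p"
proof -
  have *: "Poly_Mapping.keys (\<Sum>t\<in>B. Poly_Mapping.single t (Poly_Mapping.lookup p t)) \<subseteq> A \<and>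
      P (\<Sum>t\<in>B. Poly_Mapping.single t (Poly_Mapping.lookup p t))" if "finite B" "B \<subseteq> A" for B
    using that
  proof (induction B rule: finite_induct)
    case empty
    then show ?case using assms(2) by simp
  next
    case (insert t B)
    have "P (Poly_Mapping.single t (Poly_Mapping.lookup p t))"
      using assms(4)[of t] insert.prems by (simp add: lc_scale_tree)
    moreover have "Poly_Mapping.keys (Poly_Mapping.single t (Poly_Mapping.lookup p t)) \<subseteq> A"
      using insert.prems by (auto split: if_splits)
    ultimately show ?case
      using insert assms(3) by (simp add: subset_trans[OF keys_add])
  qed
  have "(\<Sum>t\<in>Poly_Mapping.keys p. Poly_Mapping.single t (Poly_Mapping.lookup p t)) = p"
    by (rule poly_mapping_eqI)
      (auto simp: lookup_sum lookup_single when_def in_keys_iff sum.delta)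
  then show ?thesis using *[of "Poly_Mapping.keys p"] assms(1) by simp
qed

text \<open>\<open>lc_map\<close> sums over the support of its argument, which can shrink under
  addition. A common larger index set lets two such sums be added term by term.\<close>

lemma lc_map_superset:
  assumes "finite A" "Poly_Mapping.keys p \<subseteq> A"
  shows "lc_map h p = (\<Sum>t\<in>A. Poly_Mapping.single (h t) (Poly_Mapping.lookup p t))"
  unfolding lc_map_def
  by (rule sum.mono_neutral_left) (use assms in \<open>auto simp: in_keys_iff\<close>)

lemma lc_map_add: "lc_map h (p + q) = lc_map h p + lc_map h q"
proof -
  let ?A = "Poly_Mapping.keys p \<union> Poly_Mapping.keys q"
  show ?thesis
    using lc_map_superset[of ?A "p + q" h] lc_map_superset[of ?A p h] lc_map_superset[of ?A q h]
    by (simp add: keys_add lookup_add single_add sum.distrib)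
qed

lemma lc_map_zero [simp]: "lc_map h 0 = 0"
  by (simp add: lc_map_def)

lemma lc_map_single [simp]: "lc_map h (Poly_Mapping.single t c) = Poly_Mapping.single (h t) c"
  using lc_map_superset[of "{t}" "Poly_Mapping.single t c" h] by simp

lemma lc_map_tree [simp]: "lc_map h (tree t) = tree (h t)"
  by (simp add: tree_def)

lemma lc_map_scale: "lc_map h (lc_scale c p) = lc_scale c (lc_map h p)"
proof -
  have "lc_map h (lc_scale c p) =
      (\<Sum>t\<in>Poly_Mapping.keys p. Poly_Mapping.single (h t) (Poly_Mapping.lookup (lc_scale c p) t))"
    by (rule lc_map_superset) (auto simp: keys_lc_scale)
  then show ?thesis
    by (simp add: lc_map_def lc_scale_sum lookup_lc_scale)
qed

lemma lc_map_uminus: "lc_map h (- p) = - lc_map h p"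
  using lc_map_scale[of h "- 1" p] by simp

lemma lc_map_diff: "lc_map h (p - q) = lc_map h p - lc_map h q"
  using lc_map_add[of h p "- q"] by (simp add: lc_map_uminus)

lemma lc_map_sum: "lc_map h (sum g A) = (\<Sum>x\<in>A. lc_map h (g x))"
  by (induction A rule: infinite_finite_induct) (auto simp: lc_map_add)

lemma keys_lc_map: "Poly_Mapping.keys (lc_map h p) \<subseteq> h ` Poly_Mapping.keys p"
  unfolding lc_map_def by (rule order.trans[OF keys_sum]) (auto split: if_splits)

lemma lc_map_cong:
  assumes "Poly_Mapping.keys p \<subseteq> A" "\<And>t. t \<in> A \<Longrightarrow> h t = g t"
  shows "lc_map h p = lc_map g p"
  unfolding lc_map_def by (rule sum.cong) (use assms in auto)

lemma lc_map_lc_map: 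
  fixes p :: "('k::field, 'g) tcomb"
  shows "lc_map h (lc_map g p) = lc_map (\<lambda>t. h (g t)) p"
proof -
  have "Poly_Mapping.keys p \<subseteq> UNIV" by simp
  then show ?thesis
    by (induction p rule: lc_induct) (auto simp: lc_map_add lc_scale_tree)
qed

text \<open>The same device in both arguments; bilinearity of grafting follows from it.\<close>

lemma lc_graft_superset:
  assumes "finite A" "Poly_Mapping.keys p \<subseteq> A" "finite B" "Poly_Mapping.keys q \<subseteq> B"
  shows "lc_graft i p q = (\<Sum>s\<in>A. \<Sum>t\<in>B.
    Poly_Mapping.single (graft i s t) (Poly_Mapping.lookup p s * Poly_Mapping.lookup q t))"
proof -
  have "lc_graft i p q = (\<Sum>s\<in>Poly_Mapping.keys p. \<Sum>t\<in>B.
      Poly_Mapping.single (graft i s t) (Poly_Mapping.lookup p s * Poly_Mapping.lookup q t))"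
    unfolding lc_graft_def
    by (intro sum.cong refl sum.mono_neutral_left) (use assms in \<open>auto simp: in_keys_iff\<close>)
  also have "\<dots> = (\<Sum>s\<in>A. \<Sum>t\<in>B.
      Poly_Mapping.single (graft i s t) (Poly_Mapping.lookup p s * Poly_Mapping.lookup q t))"
    by (rule sum.mono_neutral_left) (use assms in \<open>auto simp: in_keys_iff\<close>)
  finally show ?thesis .
qed

lemma lc_graft_add_left: "lc_graft i (p + p') q = lc_graft i p q + lc_graft i p' q"
proof -
  let ?A = "Poly_Mapping.keys p \<union> Poly_Mapping.keys p'" and ?B = "Poly_Mapping.keys q"
  show ?thesis
    using lc_graft_superset[of ?A "p + p'" ?B q i] lc_graft_superset[of ?A p ?B q i]
      lc_graft_superset[of ?A p' ?B q i]
    by (simp add: keys_add lookup_add single_add sum.distrib distrib_right)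
qed

lemma lc_graft_add_right: "lc_graft i p (q + q') = lc_graft i p q + lc_graft i p q'"
proof -
  let ?A = "Poly_Mapping.keys p" and ?B = "Poly_Mapping.keys q \<union> Poly_Mapping.keys q'"
  show ?thesis
    using lc_graft_superset[of ?A p ?B "q + q'" i] lc_graft_superset[of ?A p ?B q i]
      lc_graft_superset[of ?A p ?B q' i]
    by (simp add: keys_add lookup_add single_add sum.distrib distrib_left)
qed

lemma lc_graft_zero [simp]: "lc_graft i 0 q = 0" "lc_graft i p 0 = 0"
  by (simp_all add: lc_graft_def)

lemma lc_graft_scale_left: "lc_graft i (lc_scale c p) q = lc_scale c (lc_graft i p q)"
  using lc_graft_superset[of "Poly_Mapping.keys p" "lc_scale c p" "Poly_Mapping.keys q" q i]
  by (simp add: keys_lc_scale lc_graft_def lc_scale_sum lookup_lc_scale mult.assoc)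

lemma lc_graft_scale_right: "lc_graft i p (lc_scale c q) = lc_scale c (lc_graft i p q)"
  using lc_graft_superset[of "Poly_Mapping.keys p" p "Poly_Mapping.keys q" "lc_scale c q" i]
  by (simp add: keys_lc_scale lc_graft_def lc_scale_sum lookup_lc_scale mult.left_commute)

lemma lc_graft_diff_left: "lc_graft i (p - p') q = lc_graft i p q - lc_graft i p' q"
  using lc_graft_add_left[of i p "lc_scale (- 1) p'" q] unfolding lc_graft_scale_left by simp

lemma lc_graft_diff_right: "lc_graft i p (q - q') = lc_graft i p q - lc_graft i p q'"
  using lc_graft_add_right[of i p q "lc_scale (- 1) q'"] unfolding lc_graft_scale_right by simp

lemma lc_graft_sum_left: "lc_graft i (sum g A) q = (\<Sum>x\<in>A. lc_graft i (g x) q)"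
  by (induction A rule: infinite_finite_induct) (auto simp: lc_graft_add_left)

lemma lc_graft_sum_right: "lc_graft i p (sum g A) = (\<Sum>x\<in>A. lc_graft i p (g x))"
  by (induction A rule: infinite_finite_induct) (auto simp: lc_graft_add_right)

lemma lc_graft_tree [simp]: "lc_graft i (tree s) (tree t) = tree (graft i s t)"
  by (simp add: lc_graft_def tree_def)

lemma keys_lc_graft:
  "Poly_Mapping.keys (lc_graft i p q) \<subseteq>
    {graft i s t | s t. s \<in> Poly_Mapping.keys p \<and> t \<in> Poly_Mapping.keys q}"
  unfolding lc_graft_def
  by (rule order.trans[OF keys_sum], rule UN_least, rule order.trans[OF keys_sum])
    (auto split: if_splits)

text \<open>The factors get different maps because a bisuccessor of a composite at one leaf
  restricts to bisuccessors at different leaves of the two factors. Bilinearity reduces the claim to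
  single trees.\<close>

lemma lc_map_lc_graft:
  fixes p :: "('k::field, 'g) tcomb" and q :: "('k, 'g) tcomb"
  assumes p: "Poly_Mapping.keys p \<subseteq> A" and q: "Poly_Mapping.keys q \<subseteq> B"
    and h: "\<And>s t. s \<in> A \<Longrightarrow> t \<in> B \<Longrightarrow> h (graft i s t) = graft i (h1 s) (h2 t)"
  shows "lc_map h (lc_graft i p q) = lc_graft i (lc_map h1 p) (lc_map h2 q)"
  using p
proof (induction p rule: lc_induct)
  case (scale c s)
  have "lc_map h (lc_graft i (tree s) q) = lc_graft i (tree (h1 s)) (lc_map h2 q)"
    using q
    by (induction q rule: lc_induct)
      (use scale h in \<open>auto simp: lc_map_add lc_graft_add_right lc_map_scale lc_graft_scale_right\<close>)
  then show ?case by (simp add: lc_map_scale lc_graft_scale_left)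
qed (auto simp: lc_map_add lc_graft_add_left)

section \<open>Grafting of trees\<close>

lemma leaves_not_Nil [simp]: "leaves t \<noteq> []"
  by (induction t) auto

lemma leaves_map_ptree [simp]: "leaves (map_ptree g h t) = map h (leaves t)"
  by (induction t) auto

lemma vlabels_map_ptree [simp]: "vlabels (map_ptree g h t) = g ` vlabels t"
  by (induction t) auto

lemma map_ptree_cong:
  assumes "\<And>x. x \<in> set (leaves t) \<Longrightarrow> h x = h' x"
  shows "map_ptree g h t = map_ptree g h' t"
  using assms by (induction t) auto

lemma leaves_graft:
  "leaves (graft i s t) = concat (map (\<lambda>j. if j < i then [j]
     else if j = i then map (\<lambda>x. x + i - 1) (leaves t) else [j + length (leaves t) - 1]) (leaves s))"
  by (induction s) auto

lemma vlabels_graft: "vlabels (graft i s t) \<subseteq> vlabels s \<union> vlabels t"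
  by (induction s) auto

lemma ns_trees_subset_sym_trees: "ns_trees G m \<subseteq> sym_trees G m"
  by (auto simp: ns_trees_def sym_trees_def simp del: upt_Suc)

lemma sym_trees_length:
  assumes "t \<in> sym_trees G m"
  shows "length (leaves t) = m" "m \<ge> 1"
proof -
  show "length (leaves t) = m"
    using assms distinct_card[of "leaves t"] by (simp add: sym_trees_def)
  moreover have "length (leaves t) > 0" by simp
  ultimately show "m \<ge> 1" by linarith
qed

lemma ns_trees_length:
  assumes "t \<in> ns_trees G m"
  shows "length (leaves t) = m" "m \<ge> 1"
  using assms sym_trees_length ns_trees_subset_sym_trees by blast+

text \<open>The leaf \<open>i\<close> occurs once, so one block of the concatenation comes from
  \<open>t\<close> and every other block is a single renumbered leaf.\<close>

lemma graft_split:
  assumes "leaves s = as @ [i] @ bs" "i \<notin> set as" "i \<notin> set bs"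
  shows "leaves (graft i s t) = map (\<lambda>j. if j < i then j else j + length (leaves t) - 1) as
    @ map (\<lambda>x. x + i - 1) (leaves t) @ map (\<lambda>j. if j < i then j else j + length (leaves t) - 1) bs"
proof -
  have "concat (map (\<lambda>j. if j < i then [j] else if j = i then map (\<lambda>x. x + i - 1) (leaves t)
      else [j + length (leaves t) - 1]) cs) =
      map (\<lambda>j. if j < i then j else j + length (leaves t) - 1) cs" if "i \<notin> set cs" for cs
    using that by (induction cs) auto
  then show ?thesis using assms by (simp add: leaves_graft)
qed

lemma graft_ns_trees:
  assumes s: "s \<in> ns_trees G m" and t: "t \<in> ns_trees G n" and i: "i \<in> {1..m}"
  shows "graft i s t \<in> ns_trees G (m + n - 1)"
proof -
  have n: "length (leaves t) = n" "n \<ge> 1" using ns_trees_length[OF t] by auto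
  have ls: "leaves s = [1..<i] @ [i] @ [Suc i..<Suc m]"
    using s i upt_add_eq_append[of 1 i "Suc m - i"] upt_conv_Cons[of i "Suc m"]
    by (simp add: ns_trees_def del: upt_Suc)
  have lt: "leaves t = [1..<Suc n]" using t by (simp add: ns_trees_def)
  have 1: "map (\<lambda>j. if j < i then j else j + n - 1) [1..<i] = [1..<i]"
    by (rule map_idI) auto
  have 2: "map (\<lambda>x. x + i - 1) [1..<Suc n] = [i..<i + n]"
    by (rule nth_equalityI) (use i in \<open>auto simp del: upt_Suc\<close>)
  have 3: "map (\<lambda>j. if j < i then j else j + n - 1) [Suc i..<Suc m] = [i + n..<m + n]"
    by (rule nth_equalityI) (use i n in \<open>auto simp del: upt_Suc\<close>)
  have "leaves (graft i s t) = [1..<i] @ [i..<i + n] @ [i + n..<m + n]"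
    using graft_split[OF ls, of t, unfolded n(1) 1 3, unfolded lt 2] by simp
  also have "\<dots> = [1..<Suc (m + n - 1)]"
    using upt_add_eq_append[of i "i + n" "m - i"] upt_add_eq_append[of 1 i "m + n - i"] i n(2)
    by (simp del: upt_Suc add: Suc_diff_le add.commute)
  finally have "leaves (graft i s t) = [1..<Suc (m + n - 1)]" .
  moreover have "vlabels (graft i s t) \<subseteq> G"
    using s t vlabels_graft[of i s t] by (auto simp: ns_trees_def)
  ultimately show ?thesis by (simp add: ns_trees_def del: upt_Suc)
qed

lemma graft_sym_trees:
  assumes s: "s \<in> sym_trees G m" and t: "t \<in> sym_trees G n" and i: "i \<in> {1..m}"
  shows "graft i s t \<in> sym_trees G (m + n - 1)"
proof -
  have n: "length (leaves t) = n" "n \<ge> 1" using sym_trees_length[OF t] by auto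
  have "i \<in> set (leaves s)" using s i by (simp add: sym_trees_def)
  then obtain as bs where ls: "leaves s = as @ [i] @ bs" by (auto dest: split_list)
  have ds: "distinct (as @ [i] @ bs)" and ss: "set (as @ [i] @ bs) = {1..m}"
    using s ls by (auto simp: sym_trees_def)
  have dt: "distinct (leaves t)" and st: "set (leaves t) = {1..n}"
    using t by (auto simp: sym_trees_def)
  \<comment> \<open>The renumbering of the surviving leaves of \<open>s\<close>. On labels other
    than \<open>i\<close> it avoids the block \<open>{i..<i + n}\<close> that the leaves of
    \<open>t\<close> occupy.\<close>
  define h where "h j = (if j < i then j else j + n - 1)" for j
  have lg: "leaves (graft i s t) = map h as @ map (\<lambda>x. x + i - 1) (leaves t) @ map h bs"
    using graft_split[OF ls, of t] ds n by (simp add: h_def[abs_def])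
  have inj: "inj_on h A" for A
    using n by (auto simp: inj_on_def h_def split: if_splits)
  have inj': "inj_on (\<lambda>x. x + i - 1) A" for A
    using i by (auto simp: inj_on_def)
  have im: "(\<lambda>x. x + i - 1) ` {1..n} = {i..<i + n}"
  proof -
    have "(\<lambda>x. x + i - 1) ` {1..n} = (\<lambda>x. x + (i - 1)) ` {1..n}" using i by auto
    also have "\<dots> = {i..<i + n}" using i n by (subst image_add_atLeastAtMost') auto
    finally show ?thesis .
  qed
  have hi: "h ` A \<inter> {i..<i + n} = {}" if "i \<notin> A" for A
  proof -
    have "h y \<notin> {i..<i + n}" if "y \<in> A" for y
    proof -
      have "y \<noteq> i" using that \<open>i \<notin> A\<close> by blast
      then show ?thesis using n by (auto simp: h_def)
    qed
    then show ?thesis by blast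
  qed
  have hab: "set as \<union> set bs = {1..m} - {i}" "set as \<inter> set bs = {}" "i \<notin> set as" "i \<notin> set bs"
    using ds ss by auto
  have "h ` ({1..m} - {i}) = {1..m + n - 1} - {i..<i + n}"
  proof (intro equalityI subsetI)
    fix y assume y: "y \<in> {1..m + n - 1} - {i..<i + n}"
    show "y \<in> h ` ({1..m} - {i})"
    proof (cases "y < i")
      case True
      then show ?thesis using y i by (intro image_eqI[of _ _ y]) (auto simp: h_def)
    next
      case False
      then show ?thesis using y i n by (intro image_eqI[of _ _ "y + 1 - n"]) (auto simp: h_def)
    qed
  qed (use i n in \<open>auto simp: h_def split: if_splits\<close>)
  moreover have "set (leaves (graft i s t)) = h ` (set as \<union> set bs) \<union> {i..<i + n}"
    unfolding lg set_append set_map st im by blast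
  moreover have "{i..<i + n} \<subseteq> {1..m + n - 1}" using i n by auto
  ultimately have set: "set (leaves (graft i s t)) = {1..m + n - 1}"
    unfolding hab(1) by blast
  have "h ` set as \<inter> h ` set bs = {}"
    using hab(2) inj[of UNIV] by (simp add: image_Int[symmetric])
  then have "distinct (leaves (graft i s t))"
    using ds dt st im hi[of "set as"] hi[of "set bs"] hab inj inj'
    by (auto simp: lg distinct_map)
  moreover have "vlabels (graft i s t) \<subseteq> G"
    using s t vlabels_graft[of i s t] by (auto simp: sym_trees_def)
  ultimately show ?thesis using set by (simp add: sym_trees_def)
qed

lemma map_ptree_graft:
  "map_ptree g id (graft i s t) = graft i (map_ptree g id s) (map_ptree g id t)"
  by (induction s) (auto simp: ptree.map_comp o_def id_def)

text \<open>Grafting at leaf 2 first leaves leaf 1 in place. A leaf 0 of \<open>r\<close> would be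
  shifted to 1 by the first grafting and then be replaced by \<open>l\<close> in the second.\<close>

lemma Node_eq_graft:
  assumes "0 \<notin> set (leaves r)"
  shows "graft 1 (graft 2 (Node w (Leaf 1) (Leaf 2)) r) l =
    Node w l (map_ptree id (\<lambda>x. x + length (leaves l)) r)"
proof -
  have "graft 1 (map_ptree id (\<lambda>x. x + 2 - 1) r) l = map_ptree id (\<lambda>x. x + length (leaves l)) r"
    using assms by (induction r) auto
  moreover have "map_ptree id (\<lambda>x. x + 1 - 1) l = l" by (simp add: ptree.map_ident_strong)
  ultimately show ?thesis by simp
qed

text \<open>Decomposes a planar tree operadically at its root. The induction is on the number of
  leaves, since the right factor is a renumbered copy of the right subtree rather than the subtree
  itself.\<close>

lemma ns_trees_induct [consumes 1, case_names leaf node]: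
  assumes "t \<in> ns_trees G m"
    and "P 1 (Leaf 1)"
    and "\<And>w p q l r. w \<in> G \<Longrightarrow> l \<in> ns_trees G p \<Longrightarrow> r \<in> ns_trees G q \<Longrightarrow> P p l \<Longrightarrow> P q r \<Longrightarrow>
      P (p + q) (graft 1 (graft 2 (Node w (Leaf 1) (Leaf 2)) r) l)"
  shows "P m t"
  using assms(1)
proof (induction "length (leaves t)" arbitrary: t m rule: less_induct)
  case less
  show ?case
  proof (cases t)
    case (Leaf x)
    then have "m = 1" "x = 1"
      using less.prems ns_trees_length[OF less.prems] by (auto simp: ns_trees_def)
    then show ?thesis using Leaf assms(2) by simp
  next
    case (Node w l r)
    define p where "p = length (leaves l)"
    define q where "q = length (leaves r)"
    \<comment> \<open>The right subtree carries the leaves \<open>p + 1\<close> to \<open>m\<close>;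
      numbered from 1 it becomes a tree of arity \<open>q\<close>, and grafting \<open>l\<close> at
      leaf 1 restores the shift.\<close>
    define r' where "r' = map_ptree id (\<lambda>x. x - p) r"
    have m: "m = p + q" using ns_trees_length[OF less.prems] Node by (simp add: p_def q_def)
    have lr: "leaves l @ leaves r = [1..<Suc m]"
      using less.prems Node by (simp add: ns_trees_def del: upt_Suc)
    have "[1..<Suc m] = [1..<Suc p] @ [Suc p..<Suc m]"
      using upt_add_eq_append[of 1 "Suc p" q] m by (simp del: upt_Suc)
    then have ll: "leaves l = [1..<Suc p]" and lr: "leaves r = [Suc p..<Suc m]"
      using lr by (simp_all add: p_def append_eq_append_conv del: upt_Suc)
    have "map (\<lambda>x. x - p) [Suc p..<Suc m] = [1..<Suc q]"
      by (rule nth_equalityI) (use m in \<open>auto simp del: upt_Suc\<close>)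
    then have lr': "leaves r' = [1..<Suc q]" by (simp add: r'_def lr del: upt_Suc)
    have v: "w \<in> G" "vlabels l \<subseteq> G" "vlabels r \<subseteq> G"
      using less.prems Node by (auto simp: ns_trees_def)
    have l: "l \<in> ns_trees G p" and r': "r' \<in> ns_trees G q"
      using ll lr' v by (auto simp: ns_trees_def r'_def simp del: upt_Suc)
    have "map_ptree id (\<lambda>x. x + p) r' = map_ptree id (\<lambda>x. x) r"
      unfolding r'_def ptree.map_comp o_def id_def
      by (rule map_ptree_cong) (use lr in \<open>auto simp del: upt_Suc\<close>)
    then have "map_ptree id (\<lambda>x. x + length (leaves l)) r' = r"
      by (simp add: p_def ptree.map_ident_strong)
    moreover have "0 \<notin> set (leaves r')" using lr' by (simp del: upt_Suc)
    ultimately have "t = graft 1 (graft 2 (Node w (Leaf 1) (Leaf 2)) r') l"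
      using Node_eq_graft[of r' w l] Node by simp
    moreover have "length (leaves r') = length (leaves r)" by (simp add: r'_def)
    moreover have "length (leaves l) > 0" "length (leaves r) > 0" by simp_all
    ultimately show ?thesis
      using assms(3)[OF v(1) l r'] less.hyps[OF _ l] less.hyps[OF _ r'] Node m by (simp del: length_greater_0_conv)
  qed
qed

section \<open>Bisuccessors of single trees and of their composites\<close>

lemma leaves_bsu_tree [simp]: "leaves (bsu_tree x t) = leaves t"
  by (induction t) auto

lemma bsu_tree_absent:
  assumes "x \<notin> set (leaves t)" "y \<notin> set (leaves t)"
  shows "bsu_tree x t = bsu_tree y t"
  using assms by (induction t) auto

text \<open>\<open>bsu_tree\<close> only asks which subtrees contain the leaf, so it suffices that
  \<open>g\<close> takes the value \<open>x\<close> at \<open>z\<close> alone. Neither leaf has to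
  occur, which covers the number 0.\<close>

lemma bsu_tree_map_ptree:
  assumes "\<And>j. j \<in> set (leaves t) \<Longrightarrow> g j = x \<longleftrightarrow> j = z"
  shows "bsu_tree x (map_ptree id g t) = map_ptree id g (bsu_tree z t)"
  using assms
proof (induction t)
  case (Node w l r)
  have "x \<in> g ` set (leaves l) \<longleftrightarrow> z \<in> set (leaves l)" "x \<in> g ` set (leaves r) \<longleftrightarrow> z \<in> set (leaves r)"
    using Node.prems by (auto simp: image_iff)
  then show ?case using Node by auto
qed simp

text \<open>The path to \<open>x\<close> either stays in \<open>s\<close>, ending left or right of
  the grafted block, or runs to leaf \<open>i\<close> of \<open>s\<close> and continues in
  \<open>t\<close>. If it stays in \<open>s\<close>, then \<open>t\<close> lies off the path: leaf 0
  does not occur there, so every vertex of \<open>t\<close> gets the star.\<close>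

lemma bsu_tree_graft:
  assumes t: "set (leaves t) = {1..n}" "length (leaves t) = n" and i: "i \<ge> 1"
  shows "bsu_tree x (graft i s t) =
    graft i (bsu_tree (if x < i then x else if x < i + n then i else x + 1 - n) s)
      (bsu_tree (if i \<le> x \<and> x < i + n then x + 1 - i else 0) t)"
    (is "_ = graft i (bsu_tree ?y s) (bsu_tree ?z t)")
proof -
  have n: "n \<ge> 1" using t(2) leaves_not_Nil[of t] by (cases "leaves t") auto
  have shift: "x \<in> (\<lambda>j. j + i - 1) ` {1..n} \<longleftrightarrow> i \<le> x \<and> x < i + n"
    using i by (auto simp: image_iff intro!: bexI[of _ "x + 1 - i"])
  have mem: "x \<in> set (leaves (graft i s t)) \<longleftrightarrow> ?y \<in> set (leaves s)" for s
    using shift t n by (induction s) auto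
  show ?thesis
  proof (induction s)
    case (Leaf j)
    have "bsu_tree x (map_ptree id (\<lambda>x. x + i - 1) t) = map_ptree id (\<lambda>x. x + i - 1) (bsu_tree ?z t)"
      by (rule bsu_tree_map_ptree) (use t i in auto)
    then show ?case by simp
  next
    case (Node w l r)
    then show ?case using mem[of l] mem[of r] by simp
  qed
qed

text \<open>\<open>bsu_tree\<close> produces labels of three shapes, and each is treated by its own
  hypothesis: the star is not derived from the other two, because a map built from lifts need not be
  additive.\<close>

lemma map_ptree_bsu_tree:
  assumes "\<And>w. w \<in> vlabels t \<Longrightarrow> g' (tens Prec w) = tens Prec (g w)"
    and "\<And>w. w \<in> vlabels t \<Longrightarrow> g' (tens Succ w) = tens Succ (g w)"
    and "\<And>w. w \<in> vlabels t \<Longrightarrow> g' (tens Prec w + tens Succ w) = tens Prec (g w) + tens Succ (g w)"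
  shows "map_ptree g' id (bsu_tree x t) = bsu_tree x (map_ptree g id t)"
  using assms
proof (induction t)
  case (Node w l r)
  have "map_ptree g' id (bsu_tree x l) = bsu_tree x (map_ptree g id l)"
    by (rule Node.IH; rule Node.prems; simp)
  moreover have "map_ptree g' id (bsu_tree x r) = bsu_tree x (map_ptree g id r)"
    by (rule Node.IH; rule Node.prems; simp)
  moreover have "g' (if A then tens Prec w else if B then tens Succ w else tens Prec w + tens Succ w) =
      (if A then tens Prec (g w) else if B then tens Succ (g w) else tens Prec (g w) + tens Succ (g w))"
    for A B
    using Node.prems(1)[of w] Node.prems(2)[of w] Node.prems(3)[of w] by (cases A; cases B) (simp_all del: plus_fun_apply)
  ultimately show ?case
    by (simp only: bsu_tree.simps ptree.map leaves_map_ptree list.map_id)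
qed simp

section \<open>Quotients of operads of trees\<close>

lemma keys_add_subset:
  "Poly_Mapping.keys p \<subseteq> A \<Longrightarrow> Poly_Mapping.keys q \<subseteq> A \<Longrightarrow> Poly_Mapping.keys (p + q) \<subseteq> A"
  by (rule order.trans[OF keys_add Un_least])

lemma keys_scale_subset: "Poly_Mapping.keys p \<subseteq> A \<Longrightarrow> Poly_Mapping.keys (lc_scale c p) \<subseteq> A"
  by (rule order.trans[OF keys_lc_scale])

lemma keys_diff_subset:
  "Poly_Mapping.keys p \<subseteq> A \<Longrightarrow> Poly_Mapping.keys q \<subseteq> A \<Longrightarrow> Poly_Mapping.keys (p - q) \<subseteq> A"
  for p q :: "'t \<Rightarrow>\<^sub>0 'k::field"
  using keys_add_subset[of p A "lc_scale (- 1) q"] keys_scale_subset[of q A] by simp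

text \<open>Quotient operations are defined as unions over all representatives; this collapses such
  a union once all its members are the same coset.\<close>

lemma UN_eq_const: "a \<in> X \<Longrightarrow> (\<And>x. x \<in> X \<Longrightarrow> f x = c) \<Longrightarrow> (\<Union>x\<in>X. f x) = c"
  by blast

text \<open>What the nonsymmetric and the symmetric quotient have in common. The action is left out,
  and the record extension \<open>'z\<close> lets \<open>T\<close> be either kind of tree
  operad.\<close>

locale tree_quotient =
  fixes T :: "('k::field, ('k, 'g) tcomb, 'z) ns_operad_scheme"
    and I :: "nat \<Rightarrow> ('k, 'g) tcomb \<Rightarrow> bool"
  assumes struct: "oadd T = (\<lambda>_. (+))" "oscale T = (\<lambda>_. lc_scale)" "ozero T = (\<lambda>_. 0)"
      "ounit T = tree (Leaf 1)" "pcomp T = (\<lambda>_ i _. lc_graft i)"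
    and ops_zero: "0 \<in> ops T m"
    and ops_add: "p \<in> ops T m \<Longrightarrow> q \<in> ops T m \<Longrightarrow> p + q \<in> ops T m"
    and ops_scale: "p \<in> ops T m \<Longrightarrow> lc_scale c p \<in> ops T m"
    and ops_unit: "tree (Leaf 1) \<in> ops T 1"
    and ops_comp: "p \<in> ops T m \<Longrightarrow> q \<in> ops T n \<Longrightarrow> i \<in> {1..m} \<Longrightarrow> lc_graft i p q \<in> ops T (m + n - 1)"
    and ideal_ops: "I m p \<Longrightarrow> p \<in> ops T m"
    and ideal_zero: "I m 0"
    and ideal_add: "I m p \<Longrightarrow> I m q \<Longrightarrow> I m (p + q)"
    and ideal_scale: "I m p \<Longrightarrow> I m (lc_scale c p)"
    and ideal_left: "I m p \<Longrightarrow> q \<in> ops T n \<Longrightarrow> i \<in> {1..m} \<Longrightarrow> I (m + n - 1) (lc_graft i p q)"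
    and ideal_right: "p \<in> ops T m \<Longrightarrow> I n q \<Longrightarrow> i \<in> {1..m} \<Longrightarrow> I (m + n - 1) (lc_graft i p q)"
begin

lemma ops_sum: "(\<And>x. x \<in> A \<Longrightarrow> g x \<in> ops T m) \<Longrightarrow> sum g A \<in> ops T m"
  by (induction A rule: infinite_finite_induct) (auto simp: ops_zero ops_add)

lemma ideal_left_diff:
  "I m (p - p') \<Longrightarrow> q \<in> ops T n \<Longrightarrow> i \<in> {1..m} \<Longrightarrow>
    I (m + n - 1) (lc_graft i p q - lc_graft i p' q)"
  unfolding lc_graft_diff_left[symmetric] by (rule ideal_left)

lemma ideal_right_diff:
  "p \<in> ops T m \<Longrightarrow> I n (q - q') \<Longrightarrow> i \<in> {1..m} \<Longrightarrow>
    I (m + n - 1) (lc_graft i p q - lc_graft i p q')"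
  unfolding lc_graft_diff_right[symmetric] by (rule ideal_right)

lemma ideal_diff: "I m p \<Longrightarrow> I m q \<Longrightarrow> I m (p - q)"
  using ideal_add[of m p "lc_scale (- 1) q"] ideal_scale[of m q "- 1"] by simp

lemma ideal_uminus: "I m p \<Longrightarrow> I m (- p)"
  using ideal_scale[of m p "- 1"] by simp

lemma ideal_sum: "(\<And>x. x \<in> A \<Longrightarrow> I m (g x)) \<Longrightarrow> I m (sum g A)"
  by (induction A rule: infinite_finite_induct) (auto simp: ideal_zero ideal_add)

lemma ideal_trans: "I m (p - q) \<Longrightarrow> I m (q - r) \<Longrightarrow> I m (p - r)"
  using ideal_add[of m "p - q" "q - r"] by simp

text \<open>Telescopes through the mixed composite of \<open>p\<close> and
  \<open>q'\<close>.\<close>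

lemma ideal_comp_cong:
  assumes "I m (p - p')" "I n (q - q')" "p \<in> ops T m" "q' \<in> ops T n" "i \<in> {1..m}"
  shows "I (m + n - 1) (lc_graft i p q - lc_graft i p' q')"
proof -
  have "lc_graft i p q - lc_graft i p' q' = lc_graft i p (q - q') + lc_graft i (p - p') q'"
    by (simp add: lc_graft_diff_left lc_graft_diff_right)
  then show ?thesis
    using ideal_add[OF ideal_right[OF assms(3,2,5)] ideal_left[OF assms(1,4,5)]] by simp
qed

abbreviation cl :: "nat \<Rightarrow> ('k, 'g) tcomb \<Rightarrow> ('k, 'g) tcomb set" where
  "cl \<equiv> coset T I"

lemma mem_cl: "x \<in> cl m p \<longleftrightarrow> I m (x - p)"
  unfolding coset_def by (auto simp: struct intro: exI[of _ "x - p"])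

lemma cl_eq_iff: "cl m p = cl m q \<longleftrightarrow> I m (p - q)"
proof
  assume "cl m p = cl m q"
  then show "I m (p - q)" using mem_cl[of p m p] mem_cl[of p m q] by (simp add: ideal_zero)
next
  assume *: "I m (p - q)"
  then have "I m (q - p)" using ideal_uminus[OF *] by simp
  then have "I m (x - p) \<longleftrightarrow> I m (x - q)" for x
    using ideal_trans[of m x p q] ideal_trans[of m x q p] * by blast
  then show "cl m p = cl m q" by (simp add: set_eq_iff mem_cl)
qed

lemma cl_self: "p \<in> cl m p"
  by (simp add: mem_cl ideal_zero)

lemma quotient_add: "oadd (ns_quotient T I) m (cl m p) (cl m q) = cl m (p + q)"
proof -
  have "cl m (x + y) = cl m (p + q)" if "x \<in> cl m p" "y \<in> cl m q" for x y
    using that ideal_add[of m "x - p" "y - q"] by (simp add: mem_cl cl_eq_iff add_diff_add)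
  then have "(\<Union>x\<in>cl m p. \<Union>y\<in>cl m q. cl m (x + y)) = cl m (p + q)"
    by (intro UN_eq_const[OF cl_self])
  then show ?thesis by (simp add: ns_quotient_def struct)
qed

lemma quotient_scale: "oscale (ns_quotient T I) m c (cl m p) = cl m (lc_scale c p)"
proof -
  have "cl m (lc_scale c x) = cl m (lc_scale c p)" if "x \<in> cl m p" for x
    using that ideal_scale[of m "x - p" c] by (simp add: mem_cl cl_eq_iff lc_scale_diff)
  then have "(\<Union>x\<in>cl m p. cl m (lc_scale c x)) = cl m (lc_scale c p)"
    by (intro UN_eq_const[OF cl_self])
  then show ?thesis by (simp add: ns_quotient_def struct)
qed

lemma quotient_comp:
  assumes "p \<in> ops T m" "q \<in> ops T n" "i \<in> {1..m}"
  shows "pcomp (ns_quotient T I) m i n (cl m p) (cl n q) = cl (m + n - 1) (lc_graft i p q)"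
proof -
  have "cl (m + n - 1) (lc_graft i x y) = cl (m + n - 1) (lc_graft i p q)"
    if "x \<in> cl m p" "y \<in> cl n q" for x y
  proof -
    have x: "I m (x - p)" and y: "I n (y - q)" using that by (auto simp: mem_cl)
    \<comment> \<open>Every representative lies in the carrier, because ideal elements do
      (\<open>ideal_ops\<close>).\<close>
    have "x \<in> ops T m" using ops_add[OF assms(1) ideal_ops[OF x]] by simp
    then show ?thesis using ideal_comp_cong[OF x y _ assms(2,3)] by (simp add: cl_eq_iff)
  qed
  then have "(\<Union>x\<in>cl m p. \<Union>y\<in>cl n q. cl (m + n - 1) (lc_graft i x y)) =
      cl (m + n - 1) (lc_graft i p q)"
    by (intro UN_eq_const[OF cl_self])
  then show ?thesis by (simp add: ns_quotient_def struct)
qed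

lemma ops_quotient: "ops (ns_quotient T I) m = cl m ` ops T m"
  by (simp add: ns_quotient_def)

lemma quotient_unit: "ounit (ns_quotient T I) = cl 1 (tree (Leaf 1))"
  by (simp add: ns_quotient_def struct)

lemma quotient_zero: "ozero (ns_quotient T I) m = cl m 0"
  by (simp add: ns_quotient_def struct)

lemma projection_hom: "ns_operad_hom T (ns_quotient T I) cl"
  unfolding ns_operad_hom_def
  by (auto simp: ops_quotient quotient_add quotient_scale quotient_comp quotient_unit struct)

lemma quotient_scale_zero:
  "X \<in> ops (ns_quotient T I) m \<Longrightarrow> oscale (ns_quotient T I) m 0 X = ozero (ns_quotient T I) m"
  by (auto simp: ops_quotient quotient_scale quotient_zero)

text \<open>The universal property of the quotient. \<open>F\<close> evaluates \<open>G\<close> at a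
  chosen representative, which is harmless by the hypothesis \<open>I\<close>; restricting it to the
  carriers gives the extensionality that \<open>induced_morphism\<close> demands.\<close>

lemma quotient_hom_lift:
  assumes hom: "ns_operad_hom T Q G"
    and I: "\<And>m p q. p \<in> ops T m \<Longrightarrow> q \<in> ops T m \<Longrightarrow> I m (p - q) \<Longrightarrow> G m p = G m q"
  obtains F where "ns_operad_hom (ns_quotient T I) Q F"
    and "\<And>m. F m \<in> extensional (ops (ns_quotient T I) m)"
    and "\<And>m p. p \<in> ops T m \<Longrightarrow> F m (cl m p) = G m p"
proof
  define F where
    "F m = restrict (\<lambda>X. G m (SOME p. p \<in> ops T m \<and> X = cl m p)) (ops (ns_quotient T I) m)" for m
  show ext: "F m \<in> extensional (ops (ns_quotient T I) m)" for m
    by (simp add: F_def)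
  show F: "F m (cl m p) = G m p" if "p \<in> ops T m" for m p
  proof -
    let ?q = "SOME q. q \<in> ops T m \<and> cl m p = cl m q"
    have "?q \<in> ops T m \<and> cl m p = cl m ?q" by (rule someI[of _ p]) (use that in simp)
    then have "G m p = G m ?q" using I[of p m ?q] that by (simp add: cl_eq_iff)
    then show ?thesis using that by (simp add: F_def ops_quotient)
  qed
  show "ns_operad_hom (ns_quotient T I) Q F"
    unfolding ns_operad_hom_def
  proof (intro conjI allI ballI)
    show "F 1 (ounit (ns_quotient T I)) = ounit Q"
      using hom F[OF ops_unit] by (simp add: ns_operad_hom_def struct quotient_unit)
  next
    fix m n i X Y
    assume i: "i \<in> {1..m}" and "X \<in> ops (ns_quotient T I) m" "Y \<in> ops (ns_quotient T I) n"
    then obtain p q where pq: "p \<in> ops T m" "X = cl m p" "q \<in> ops T n" "Y = cl n q"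
      by (auto simp: ops_quotient)
    then show "F (m + n - 1) (pcomp (ns_quotient T I) m i n X Y) = pcomp Q m i n (F m X) (F n Y)"
      using hom i F[OF ops_comp[OF pq(1,3) i]]
      by (simp only: quotient_comp F ns_operad_hom_def struct) 
  qed (use hom in \<open>auto simp: ns_operad_hom_def ops_quotient quotient_add quotient_scale
      struct F ops_add ops_scale\<close>)
qed

end

lemma sym_quotient_simps [simp]:
  "ops (sym_quotient Q I) = ops (ns_quotient Q I)"
  "oadd (sym_quotient Q I) = oadd (ns_quotient Q I)"
  "oscale (sym_quotient Q I) = oscale (ns_quotient Q I)"
  "ozero (sym_quotient Q I) = ozero (ns_quotient Q I)"
  "ounit (sym_quotient Q I) = ounit (ns_quotient Q I)"
  "pcomp (sym_quotient Q I) = pcomp (ns_quotient Q I)"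
  by (simp_all add: sym_quotient_def ns_operad.extend_def sym_operad.fields_def)

lemma forget_simps [simp]:
  "ops (forget Q) = ops Q" "oadd (forget Q) = oadd Q" "oscale (forget Q) = oscale Q"
  "ozero (forget Q) = ozero Q" "ounit (forget Q) = ounit Q" "pcomp (forget Q) = pcomp Q"
  by (simp_all add: forget_def ns_operad.truncate_def)

lemma ns_operad_hom_comp:
  assumes "ns_operad_hom P Q f" "ns_operad_hom Q R g"
  shows "ns_operad_hom P R (\<lambda>m p. g m (f m p))"
  using assms unfolding ns_operad_hom_def by auto

lemma ops_ns_tree_operad [simp]:
  "ops (ns_tree_operad G) m = {p. Poly_Mapping.keys p \<subseteq> ns_trees G m}"
  by (simp add: ns_tree_operad_def)

lemma ops_sym_tree_operad [simp]:
  "ops (sym_tree_operad G) m = {p. Poly_Mapping.keys p \<subseteq> sym_trees G m}"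
  by (simp add: sym_tree_operad_def)

lemma corolla_in_ns_trees: "w \<in> G \<Longrightarrow> Node w (Leaf 1) (Leaf 2) \<in> ns_trees G 2"
  by (simp add: ns_trees_def numeral_2_eq_2)

lemma corolla_in_sym_trees:
  "w \<in> G \<Longrightarrow> Node w (Leaf 1) (Leaf 2) \<in> sym_trees G 2"
  "w \<in> G \<Longrightarrow> Node w (Leaf 2) (Leaf 1) \<in> sym_trees G 2"
  by (auto simp: sym_trees_def)

lemma keys_corolla [simp]: "Poly_Mapping.keys (corolla w) = {Node w (Leaf 1) (Leaf 2)}"
  by (simp add: corolla_def)

lemma lc_graft_ns_trees:
  assumes "Poly_Mapping.keys p \<subseteq> ns_trees G m" "Poly_Mapping.keys q \<subseteq> ns_trees G n" "i \<in> {1..m}"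
  shows "Poly_Mapping.keys (lc_graft i p q) \<subseteq> ns_trees G (m + n - 1)"
  using keys_lc_graft[of i p q] graft_ns_trees[OF _ _ assms(3)] assms by blast

lemma lc_graft_sym_trees:
  assumes "Poly_Mapping.keys p \<subseteq> sym_trees G m" "Poly_Mapping.keys q \<subseteq> sym_trees G n" "i \<in> {1..m}"
  shows "Poly_Mapping.keys (lc_graft i p q) \<subseteq> sym_trees G (m + n - 1)"
  using keys_lc_graft[of i p q] graft_sym_trees[OF _ _ assms(3)] assms by blast

lemma lc_graft_corolla:
  "tree (graft 1 (graft 2 (Node w (Leaf 1) (Leaf 2)) r) l) =
    lc_graft 1 (lc_graft 2 (corolla w) (tree r)) (tree l)"
  unfolding corolla_def lc_graft_tree ..

text \<open>Trees are composites of corollas, and combinations are sums of multiples of trees. The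
  target is a bare record, so the value at 0 has to be computed from the equation of 0 with its
  multiple by the scalar 0; this is what \<open>zero\<close> provides.\<close>

lemma ns_tree_operad_hom_unique:
  assumes F: "ns_operad_hom (ns_tree_operad G) Q F" and F': "ns_operad_hom (ns_tree_operad G) Q F'"
    and zero: "\<And>m X. X \<in> ops Q m \<Longrightarrow> oscale Q m 0 X = ozero Q m"
    and corolla: "\<And>w. w \<in> G \<Longrightarrow> F 2 (corolla w) = F' 2 (corolla w)"
    and p: "p \<in> ops (ns_tree_operad G) m"
  shows "F m p = F' m p"
proof -
  have comp: "H (m + n - 1) (lc_graft i p q) = pcomp Q m i n (H m p) (H n q)"
    if "ns_operad_hom (ns_tree_operad G) Q H" "Poly_Mapping.keys p \<subseteq> ns_trees G m"
      "Poly_Mapping.keys q \<subseteq> ns_trees G n" "i \<in> {1..m}" for H m n i p q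
    using that unfolding ns_operad_hom_def by (simp add: ns_tree_operad_def)
  have tree: "F m (tree t) = F' m (tree t)" if "t \<in> ns_trees G m" for m t
    using that
  proof (induction rule: ns_trees_induct)
    case leaf
    show ?case using F F' by (simp add: ns_operad_hom_def ns_tree_operad_def)
  next
    case (node w p q l r)
    have *: "H (p + q) (tree (graft 1 (graft 2 (Node w (Leaf 1) (Leaf 2)) r) l)) =
        pcomp Q (Suc q) 1 p (pcomp Q 2 2 q (H 2 (corolla w)) (H q (tree r))) (H p (tree l))"
      if H: "ns_operad_hom (ns_tree_operad G) Q H" for H
    proof -
      have c: "Poly_Mapping.keys (corolla w :: ('a, 'b) tcomb) \<subseteq> ns_trees G 2"
        using corolla_in_ns_trees[OF node(1)] by simp
      have k: "Poly_Mapping.keys (tree r :: ('a, 'b) tcomb) \<subseteq> ns_trees G q"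
          "Poly_Mapping.keys (tree l :: ('a, 'b) tcomb) \<subseteq> ns_trees G p"
        using node by auto
      show ?thesis
        unfolding lc_graft_corolla
        using comp[OF H lc_graft_ns_trees[OF c k(1)] k(2), of 2 1] comp[OF H c k(1), of 2]
        by (simp add: add.commute)
    qed
    show ?case unfolding *[OF F] *[OF F'] using node corolla by simp
  qed
  have lin: "H m (p + q) = oadd Q m (H m p) (H m q)" "H m (lc_scale c p) = oscale Q m c (H m p)"
      "H m p \<in> ops Q m"
    if "ns_operad_hom (ns_tree_operad G) Q H" "Poly_Mapping.keys p \<subseteq> ns_trees G m"
      "Poly_Mapping.keys q \<subseteq> ns_trees G m" for H m c p q
    using that unfolding ns_operad_hom_def by (simp_all add: ns_tree_operad_def)
  have H0: "H m 0 = ozero Q m" if H: "ns_operad_hom (ns_tree_operad G) Q H" for H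
    using lin(2)[OF H, of 0 m 0 0] lin(3)[OF H, of 0 m 0] zero by simp
  from p have "Poly_Mapping.keys p \<subseteq> ns_trees G m" by simp
  then show ?thesis
  proof (induction p rule: lc_induct)
    case zero
    show ?case using H0[OF F] H0[OF F'] by simp
  next
    case (add p q)
    then show ?case using lin(1)[OF F] lin(1)[OF F'] by simp
  next
    case (scale c t)
    then show ?case using lin(2)[OF F, of "tree t" m 0] lin(2)[OF F', of "tree t" m 0] tree by simp
  qed
qed

section \<open>Presentations and their bisuccessors\<close>

lemma vector_space_lscale:
  assumes "vector_space (vscale P)"
  shows "vector_space (lscale P)"
  using assms by (simp add: vector_space_def lscale_def fun_eq_iff)

lemma subspace_lscale_iff:
  assumes "vector_space (vscale P)"
  shows "module.subspace (lscale P) S \<longleftrightarrow>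
    0 \<in> S \<and> (\<forall>a\<in>S. \<forall>b\<in>S. a + b \<in> S) \<and> (\<forall>c. \<forall>a\<in>S. lscale P c a \<in> S)"
  using vector_space_lscale[OF assms] module.subspace_def[of "lscale P" S]
  by (simp add: module_iff_vector_space)

lemma lscale_zero:
  assumes "vector_space (vscale P)"
  shows "lscale P c 0 = 0"
  using vector_space_lscale[OF assms] module.scale_zero_right[of "lscale P" c]
  by (simp add: module_iff_vector_space)

lemma ns_tree_operad_struct [simp]:
  "oadd (ns_tree_operad G) = (\<lambda>_. (+))" "oscale (ns_tree_operad G) = (\<lambda>_. lc_scale)"
  "ozero (ns_tree_operad G) = (\<lambda>_. 0)" "ounit (ns_tree_operad G) = tree (Leaf 1)"
  "pcomp (ns_tree_operad G) = (\<lambda>_ i _. lc_graft i)"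
  by (simp_all add: ns_tree_operad_def)

lemma sym_tree_operad_struct [simp]:
  "oadd (sym_tree_operad G) = (\<lambda>_. (+))" "oscale (sym_tree_operad G) = (\<lambda>_. lc_scale)"
  "ozero (sym_tree_operad G) = (\<lambda>_. 0)" "ounit (sym_tree_operad G) = tree (Leaf 1)"
  "pcomp (sym_tree_operad G) = (\<lambda>_ i _. lc_graft i)"
  "oact (sym_tree_operad G) = (\<lambda>_ \<sigma>. lc_map (map_ptree id (inv \<sigma>)))"
  by (simp_all add: sym_tree_operad_def)

lemma keys_corolla_subset:
  "a \<in> G \<Longrightarrow> Poly_Mapping.keys (corolla a) \<subseteq> ns_trees G 2"
  "a \<in> G \<Longrightarrow> Poly_Mapping.keys (corolla a) \<subseteq> sym_trees G 2"
  using corolla_in_ns_trees[of a G] corolla_in_sym_trees[of a G] by simp_all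

lemma keys_linearity_rel:
  assumes "vector_space (vscale P)" "module.subspace (lscale P) (gen P)" "r \<in> linearity_rel P m"
  shows "Poly_Mapping.keys r \<subseteq> ns_trees (gen P) m"
proof -
  have *: "Poly_Mapping.keys (corolla a) \<subseteq> ns_trees (gen P) 2" if "a \<in> gen P" for a
    using keys_corolla_subset(1)[OF that] .
  have add: "a + b \<in> gen P" if "a \<in> gen P" "b \<in> gen P" for a b
    using assms that by (simp add: subspace_lscale_iff)
  have sc: "lscale P c a \<in> gen P" if "a \<in> gen P" for a c
    using assms that by (simp add: subspace_lscale_iff)
  have [simp]: "m = 2" using assms(3) by (auto simp: linearity_rel_def split: if_splits)
  from assms(3) consider
      a b where "r = corolla (a + b) - corolla a - corolla b" "a \<in> gen P" "b \<in> gen P"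
    | c a where "r = corolla (lscale P c a) - lc_scale c (corolla a)" "a \<in> gen P"
    by (auto simp: linearity_rel_def simp del: plus_fun_apply)
  then show ?thesis
  proof cases
    case 1
    then show ?thesis
      using keys_diff_subset[OF keys_diff_subset[OF *[OF add] *] *] by simp
  next
    case 2
    then show ?thesis
      using keys_diff_subset[OF *[OF sc] keys_scale_subset[OF *]] by simp
  qed
qed

lemma tree_quotient_ns:
  assumes P: "ns_presentation P"
  shows "tree_quotient (ns_tree_operad (gen P)) (ns_rel_ideal P)"
proof
  have unit: "Leaf 1 \<in> ns_trees (gen P) 1" by (simp add: ns_trees_def)
  then show "tree (Leaf 1) \<in> ops (ns_tree_operad (gen P)) 1" by simp
  have rel: "Poly_Mapping.keys r \<subseteq> ns_trees (gen P) m" if "r \<in> linearity_rel P m \<union> rel P m" for r m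
    using that P keys_linearity_rel[of P r m] by (auto simp: ns_presentation_def)
  show "p \<in> ops (ns_tree_operad (gen P)) m" if "ns_rel_ideal P m p" for m p
    using that unfolding ns_rel_ideal_def
    by (induction rule: ns_ideal.induct)
      (simp_all add: rel keys_add_subset keys_scale_subset lc_graft_ns_trees[simplified])
qed (simp_all add: keys_add_subset keys_scale_subset lc_graft_ns_trees[simplified] ns_rel_ideal_def
    ns_ideal.ns_zero[where Q = "ns_tree_operad (gen P)", simplified]
    ns_ideal.ns_add[where Q = "ns_tree_operad (gen P)", simplified]
    ns_ideal.ns_scale[where Q = "ns_tree_operad (gen P)", simplified]
    ns_ideal.ns_comp_left[where Q = "ns_tree_operad (gen P)", simplified]
    ns_ideal.ns_comp_right[where Q = "ns_tree_operad (gen P)", simplified])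

lemma lc_map_sym_trees:
  assumes "Poly_Mapping.keys p \<subseteq> sym_trees G m" "\<sigma> permutes {1..m}"
  shows "Poly_Mapping.keys (lc_map (map_ptree id \<sigma>) p) \<subseteq> sym_trees G m"
proof -
  have "map_ptree id \<sigma> t \<in> sym_trees G m" if "t \<in> sym_trees G m" for t
    using that permutes_inj_on[OF assms(2)] permutes_image[OF assms(2)]
    by (simp add: sym_trees_def distinct_map)
  then show ?thesis using keys_lc_map[of "map_ptree id \<sigma>" p] assms(1) by blast
qed

lemma keys_exchange_rel:
  assumes "sym_presentation Q" "r \<in> exchange_rel Q m"
  shows "Poly_Mapping.keys r \<subseteq> sym_trees (gen Q) m"
proof -
  obtain a where a: "a \<in> gen Q" "m = 2" and r: "r = corolla a - tree (Node (twist Q a) (Leaf 2) (Leaf 1))"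
    using assms(2) by (auto simp: exchange_rel_def split: if_splits)
  have "twist Q a \<in> gen Q" using assms(1) a by (simp add: sym_presentation_def)
  then show ?thesis
    using a keys_corolla_subset(2)[of a] corolla_in_sym_trees(2)[of "twist Q a"]
    unfolding r by (intro keys_diff_subset) simp_all
qed

lemma tree_quotient_sym:
  assumes Q: "sym_presentation Q"
  shows "tree_quotient (sym_tree_operad (gen Q)) (sym_rel_ideal Q)"
proof
  have unit: "Leaf 1 \<in> sym_trees (gen Q) 1" by (simp add: sym_trees_def)
  then show "tree (Leaf 1) \<in> ops (sym_tree_operad (gen Q)) 1" by simp
  have rel: "Poly_Mapping.keys r \<subseteq> sym_trees (gen Q) m"
    if "r \<in> linearity_rel Q m \<union> exchange_rel Q m \<union> rel Q m" for r m
  proof -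
    have "vector_space (vscale Q)" "module.subspace (lscale Q) (gen Q)"
      "rel Q m \<subseteq> ops (sym_tree_operad (gen Q)) m"
      using Q by (simp_all add: sym_presentation_def)
    then show ?thesis
      using that keys_linearity_rel[of Q r m] keys_exchange_rel[OF Q, of r m]
        ns_trees_subset_sym_trees[of "gen Q" m]
      unfolding ops_sym_tree_operad by blast
  qed
  show "p \<in> ops (sym_tree_operad (gen Q)) m" if "sym_rel_ideal Q m p" for m p
    using that unfolding sym_rel_ideal_def
    by (induction rule: sym_ideal.induct)
      (simp_all add: rel keys_add_subset keys_scale_subset lc_graft_sym_trees[simplified]
        lc_map_sym_trees[simplified] permutes_inv)
qed (simp_all add: keys_add_subset keys_scale_subset lc_graft_sym_trees[simplified] sym_rel_ideal_def
    sym_ideal.sym_zero[where Q = "sym_tree_operad (gen Q)", simplified]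
    sym_ideal.sym_add[where Q = "sym_tree_operad (gen Q)", simplified]
    sym_ideal.sym_scale[where Q = "sym_tree_operad (gen Q)", simplified]
    sym_ideal.sym_comp_left[where Q = "sym_tree_operad (gen Q)", simplified]
    sym_ideal.sym_comp_right[where Q = "sym_tree_operad (gen Q)", simplified])

lemma sym_rel_ideal_act:
  "sym_rel_ideal Q m p \<Longrightarrow> \<sigma> permutes {1..m} \<Longrightarrow>
    sym_rel_ideal Q m (lc_map (map_ptree id (inv \<sigma>)) p)"
  unfolding sym_rel_ideal_def using sym_ideal.sym_act[where Q = "sym_tree_operad (gen Q)"] by simp

lemma ns_rel_ideal_gen: "r \<in> linearity_rel P m \<union> rel P m \<Longrightarrow> ns_rel_ideal P m r"
  unfolding ns_rel_ideal_def by (rule ns_ideal.ns_gen)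

lemma sym_rel_ideal_gen:
  "r \<in> linearity_rel Q m \<union> exchange_rel Q m \<union> rel Q m \<Longrightarrow> sym_rel_ideal Q m r"
  unfolding sym_rel_ideal_def by (rule sym_ideal.sym_gen)

lemma sym_rel_ideal_linear:
  assumes "a \<in> gen Q" "b \<in> gen Q"
  shows "sym_rel_ideal Q 2 (corolla (a + b) - corolla a - corolla b)"
    and "sym_rel_ideal Q 2 (corolla (lscale Q c a) - lc_scale c (corolla a))"
  by (rule sym_rel_ideal_gen, use assms in \<open>auto simp: linearity_rel_def simp del: plus_fun_apply\<close>)+

section \<open>Labels in tensor products and presentations of bisuccessors\<close>

lemma tens_snoc [simp]: "tens s w (l @ [s']) = (if s = s' then w l else 0)"
  by (simp add: tens_def)

lemma tens_Nil [simp]: "tens s w [] = 0"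
  by (simp add: tens_def)

text \<open>\<open>tens\<close> reads the last letter of a word, so labels are compared by splitting
  words at their end.\<close>

lemma label_eqI: "u [] = v [] \<Longrightarrow> (\<And>l s. u (l @ [s]) = v (l @ [s])) \<Longrightarrow> u = v" for u v :: "'v label"
proof
  show "u l = v l" if "u [] = v []" "\<And>l s. u (l @ [s]) = v (l @ [s])" for l
    using that by (cases l rule: rev_cases) auto
qed

lemma tens_zero [simp]: "tens s 0 = 0"
  by (rule label_eqI) auto

lemma tens_add: "tens s (a + b) = tens s a + tens s b" for a b :: "'v::ab_group_add label"
  by (rule label_eqI) auto

lemma lscale_add:
  assumes "vector_space (vscale P)"
  shows "lscale P c (a + b) = lscale P c a + lscale P c b"
  using vector_space_lscale[OF assms] by (simp add: vector_space_def)

lemma tens_lscale: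
  assumes "vector_space (vscale P)"
  shows "tens s (lscale P c a) = lscale P c (tens s a)"
proof -
  have "vscale P c 0 = 0"
    using assms module.scale_zero_right[of "vscale P" c] by (simp add: module_iff_vector_space)
  then show ?thesis by (intro label_eqI) (auto simp: lscale_def)
qed

lemma tens_components:
  "(\<lambda>l. (tens Prec a + tens Succ b) (l @ [Prec])) = a"
  "(\<lambda>l. (tens Prec a + tens Succ b) (l @ [Succ])) = b"
  for a b :: "'v::ab_group_add label"
  by auto

lemma ns_BSu_simps [simp]:
  "vscale (ns_BSu P) = vscale P"
  "gen (ns_BSu P) = {tens Prec a + tens Succ b | a b. a \<in> gen P \<and> b \<in> gen P}"
  "rel (ns_BSu P) = (\<lambda>m. {lc_map (bsu_tree x) r | x r. x \<in> {1..m} \<and> r \<in> rel P m})"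
  "lscale (ns_BSu P) = lscale P"
  by (simp_all add: ns_BSu_def lscale_def fun_eq_iff)

lemma sym_BSu_simps [simp]:
  "vscale (sym_BSu Q) = vscale Q"
  "gen (sym_BSu Q) = gen (ns_BSu Q)"
  "rel (sym_BSu Q) = rel (ns_BSu Q)"
  "lscale (sym_BSu Q) = lscale Q"
  by (simp_all add: sym_BSu_def lscale_def fun_eq_iff)

lemma twist_sym_BSu:
  "twist (sym_BSu Q) (tens Prec a + tens Succ b) = tens Succ (twist Q a) + tens Prec (twist Q b)"
proof -
  have "twist (sym_BSu Q) = (\<lambda>w. tens Succ (twist Q (\<lambda>l. w (l @ [Prec]))) +
      tens Prec (twist Q (\<lambda>l. w (l @ [Succ]))))"
    by (simp add: sym_BSu_def)
  then show ?thesis by (simp only: tens_components)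
qed

lemma lin_BSu:
  assumes "vector_space (vscale P)" "module.subspace (lscale P) (gen P)"
  shows "module.subspace (lscale P) (gen (ns_BSu P))"
proof -
  have 0: "0 \<in> gen P" and add: "\<And>a b. a \<in> gen P \<Longrightarrow> b \<in> gen P \<Longrightarrow> a + b \<in> gen P"
    and scale: "\<And>c a. a \<in> gen P \<Longrightarrow> lscale P c a \<in> gen P"
    using assms by (simp_all add: subspace_lscale_iff)
  have "0 = tens Prec 0 + tens Succ (0 :: 'b label)" by (simp del: plus_fun_apply)
  moreover have "tens Prec a + tens Succ b + (tens Prec a' + tens Succ b') =
      tens Prec (a + a') + tens Succ (b + b')" for a b a' b' :: "'b label"
    by (simp add: tens_add algebra_simps del: plus_fun_apply)
  moreover have "lscale P c (tens Prec a + tens Succ b) =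
      tens Prec (lscale P c a) + tens Succ (lscale P c b)" for a b c
    using assms(1) by (simp add: tens_lscale lscale_add)
  ultimately show ?thesis
    unfolding subspace_lscale_iff[OF assms(1)] ns_BSu_simps using 0 add scale by blast
qed

lemma tens_in_BSu:
  assumes "0 \<in> gen P" "w \<in> gen P"
  shows "tens Prec w \<in> gen (ns_BSu P)" "tens Succ w \<in> gen (ns_BSu P)"
    "tens Prec w + tens Succ w \<in> gen (ns_BSu P)"
proof -
  have "tens Prec w = tens Prec w + tens Succ 0" "tens Succ w = tens Prec 0 + tens Succ w"
    by (simp_all del: plus_fun_apply)
  then show "tens Prec w \<in> gen (ns_BSu P)" "tens Succ w \<in> gen (ns_BSu P)"
    "tens Prec w + tens Succ w \<in> gen (ns_BSu P)"
    unfolding ns_BSu_simps using assms by blast+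
qed

lemma vlabels_bsu_tree:
  assumes "0 \<in> gen P" "vlabels t \<subseteq> gen P"
  shows "vlabels (bsu_tree x t) \<subseteq> gen (ns_BSu P)"
  using assms(2) 
proof (induction t)
  case (Node w l r)
  then show ?case using tens_in_BSu[OF assms(1), of w]
    by (simp del: ns_BSu_simps plus_fun_apply)
qed simp

lemma lc_map_bsu_tree_ns:
  assumes "0 \<in> gen P" "Poly_Mapping.keys p \<subseteq> ns_trees (gen P) m"
  shows "Poly_Mapping.keys (lc_map (bsu_tree x) p) \<subseteq> ns_trees (gen (ns_BSu P)) m"
proof -
  have "bsu_tree x t \<in> ns_trees (gen (ns_BSu P)) m" if "t \<in> ns_trees (gen P) m" for t
    using that vlabels_bsu_tree[OF assms(1), of t x]
    by (simp add: ns_trees_def del: ns_BSu_simps upt_Suc)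
  then show ?thesis using keys_lc_map[of "bsu_tree x" p] assms(2) by blast
qed

lemma lc_map_bsu_tree_sym:
  assumes "0 \<in> gen P" "Poly_Mapping.keys p \<subseteq> sym_trees (gen P) m"
  shows "Poly_Mapping.keys (lc_map (bsu_tree x) p) \<subseteq> sym_trees (gen (ns_BSu P)) m"
proof -
  have "bsu_tree x t \<in> sym_trees (gen (ns_BSu P)) m" if "t \<in> sym_trees (gen P) m" for t
    using that vlabels_bsu_tree[OF assms(1), of t x]
    by (simp add: sym_trees_def del: ns_BSu_simps)
  then show ?thesis using keys_lc_map[of "bsu_tree x" p] assms(2) by blast
qed

lemma ns_presentationD:
  assumes "ns_presentation P"
  shows "vector_space (vscale P)" "0 \<in> gen P"
    "a \<in> gen P \<Longrightarrow> b \<in> gen P \<Longrightarrow> a + b \<in> gen P" "a \<in> gen P \<Longrightarrow> lscale P c a \<in> gen P"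
    "r \<in> rel P m \<Longrightarrow> Poly_Mapping.keys r \<subseteq> ns_trees (gen P) m"
  using assms unfolding ns_presentation_def by (auto simp: subspace_lscale_iff simp del: plus_fun_apply)

lemma sym_presentationD:
  assumes "sym_presentation Q"
  shows "vector_space (vscale Q)" "0 \<in> gen Q"
    "a \<in> gen Q \<Longrightarrow> b \<in> gen Q \<Longrightarrow> a + b \<in> gen Q" "a \<in> gen Q \<Longrightarrow> lscale Q c a \<in> gen Q"
    "r \<in> rel Q m \<Longrightarrow> Poly_Mapping.keys r \<subseteq> sym_trees (gen Q) m"
    "a \<in> gen Q \<Longrightarrow> twist Q a \<in> gen Q" "a \<in> gen Q \<Longrightarrow> twist Q (twist Q a) = a"
    "a \<in> gen Q \<Longrightarrow> b \<in> gen Q \<Longrightarrow> twist Q (a + b) = twist Q a + twist Q b"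
    "a \<in> gen Q \<Longrightarrow> twist Q (lscale Q c a) = lscale Q c (twist Q a)"
  using assms unfolding sym_presentation_def subset_eq[where B = "ops _ _"]
  by (auto simp: subspace_lscale_iff simp del: plus_fun_apply)

lemma twist_zero:
  assumes "sym_presentation Q"
  shows "twist Q 0 = 0"
  using sym_presentationD(8)[OF assms sym_presentationD(2)[OF assms] sym_presentationD(2)[OF assms]]
  by (simp del: plus_fun_apply)

lemma ns_presentation_BSu:
  assumes P: "ns_presentation P"
  shows "ns_presentation (ns_BSu P)"
proof -
  have "rel (ns_BSu P) m \<subseteq> ops (ns_tree_operad (gen (ns_BSu P))) m" for m
  proof
    fix r assume "r \<in> rel (ns_BSu P) m"
    then obtain x r' where "r = lc_map (bsu_tree x) r'" "r' \<in> rel P m" by auto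
    then show "r \<in> ops (ns_tree_operad (gen (ns_BSu P))) m"
      using lc_map_bsu_tree_ns[OF ns_presentationD(2)[OF P] ns_presentationD(5)[OF P]]
      by (simp del: ns_BSu_simps)
  qed
  then show ?thesis
    using P lin_BSu[of P] by (simp add: ns_presentation_def del: ns_BSu_simps(2,3) ops_ns_tree_operad)
qed

lemma sym_presentation_BSu:
  assumes Q: "sym_presentation Q"
  shows "sym_presentation (sym_BSu Q)"
proof -
  have rel: "rel (sym_BSu Q) m \<subseteq> ops (sym_tree_operad (gen (sym_BSu Q))) m" for m
  proof
    fix r assume "r \<in> rel (sym_BSu Q) m"
    then obtain x r' where "r = lc_map (bsu_tree x) r'" "r' \<in> rel Q m" by auto
    then show "r \<in> ops (sym_tree_operad (gen (sym_BSu Q))) m"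
      using lc_map_bsu_tree_sym[OF sym_presentationD(2)[OF Q] sym_presentationD(5)[OF Q]]
      by (simp del: ns_BSu_simps)
  qed
  note tw = sym_presentationD(6-9)[OF Q]
  have gens: "\<exists>a b. u = tens Prec a + tens Succ b \<and> a \<in> gen Q \<and> b \<in> gen Q"
    if "u \<in> gen (sym_BSu Q)" for u using that by auto
  have mem: "tens Prec a + tens Succ b \<in> gen (sym_BSu Q)" if "a \<in> gen Q" "b \<in> gen Q" for a b
    using that by auto
  have 1: "twist (sym_BSu Q) u \<in> gen (sym_BSu Q) \<and> twist (sym_BSu Q) (twist (sym_BSu Q) u) = u"
    if uv: "u \<in> gen (sym_BSu Q)" for u
  proof -
    obtain a b where u: "u = tens Prec a + tens Succ b" "a \<in> gen Q" "b \<in> gen Q" 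
      using gens[OF uv] by blast
    have "twist (sym_BSu Q) u = tens Prec (twist Q b) + tens Succ (twist Q a)"
      unfolding u twist_sym_BSu by (rule add.commute)
    then show ?thesis using mem[of "twist Q b" "twist Q a"] tw u
      by (simp add: twist_sym_BSu add.commute del: plus_fun_apply sym_BSu_simps)
  qed
  have 2: "twist (sym_BSu Q) (u + v) = twist (sym_BSu Q) u + twist (sym_BSu Q) v"
    if uv: "u \<in> gen (sym_BSu Q)" "v \<in> gen (sym_BSu Q)" for u v
  proof -
    obtain a b where u: "u = tens Prec a + tens Succ b" "a \<in> gen Q" "b \<in> gen Q" 
      using gens[OF uv(1)] by blast
    obtain a' b' where v: "v = tens Prec a' + tens Succ b'" "a' \<in> gen Q" "b' \<in> gen Q" 
      using gens[OF uv(2)] by blast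
    have "u + v = tens Prec (a + a') + tens Succ (b + b')"
      unfolding u v by (simp add: tens_add algebra_simps del: plus_fun_apply)
    then have "twist (sym_BSu Q) (u + v) = tens Succ (twist Q (a + a')) + tens Prec (twist Q (b + b'))"
      by (simp only: twist_sym_BSu)
    also have "\<dots> = twist (sym_BSu Q) u + twist (sym_BSu Q) v"
      unfolding u(1) v(1) twist_sym_BSu tw(3)[OF u(2) v(2)] tw(3)[OF u(3) v(3)] tens_add
      by (simp only: add_ac)
    finally show ?thesis .
  qed
  have 3: "twist (sym_BSu Q) (lscale Q c u) = lscale Q c (twist (sym_BSu Q) u)"
    if uv: "u \<in> gen (sym_BSu Q)" for c u
  proof -
    obtain a b where u: "u = tens Prec a + tens Succ b" "a \<in> gen Q" "b \<in> gen Q" 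
      using gens[OF uv] by blast
    have "lscale Q c u = tens Prec (lscale Q c a) + tens Succ (lscale Q c b)"
      unfolding u using Q by (simp add: tens_lscale lscale_add sym_presentationD)
    then have "twist (sym_BSu Q) (lscale Q c u) =
        tens Succ (twist Q (lscale Q c a)) + tens Prec (twist Q (lscale Q c b))"
      by (simp only: twist_sym_BSu)
    also have "\<dots> = lscale Q c (twist (sym_BSu Q) u)"
      unfolding u(1) twist_sym_BSu tw(4)[OF u(2)] tw(4)[OF u(3)]
      using Q by (simp only: tens_lscale lscale_add sym_presentationD(1))
    finally show ?thesis .
  qed
  show ?thesis
    unfolding sym_presentation_def
    using rel 1 2 3 Q lin_BSu[of Q]
    by (simp add: sym_presentation_def del: ns_BSu_simps(2,3) ops_sym_tree_operad sym_BSu_simps(3))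
qed

section \<open>The ideal of relations under bisuccessors\<close>

lemma sym_trees_standardize:
  assumes "t \<in> sym_trees G m"
  obtains \<pi> t0 where "\<pi> permutes {1..m}" "t0 \<in> ns_trees G m" "t = map_ptree id \<pi> t0"
proof -
  have len: "length (leaves t) = m" using sym_trees_length[OF assms] by simp
  have d: "distinct (leaves t)" and s: "set (leaves t) = {1..m}" and v: "vlabels t \<subseteq> G"
    using assms by (auto simp: sym_trees_def)
  \<comment> \<open>Sends the position \<open>j\<close>, counted from 1, to the label of the leaf
    there; list positions start at 0, hence \<open>j - 1\<close>. Undoing \<pi> numbers the leaves
    from left to right.\<close>
  define \<pi> where "\<pi> j = (if j \<in> {1..m} then leaves t ! (j - 1) else j)" for j
  have map: "map \<pi> [1..<Suc m] = leaves t"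
    by (rule nth_equalityI) (auto simp: len \<pi>_def simp del: upt_Suc)
  have set1: "set [1..<Suc m] = {1..m}" by auto
  have img: "\<pi> ` {1..m} = {1..m}"
    using arg_cong[OF map, of set] s unfolding set_map set1 by simp
  then have "bij_betw \<pi> {1..m} {1..m}"
    by (simp add: bij_betw_def eq_card_imp_inj_on)
  then have perm: "\<pi> permutes {1..m}"
    by (rule bij_imp_permutes) (auto simp: \<pi>_def)
  define t0 where "t0 = map_ptree id (inv \<pi>) t"
  have "leaves t0 = map (inv \<pi>) (map \<pi> [1..<Suc m])" by (simp only: t0_def leaves_map_ptree map)
  also have "\<dots> = [1..<Suc m]" using permutes_inverses(2)[OF perm] by (simp add: o_def del: upt_Suc)
  finally have "t0 \<in> ns_trees G m" using v by (simp add: ns_trees_def t0_def del: upt_Suc)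
  moreover have "t = map_ptree id \<pi> t0"
    using permutes_inverses(1)[OF perm] by (simp add: t0_def ptree.map_comp o_def ptree.map_ident_strong)
  ultimately show ?thesis using perm that by blast
qed

text \<open>The label that a corolla receives from its bisuccessor at \<open>x\<close>; any
  \<open>x\<close> other than 1 and 2 gives the star. For each \<open>x\<close> it is linear in
  \<open>w\<close>, which is why linearity relations go to linearity relations.\<close>

definition bsu_label :: "nat \<Rightarrow> 'v::ab_group_add label \<Rightarrow> 'v label" where
  "bsu_label x w = (if x = 1 then tens Prec w else if x = 2 then tens Succ w else tens Prec w + tens Succ w)"

lemma bsu_tree_corolla:
  "bsu_tree x (Node w (Leaf 1) (Leaf 2)) = Node (bsu_label x w) (Leaf 1) (Leaf 2)"
  by (simp add: bsu_label_def del: plus_fun_apply)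

lemma lc_map_bsu_corolla: "lc_map (bsu_tree x) (corolla w) = corolla (bsu_label x w)"
  unfolding corolla_def lc_map_tree bsu_tree_corolla ..

lemma bsu_label_add: "bsu_label x (a + b) = bsu_label x a + bsu_label x b"
  by (simp add: bsu_label_def tens_add algebra_simps del: plus_fun_apply)

lemma bsu_label_lscale:
  "vector_space (vscale P) \<Longrightarrow> bsu_label x (lscale P c a) = lscale P c (bsu_label x a)"
  by (simp add: bsu_label_def tens_lscale lscale_add del: plus_fun_apply)

lemma bsu_label_in_BSu: "0 \<in> gen P \<Longrightarrow> w \<in> gen P \<Longrightarrow> bsu_label x w \<in> gen (ns_BSu P)"
  using tens_in_BSu[of P w] by (simp add: bsu_label_def del: ns_BSu_simps plus_fun_apply)

lemma linearity_rel_BSu: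
  assumes "vector_space (vscale P)" "0 \<in> gen P" "r \<in> linearity_rel P m"
  shows "lc_map (bsu_tree x) r \<in> linearity_rel (ns_BSu P) m"
proof -
  note mem = bsu_label_in_BSu[OF assms(2)]
  have m: "m = 2" using assms(3) by (auto simp: linearity_rel_def split: if_splits)
  from assms(3) consider
      a b where "r = corolla (a + b) - corolla a - corolla b" "a \<in> gen P" "b \<in> gen P"
    | c a where "r = corolla (lscale P c a) - lc_scale c (corolla a)" "a \<in> gen P"
    by (auto simp: linearity_rel_def m simp del: plus_fun_apply)
  then show ?thesis
  proof cases
    case 1
    then have "lc_map (bsu_tree x) r =
        corolla (bsu_label x a + bsu_label x b) - corolla (bsu_label x a) - corolla (bsu_label x b)"
      by (simp only: lc_map_diff lc_map_bsu_corolla bsu_label_add)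
    then show ?thesis
      unfolding linearity_rel_def m using mem[OF 1(2)] mem[OF 1(3)] by (simp del: ns_BSu_simps plus_fun_apply) blast
  next
    case 2
    then have "lc_map (bsu_tree x) r =
        corolla (lscale (ns_BSu P) c (bsu_label x a)) - lc_scale c (corolla (bsu_label x a))"
      using assms(1) by (simp add: lc_map_diff lc_map_scale lc_map_bsu_corolla bsu_label_lscale)
    then show ?thesis
      unfolding linearity_rel_def m using mem[OF 2(2)] by (simp del: ns_BSu_simps plus_fun_apply) blast
  qed
qed

text \<open>After exchanging the subtrees, a path that turned left turns right, and the twist of the
  bisuccessor swaps the two sides accordingly. The star is symmetric under this swap.\<close>

lemma exchange_rel_BSu:
  assumes "sym_presentation Q" "r \<in> exchange_rel Q m"
  shows "lc_map (bsu_tree x) r \<in> exchange_rel (sym_BSu Q) m"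
proof -
  obtain a where a: "a \<in> gen Q" and m: "m = 2"
    and r: "r = corolla a - tree (Node (twist Q a) (Leaf 2) (Leaf 1))"
    using assms(2) by (auto simp: exchange_rel_def split: if_splits)
  have mem: "bsu_label x a \<in> gen (sym_BSu Q)"
    using bsu_label_in_BSu[OF sym_presentationD(2)[OF assms(1)] a] by (simp del: ns_BSu_simps)
  have tw: "twist (sym_BSu Q) (tens Prec a) = tens Succ (twist Q a)"
    "twist (sym_BSu Q) (tens Succ a) = tens Prec (twist Q a)"
    "twist (sym_BSu Q) (tens Prec a + tens Succ a) = tens Prec (twist Q a) + tens Succ (twist Q a)"
    \<comment> \<open>A pure tensor is read as a sum with one zero component, whose twist is zero as
      well.\<close>
    using twist_sym_BSu[of Q a 0] twist_sym_BSu[of Q 0 a] twist_sym_BSu[of Q a a] twist_zero[OF assms(1)]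
    by (simp_all add: add.commute del: plus_fun_apply)
  have "bsu_tree x (Node (twist Q a) (Leaf 2) (Leaf 1)) =
      Node (twist (sym_BSu Q) (bsu_label x a)) (Leaf 2) (Leaf 1)"
    using tw by (simp add: bsu_label_def del: plus_fun_apply)
  then have "lc_map (bsu_tree x) r =
      corolla (bsu_label x a) - tree (Node (twist (sym_BSu Q) (bsu_label x a)) (Leaf 2) (Leaf 1))"
    unfolding r lc_map_diff lc_map_bsu_corolla lc_map_tree by (rule arg_cong)
  then show ?thesis unfolding exchange_rel_def m using mem by auto
qed

text \<open>
  Expanding \<open>\<omega>\<^sub>\<star> = \<omega>\<^sub>\<prec> + \<omega>\<^sub>\<succ>\<close> along the path of each leaf: a tree with \<open>\<star>\<close> at every
  vertex is the sum of its bisuccessors modulo the relations.  The leaf \<open>0\<close> occurs in no tree, so \<open>bsu_tree 0\<close> puts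
  \<open>\<star>\<close> everywhere.
\<close>

lemma bsu_star_eq_sum_ns:
  fixes Q :: "('k::field, 'w::ab_group_add) sym_pres"
  assumes Q: "sym_presentation Q" and t: "t \<in> ns_trees (gen Q) m"
  shows "sym_rel_ideal (sym_BSu Q) m
    (tree (bsu_tree 0 t) - (\<Sum>x\<in>{1..m}. tree (bsu_tree x t)))"
proof -
  interpret B: tree_quotient "sym_tree_operad (gen (sym_BSu Q))" "sym_rel_ideal (sym_BSu Q)"
    using tree_quotient_sym[OF sym_presentation_BSu[OF Q]] .
  from t show ?thesis
  proof (induction rule: ns_trees_induct)
    case leaf
    then show ?case by (simp add: B.ideal_zero del: sym_BSu_simps)
  next
    case (node w p q l r)
    let ?L = "\<lambda>x. tree (bsu_tree x l) :: ('k, 'w label) tcomb"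
      and ?R = "\<lambda>x. tree (bsu_tree x r) :: ('k, 'w label) tcomb"
    let ?A = "corolla (tens Prec w) :: ('k, 'w label) tcomb" and ?B = "corolla (tens Succ w) :: ('k, 'w label) tcomb"
      and ?C = "corolla (tens Prec w + tens Succ w) :: ('k, 'w label) tcomb"
    let ?t = "graft 1 (graft 2 (Node w (Leaf 1) (Leaf 2)) r) l"
    let ?I = "sym_rel_ideal (sym_BSu Q)" and ?ops = "ops (sym_tree_operad (gen (sym_BSu Q)) :: ('k, ('k, 'w label) tcomb) sym_operad)"
    have l: "set (leaves l) = {1..p}" "length (leaves l) = p"
      and r: "set (leaves r) = {1..q}" "length (leaves r) = q" and pq: "p \<ge> 1" "q \<ge> 1"
      using node(2,3) ns_trees_length[OF node(2)] ns_trees_length[OF node(3)]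
      by (auto simp: ns_trees_def)
    have b0: "tree (bsu_tree 0 ?t) = lc_graft 1 (lc_graft 2 ?C (?R 0)) (?L 0)"
      by (simp add: bsu_tree_graft[OF l] bsu_tree_graft[OF r] corolla_def del: graft.simps plus_fun_apply)
    have bl: "tree (bsu_tree x ?t) = lc_graft 1 (lc_graft 2 ?A (?R 0)) (?L x)" if "x \<in> {1..p}" for x
      using that
      by (simp add: bsu_tree_graft[OF l] bsu_tree_graft[OF r] corolla_def del: graft.simps plus_fun_apply)
    \<comment> \<open>In the composite the leaves of \<open>r\<close> come after the
      \<open>p\<close> leaves of \<open>l\<close>, hence \<open>x + p\<close>.\<close>
    have br: "tree (bsu_tree (x + p) ?t) = lc_graft 1 (lc_graft 2 ?B (?R x)) (?L 0)" if "x \<in> {1..q}" for x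
      using that
      by (simp add: bsu_tree_graft[OF l] bsu_tree_graft[OF r] corolla_def Suc_diff_le
          del: graft.simps plus_fun_apply)
    let ?SL = "\<Sum>x\<in>{1..p}. ?L x" and ?SR = "\<Sum>x\<in>{1..q}. ?R x"
    have "sum g {1..p + q} = sum g {1..p} + (\<Sum>x\<in>{1..q}. g (x + p))" for g :: "nat \<Rightarrow> ('k, 'w label) tcomb"
      using sum.ub_add_nat[of 1 p g q] sum.shift_bounds_cl_nat_ivl[of g 1 p q]
      by (simp add: add.commute)
    then have "(\<Sum>x\<in>{1..p + q}. tree (bsu_tree x ?t) :: ('k, 'w label) tcomb) =
        (\<Sum>x\<in>{1..p}. tree (bsu_tree x ?t)) + (\<Sum>x\<in>{1..q}. tree (bsu_tree (x + p) ?t))" .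
    also have "\<dots> = (\<Sum>x\<in>{1..p}. lc_graft 1 (lc_graft 2 ?A (?R 0)) (?L x)) +
        (\<Sum>x\<in>{1..q}. lc_graft 1 (lc_graft 2 ?B (?R x)) (?L 0))"
      using bl br by (intro arg_cong2[where f = "(+)"] sum.cong refl)
    also have "\<dots> = lc_graft 1 (lc_graft 2 ?A (?R 0)) ?SL + lc_graft 1 (lc_graft 2 ?B ?SR) (?L 0)"
      by (simp only: lc_graft_sum_left lc_graft_sum_right)
    finally have sum: "(\<Sum>x\<in>{1..p + q}. tree (bsu_tree x ?t)) =
      lc_graft 1 (lc_graft 2 ?A (?R 0)) ?SL + lc_graft 1 (lc_graft 2 ?B ?SR) (?L 0)" .
    have zero: "0 \<in> gen Q" using sym_presentationD[OF Q] by blast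
    have mem: "tens Prec w \<in> gen (sym_BSu Q)" "tens Succ w \<in> gen (sym_BSu Q)"
        "tens Prec w + tens Succ w \<in> gen (sym_BSu Q)"
      using tens_in_BSu[OF zero node(1)] by (simp_all only: sym_BSu_simps)
    have ops2: "?A \<in> ?ops 2" "?B \<in> ?ops 2" "?C \<in> ?ops 2"
      using mem by (simp_all only: ops_sym_tree_operad mem_Collect_eq keys_corolla_subset)
    have opsL: "?L x \<in> ?ops p" for x
      using lc_map_bsu_tree_sym[OF zero, of "tree l" p x] ns_trees_subset_sym_trees[of "gen Q" p] node(2)
      by (simp del: ns_BSu_simps) blast
    have opsR: "?R x \<in> ?ops q" for x
      using lc_map_bsu_tree_sym[OF zero, of "tree r" q x] ns_trees_subset_sym_trees[of "gen Q" q] node(3)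
      by (simp del: ns_BSu_simps) blast
    have opsSL: "?SL \<in> ?ops p" by (rule B.ops_sum, rule opsL)
    have opsSR: "?SR \<in> ?ops q" by (rule B.ops_sum, rule opsR)
    have q: "2 + q - 1 = q + 1" and qp: "q + 1 + p - 1 = p + q" by simp_all
    have c: "?I 2 (?C - (?A + ?B))"
      using sym_rel_ideal_linear(1)[OF mem(1,2)] by (simp only: diff_diff_eq)
    have AB: "?A + ?B \<in> ?ops 2" using B.ops_add[OF ops2(1,2)] .
    have 22: "2 \<in> {1..2::nat}" and 11: "1 \<in> {1..q + 1}" by auto
    \<comment> \<open>Three replacements, each carried through the remaining graftings: the star at
      the root by its two parts, then the left subtree of the \<open>Prec\<close> term and the right
      subtree of the \<open>Succ\<close> term by the sums of the induction hypotheses. The other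
      subtree keeps its stars, as it is off the path.\<close>
    have e1: "?I (q + 1) (lc_graft 2 ?C (?R 0) - lc_graft 2 (?A + ?B) (?R 0))"
      using B.ideal_left_diff[OF c opsR 22] unfolding q .
    have e2: "?I (q + 1) (lc_graft 2 ?B (?R 0) - lc_graft 2 ?B ?SR)"
      using B.ideal_right_diff[OF ops2(2) node(5) 22] unfolding q .
    have graft_ops: "lc_graft 2 x y \<in> ?ops (q + 1)" if "x \<in> ?ops 2" "y \<in> ?ops q" for x y
      using B.ops_comp[OF that 22] unfolding q .
    have f1: "?I (p + q) (lc_graft 1 (lc_graft 2 ?C (?R 0)) (?L 0) -
        lc_graft 1 (lc_graft 2 (?A + ?B) (?R 0)) (?L 0))"
      using B.ideal_left_diff[OF e1 opsL 11] unfolding qp .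
    have f2: "?I (p + q) (lc_graft 1 (lc_graft 2 ?A (?R 0)) (?L 0) -
        lc_graft 1 (lc_graft 2 ?A (?R 0)) ?SL)"
      using B.ideal_right_diff[OF graft_ops[OF ops2(1) opsR] node(4) 11] unfolding qp .
    have f3: "?I (p + q) (lc_graft 1 (lc_graft 2 ?B (?R 0)) (?L 0) -
        lc_graft 1 (lc_graft 2 ?B ?SR) (?L 0))"
      using B.ideal_left_diff[OF e2 opsL 11] unfolding qp .
    have "lc_graft 1 (lc_graft 2 (?A + ?B) (?R 0)) (?L 0) =
        lc_graft 1 (lc_graft 2 ?A (?R 0)) (?L 0) + lc_graft 1 (lc_graft 2 ?B (?R 0)) (?L 0)"
      by (simp only: lc_graft_add_left)
    then show ?case
      using B.ideal_add[OF f1 B.ideal_add[OF f2 f3]] unfolding b0 sum by (simp add: algebra_simps)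
  qed
qed

text \<open>Renumbering by \<pi> turns the bisuccessor at \<open>x\<close> into the one at the image
  of \<open>x\<close>, and the sum over all leaves does not notice the reindexing. So the planar
  case transfers through the action on the ideal.\<close>

lemma bsu_star_eq_sum:
  fixes Q :: "('k::field, 'w::ab_group_add) sym_pres"
  assumes Q: "sym_presentation Q" and p: "Poly_Mapping.keys p \<subseteq> sym_trees (gen Q) m"
  shows "sym_rel_ideal (sym_BSu Q) m
    (lc_map (bsu_tree 0) p - (\<Sum>x\<in>{1..m}. lc_map (bsu_tree x) p))"
proof -
  interpret B: tree_quotient "sym_tree_operad (gen (sym_BSu Q))" "sym_rel_ideal (sym_BSu Q)"
    using tree_quotient_sym[OF sym_presentation_BSu[OF Q]] .
  let ?D = "\<lambda>p :: ('k, 'w label) tcomb. lc_map (bsu_tree 0) p - (\<Sum>x\<in>{1..m}. lc_map (bsu_tree x) p)"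
  have tree: "sym_rel_ideal (sym_BSu Q) m (?D (tree t))" if "t \<in> sym_trees (gen Q) m" for t
  proof -
    obtain \<pi> t0 where \<pi>: "\<pi> permutes {1..m}" and t0: "t0 \<in> ns_trees (gen Q) m" and t: "t = map_ptree id \<pi> t0"
      using sym_trees_standardize[OF \<open>t \<in> _\<close>] by blast
    have lt0: "set (leaves t0) = {1..m}" using t0 by (auto simp: ns_trees_def)
    have inj: "\<pi> j = \<pi> x \<longleftrightarrow> j = x" for j x using permutes_inj[OF \<pi>] by (auto dest: injD)
    \<comment> \<open>A permutation of \<open>{1..m}\<close> fixes 0, so stars everywhere remain
      stars everywhere.\<close>
    have "\<pi> 0 = 0" using \<pi> by (auto simp: permutes_def)
    then have "bsu_tree 0 t = map_ptree id \<pi> (bsu_tree 0 t0)"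
      unfolding t using inj[of _ 0] by (intro bsu_tree_map_ptree) simp
    moreover have "bsu_tree (\<pi> x) t = map_ptree id \<pi> (bsu_tree x t0)" for x
      unfolding t by (intro bsu_tree_map_ptree inj)
    moreover have "(\<Sum>x\<in>{1..m}. tree (bsu_tree x t)) = (\<Sum>x\<in>{1..m}. tree (bsu_tree (\<pi> x) t))"
      using sum.permute[OF \<pi>, of "\<lambda>x. tree (bsu_tree x t)"] by (simp add: o_def)
    \<comment> \<open>The action of a permutation renumbers leaves by its inverse; the inverse of
      \<pi> therefore acts by renumbering with \<pi>.\<close>
    ultimately have "?D (tree t) = lc_map (map_ptree id (inv (inv \<pi>)))
        (tree (bsu_tree 0 t0) - (\<Sum>x\<in>{1..m}. tree (bsu_tree x t0)))"
      using permutes_inv_inv[OF \<pi>] by (simp add: lc_map_diff lc_map_sum)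
    then show ?thesis
      using sym_rel_ideal_act[OF bsu_star_eq_sum_ns[OF Q t0] permutes_inv[OF \<pi>]] by (simp only:)
  qed
  from p show ?thesis
  proof (induction p rule: lc_induct)
    case zero
    then show ?case by (simp add: B.ideal_zero del: sym_BSu_simps)
  next
    case (add p q)
    have "?D (p + q) = ?D p + ?D q" by (simp add: lc_map_add sum.distrib)
    then show ?case using B.ideal_add[OF add(3,4)] by (simp only:)
  next
    case (scale c t)
    have "?D (lc_scale c (tree t)) = lc_scale c (?D (tree t))"
      by (simp only: lc_map_scale lc_scale_diff lc_scale_sum)
    then show ?case using B.ideal_scale[OF tree[OF scale]] by (simp only:)
  qed
qed

lemma set_leaves_sym_trees: "t \<in> sym_trees G m \<Longrightarrow> set (leaves t) = {1..m}"
  by (simp add: sym_trees_def)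

lemma bsu_tree_outside:
  assumes "Poly_Mapping.keys p \<subseteq> sym_trees G m" "x \<notin> {1..m}"
  shows "lc_map (bsu_tree x) p = lc_map (bsu_tree 0) p"
  by (rule lc_map_cong[OF assms(1)], rule bsu_tree_absent) (use assms(2) in \<open>auto simp: sym_trees_def\<close>)

text \<open>The leaf \<open>x\<close> is arbitrary and not confined to \<open>{1..m}\<close>: in the
  composition cases the ideal element may be the factor that misses the leaf, and the induction
  hypothesis is then applied at 0.\<close>

lemma sym_rel_ideal_BSu:
  fixes Q :: "('k::field, 'w::ab_group_add) sym_pres"
  assumes Q: "sym_presentation Q" and p: "sym_rel_ideal Q m p"
  shows "sym_rel_ideal (sym_BSu Q) m (lc_map (bsu_tree x) p)"
proof -
  interpret Q: tree_quotient "sym_tree_operad (gen Q)" "sym_rel_ideal Q"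
    using tree_quotient_sym[OF Q] .
  interpret B: tree_quotient "sym_tree_operad (gen (sym_BSu Q))" "sym_rel_ideal (sym_BSu Q)"
    using tree_quotient_sym[OF sym_presentation_BSu[OF Q]] .
  have zero: "0 \<in> gen Q" and vs: "vector_space (vscale Q)" using sym_presentationD[OF Q] by blast+
  have ops: "Poly_Mapping.keys p \<subseteq> sym_trees (gen Q) m" if "sym_rel_ideal Q m p" for m p
    using Q.ideal_ops[OF that] by simp
  \<comment> \<open>The leaves \<open>y\<close> and \<open>z\<close> depend on \<open>x\<close>,
    \<open>i\<close> and \<open>n\<close> but not on the trees, so one pair serves all terms of both
    combinations.\<close>
  have graft: "\<exists>y z. lc_map (bsu_tree x) (lc_graft i p q) =
      lc_graft i (lc_map (bsu_tree y) p) (lc_map (bsu_tree z) q)"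
    if "Poly_Mapping.keys p \<subseteq> sym_trees (gen Q) m" "Poly_Mapping.keys q \<subseteq> sym_trees (gen Q) n" "i \<in> {1..m}"
    for i m n x and p q :: "('k, 'w label) tcomb"
    by (intro exI, rule lc_map_lc_graft[OF that(1,2)], rule bsu_tree_graft)
      (erule set_leaves_sym_trees sym_trees_length(1) | use that in simp)+
  have opsB: "lc_map (bsu_tree x) p \<in> ops (sym_tree_operad (gen (sym_BSu Q))) m"
    if "Poly_Mapping.keys p \<subseteq> sym_trees (gen Q) m" for x m and p :: "('k, 'w label) tcomb"
    using lc_map_bsu_tree_sym[OF zero that] by (simp del: ns_BSu_simps)
  from p show ?thesis
    unfolding sym_rel_ideal_def[of Q]
  proof (induction arbitrary: x rule: sym_ideal.induct)
    case (sym_zero m)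
    then show ?case by (simp add: B.ideal_zero del: sym_BSu_simps)
  next
    case (sym_gen r m)
    then consider "r \<in> linearity_rel Q m" | "r \<in> exchange_rel Q m" | "r \<in> rel Q m" by blast
    then show ?case
    proof cases
      case 1
      have "linearity_rel (ns_BSu Q) m = linearity_rel (sym_BSu Q) m"
        by (simp add: linearity_rel_def)
      then show ?thesis
        using sym_rel_ideal_gen[of _ "sym_BSu Q" m] linearity_rel_BSu[OF vs zero 1, of x] by blast
    next
      case 2
      then show ?thesis
        using sym_rel_ideal_gen[of _ "sym_BSu Q" m] exchange_rel_BSu[OF Q 2, of x] by blast
    next
      case 3
      have k: "Poly_Mapping.keys r \<subseteq> sym_trees (gen Q) m" using sym_presentationD(5)[OF Q 3] .
      have inside: "sym_rel_ideal (sym_BSu Q) m (lc_map (bsu_tree y) r)" if "y \<in> {1..m}" for y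
        by (rule sym_rel_ideal_gen) (use that 3 in auto)
      show ?thesis
      proof (cases "x \<in> {1..m}")
        case True
        then show ?thesis by (rule inside)
      next
        case False
        \<comment> \<open>No relation of the bisuccessor is imposed at such an \<open>x\<close>. The
          combination is the version with stars, congruent to the sum over the actual
          leaves.\<close>
        have "sym_rel_ideal (sym_BSu Q) m (\<Sum>y\<in>{1..m}. lc_map (bsu_tree y) r)"
          using inside by (rule B.ideal_sum)
        from B.ideal_add[OF bsu_star_eq_sum[OF Q k] this] show ?thesis
          unfolding bsu_tree_outside[OF k False] by simp
      qed
    qed
  next
    case (sym_add m p q)
    then show ?case using B.ideal_add by (simp add: lc_map_add del: sym_BSu_simps)
  next
    case (sym_scale m p c)
    then show ?case using B.ideal_scale by (simp add: lc_map_scale del: sym_BSu_simps)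
  next
    case (sym_act m p \<sigma>)
    \<comment> \<open>Leaf \<open>x\<close> of the tree acted upon is leaf \<open>\<sigma> x\<close>
      of the original one, so the induction hypothesis is used at \<open>\<sigma> x\<close>.\<close>
    have "bsu_tree x (map_ptree id (inv \<sigma>) t) = map_ptree id (inv \<sigma>) (bsu_tree (\<sigma> x) t)"
      for t :: "('w label, nat) ptree"
      by (rule bsu_tree_map_ptree) (metis permutes_inverses[OF sym_act(2)])
    then have "lc_map (bsu_tree x) (lc_map (map_ptree id (inv \<sigma>)) p) =
        lc_map (map_ptree id (inv \<sigma>)) (lc_map (bsu_tree (\<sigma> x)) p)"
      by (simp only: lc_map_lc_map)
    then show ?case using sym_rel_ideal_act[OF sym_act(3) sym_act(2)] by simp
  next
    case (sym_comp_left m p q n i)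
    have "Poly_Mapping.keys p \<subseteq> sym_trees (gen Q) m" "Poly_Mapping.keys q \<subseteq> sym_trees (gen Q) n"
      using ops[of m p] sym_comp_left(1,2) by (simp_all add: sym_rel_ideal_def)
    then obtain y z where "lc_map (bsu_tree x) (lc_graft i p q) =
        lc_graft i (lc_map (bsu_tree y) p) (lc_map (bsu_tree z) q)"
      using graft[OF _ _ sym_comp_left(3)] by blast
    then show ?case
      using B.ideal_left[OF sym_comp_left(4) opsB sym_comp_left(3)] sym_comp_left(2)
      by (simp del: sym_BSu_simps)
  next
    case (sym_comp_right p m n q i)
    have "Poly_Mapping.keys p \<subseteq> sym_trees (gen Q) m" "Poly_Mapping.keys q \<subseteq> sym_trees (gen Q) n"
      using ops[of n q] sym_comp_right(1,2) by (simp_all add: sym_rel_ideal_def)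
    then obtain y z where "lc_map (bsu_tree x) (lc_graft i p q) =
        lc_graft i (lc_map (bsu_tree y) p) (lc_map (bsu_tree z) q)"
      using graft[OF _ _ sym_comp_right(3)] by blast
    then show ?case
      using B.ideal_right[OF opsB sym_comp_right(4) sym_comp_right(3)] sym_comp_right(1)
      by (simp del: sym_BSu_simps)
  qed
qed

section \<open>Maps of generators\<close>

lemma lc_map_corolla: "lc_map (map_ptree \<phi> id) (corolla w) = corolla (\<phi> w)"
  by (simp add: corolla_def)

lemma lc_map_label_trees:
  assumes "\<phi> ` G \<subseteq> G'" "Poly_Mapping.keys p \<subseteq> ns_trees G m"
  shows "Poly_Mapping.keys (lc_map (map_ptree \<phi> id) p) \<subseteq> ns_trees G' m"
proof -
  have "map_ptree \<phi> id t \<in> ns_trees G' m" if "t \<in> ns_trees G m" for t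
    using that assms(1) by (auto simp: ns_trees_def simp del: upt_Suc)
  then show ?thesis using keys_lc_map[of "map_ptree \<phi> id" p] assms(2) by blast
qed

lemma lc_map_lc_graft_label:
  fixes p q :: "('k::field, 'g) tcomb"
  shows "lc_map (map_ptree \<phi> id) (lc_graft i p q) =
    lc_graft i (lc_map (map_ptree \<phi> id) p) (lc_map (map_ptree \<phi> id) q)"
  by (rule lc_map_lc_graft[of _ UNIV _ UNIV]) (simp_all add: map_ptree_graft)

lemma label_hom:
  assumes "\<phi> ` G \<subseteq> G'"
  shows "ns_operad_hom (ns_tree_operad G :: ('k::field, ('k, 'g) tcomb) ns_operad)
    (sym_tree_operad G') (\<lambda>_. lc_map (map_ptree \<phi> id))"
  unfolding ns_operad_hom_def
  using lc_map_label_trees[OF assms] ns_trees_subset_sym_trees[of G']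
  by (auto simp: lc_map_add lc_map_scale lc_map_lc_graft_label) blast

definition label_map :: "('k::field, 'v::ab_group_add) ns_pres \<Rightarrow> ('k, 'w::ab_group_add) sym_pres \<Rightarrow>
    ('v label \<Rightarrow> 'w label) \<Rightarrow> bool" where
  "label_map P Q \<phi> \<longleftrightarrow> \<phi> ` gen P \<subseteq> gen Q \<and> \<phi> 0 = 0 \<and>
    (\<forall>m p. ns_rel_ideal P m p \<longrightarrow> sym_rel_ideal Q m (lc_map (map_ptree \<phi> id) p))"

text \<open>Relabelling commutes with grafting and is linear on combinations, so only the generators
  of the ideal have to be checked.\<close>

lemma label_mapI:
  assumes P: "ns_presentation P" and Q: "sym_presentation Q"
    and \<phi>: "\<phi> ` gen P \<subseteq> gen Q" "\<phi> 0 = 0"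
    and rel: "\<And>m r. r \<in> linearity_rel P m \<union> rel P m \<Longrightarrow>
      sym_rel_ideal Q m (lc_map (map_ptree \<phi> id) r)"
  shows "label_map P Q \<phi>"
proof -
  interpret Q: tree_quotient "sym_tree_operad (gen Q)" "sym_rel_ideal Q"
    using tree_quotient_sym[OF Q] .
  note hom = label_hom[OF \<phi>(1), unfolded ns_operad_hom_def]
  have "sym_rel_ideal Q m (lc_map (map_ptree \<phi> id) p)" if "ns_rel_ideal P m p" for m p
    using that unfolding ns_rel_ideal_def
  proof (induction rule: ns_ideal.induct)
    case (ns_zero m)
    then show ?case by (simp add: Q.ideal_zero)
  next
    case (ns_gen r m)
    then show ?case by (rule rel)
  next
    case (ns_add m p q)
    then show ?case by (simp add: lc_map_add Q.ideal_add)
  next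
    case (ns_scale m p c)
    then show ?case by (simp add: lc_map_scale Q.ideal_scale)
  next
    case (ns_comp_left m p q n i)
    have "lc_map (map_ptree \<phi> id) q \<in> ops (sym_tree_operad (gen Q)) n"
      using hom ns_comp_left(2) by blast
    from Q.ideal_left[OF ns_comp_left(4) this ns_comp_left(3)] show ?case
      by (simp only: ns_tree_operad_struct lc_map_lc_graft_label)
  next
    case (ns_comp_right p m n q i)
    have "lc_map (map_ptree \<phi> id) p \<in> ops (sym_tree_operad (gen Q)) m"
      using hom ns_comp_right(1) by blast
    from Q.ideal_right[OF this ns_comp_right(4) ns_comp_right(3)] show ?case
      by (simp only: ns_tree_operad_struct lc_map_lc_graft_label)
  qed
  then show ?thesis using \<phi> by (simp add: label_map_def)
qed

text \<open>The tensor product of \<phi> with the identity on the two sides, written componentwise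
  so that it makes sense for a \<phi> that is not linear.\<close>

definition bsu_map :: "('v::ab_group_add label \<Rightarrow> 'w::ab_group_add label) \<Rightarrow> 'v label \<Rightarrow> 'w label" where
  "bsu_map \<phi> w = tens Prec (\<phi> (\<lambda>l. w (l @ [Prec]))) + tens Succ (\<phi> (\<lambda>l. w (l @ [Succ])))"

lemma bsu_map_tens: "bsu_map \<phi> (tens Prec a + tens Succ b) = tens Prec (\<phi> a) + tens Succ (\<phi> b)"
  by (simp only: bsu_map_def tens_components)

lemma bsu_map_tens_single:
  assumes "\<phi> 0 = 0"
  shows "bsu_map \<phi> (tens s a) = tens s (\<phi> a)"
  using bsu_map_tens[of \<phi> a 0] bsu_map_tens[of \<phi> 0 a] assms
  by (cases s) (simp_all del: plus_fun_apply)

text \<open>The relations in \<open>rel\<close> are handled by exact commutation with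
  \<open>bsu_tree\<close>. The linearity relations take more: in \<open>sym_BSu Q\<close> a label
  splits into its two components by genuine linearity, and on each component \<phi> is linear modulo
  the ideal.\<close>

lemma label_map_BSu:
  fixes P :: "('k::field, 'v::ab_group_add) ns_pres" and Q :: "('k, 'w::ab_group_add) sym_pres"
  assumes P: "ns_presentation P" and Q: "sym_presentation Q" and \<phi>: "label_map P Q \<phi>"
  shows "label_map (ns_BSu P) (sym_BSu Q) (bsu_map \<phi>)"
proof (rule label_mapI[OF ns_presentation_BSu[OF P] sym_presentation_BSu[OF Q]])
  interpret B: tree_quotient "sym_tree_operad (gen (sym_BSu Q))" "sym_rel_ideal (sym_BSu Q)"
    using tree_quotient_sym[OF sym_presentation_BSu[OF Q]] .
  have gen: "\<phi> a \<in> gen Q" if "a \<in> gen P" for a using \<phi> that by (auto simp: label_map_def)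
  have zero: "\<phi> 0 = 0" using \<phi> by (simp add: label_map_def)
  have ideal: "sym_rel_ideal Q m (lc_map (map_ptree \<phi> id) p)" if "ns_rel_ideal P m p" for m p
    using \<phi> that by (simp add: label_map_def)
  show "bsu_map \<phi> ` gen (ns_BSu P) \<subseteq> gen (sym_BSu Q)"
  proof (rule image_subsetI)
    fix u assume "u \<in> gen (ns_BSu P)"
    then obtain a b where "u = tens Prec a + tens Succ b" "a \<in> gen P" "b \<in> gen P" by auto
    then show "bsu_map \<phi> u \<in> gen (sym_BSu Q)"
      using gen[of a] gen[of b] by (auto simp: bsu_map_tens simp del: plus_fun_apply)
  qed
  show "bsu_map \<phi> 0 = 0"
    using bsu_map_tens[of \<phi> 0 0] zero by (simp del: plus_fun_apply)
  let ?I = "sym_rel_ideal (sym_BSu Q)"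
  let ?c = "corolla :: 'w label \<Rightarrow> ('k, 'w label) tcomb"
  have tens_gen: "tens s (\<phi> a) \<in> gen (sym_BSu Q)" if "a \<in> gen P" for s a
    using tens_in_BSu(1,2)[OF sym_presentationD(2)[OF Q] gen[OF that]]
    by (cases s) (simp_all del: ns_BSu_simps)
  \<comment> \<open>The bisuccessor of a corolla at leaf 1 or 2 tensors its label with one side, so
    it carries the congruence for \<phi> to the component of that side.\<close>
  have tens_plus: "?I 2 (?c (tens s (\<phi> (a + b))) - ?c (tens s (\<phi> a)) - ?c (tens s (\<phi> b)))"
    if "a \<in> gen P" "b \<in> gen P" for s a b
  proof -
    have "ns_rel_ideal P 2 (corolla (a + b) - corolla a - corolla b)"
      by (rule ns_rel_ideal_gen) (use that in \<open>auto simp: linearity_rel_def simp del: plus_fun_apply\<close>)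
    from sym_rel_ideal_BSu[OF Q ideal[OF this], of "if s = Prec then 1 else 2"] show ?thesis
      by (cases s) (simp_all add: lc_map_diff lc_map_corolla lc_map_bsu_corolla bsu_label_def
          del: plus_fun_apply)
  qed
  have tens_scale: "?I 2 (?c (tens s (\<phi> (lscale P c a))) - lc_scale c (?c (tens s (\<phi> a))))"
    if "a \<in> gen P" for s a c
  proof -
    have "ns_rel_ideal P 2 (corolla (lscale P c a) - lc_scale c (corolla a))"
      by (rule ns_rel_ideal_gen) (use that in \<open>auto simp: linearity_rel_def simp del: plus_fun_apply\<close>)
    from sym_rel_ideal_BSu[OF Q ideal[OF this], of "if s = Prec then 1 else 2"] show ?thesis
      by (cases s) (simp_all add: lc_map_diff lc_map_corolla lc_map_scale lc_map_bsu_corolla bsu_label_def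
          del: plus_fun_apply)
  qed
  have split: "?I 2 (?c (tens Prec (\<phi> a) + tens Succ (\<phi> b)) - ?c (tens Prec (\<phi> a)) - ?c (tens Succ (\<phi> b)))"
    if "a \<in> gen P" "b \<in> gen P" for a b
    by (rule sym_rel_ideal_linear(1)) (use tens_gen that in auto)
  note P' = ns_presentationD[OF P]
  fix m r assume "r \<in> linearity_rel (ns_BSu P) m \<union> rel (ns_BSu P) m"
  then consider
      u v where "m = 2" "r = corolla (u + v) - corolla u - corolla v" "u \<in> gen (ns_BSu P)" "v \<in> gen (ns_BSu P)"
    | c u where "m = 2" "r = corolla (lscale P c u) - lc_scale c (corolla u)" "u \<in> gen (ns_BSu P)"
    | x r' where "r = lc_map (bsu_tree x) r'" "r' \<in> rel P m"
    by (auto simp: linearity_rel_def simp del: plus_fun_apply ns_BSu_simps(2) split: if_splits)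
  then show "?I m (lc_map (map_ptree (bsu_map \<phi>) id) r)"
  proof cases
    case 1
    obtain a b where u: "u = tens Prec a + tens Succ b" "a \<in> gen P" "b \<in> gen P" using 1(3) by auto
    obtain a' b' where v: "v = tens Prec a' + tens Succ b'" "a' \<in> gen P" "b' \<in> gen P" using 1(4) by auto
    have uv: "u + v = tens Prec (a + a') + tens Succ (b + b')"
      unfolding u v by (simp add: tens_add algebra_simps del: plus_fun_apply)
    have eq: "lc_map (map_ptree (bsu_map \<phi>) id) r =
        ?c (tens Prec (\<phi> (a + a')) + tens Succ (\<phi> (b + b'))) -
        ?c (tens Prec (\<phi> a) + tens Succ (\<phi> b)) - ?c (tens Prec (\<phi> a') + tens Succ (\<phi> b'))"
      unfolding 1(2) lc_map_diff lc_map_corolla uv bsu_map_tens unfolding u v bsu_map_tens ..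
    \<comment> \<open>\<open>A\<close>, \<open>B\<close> are the two components of the image of the
      sum; the indices 1 and 2 refer to the two summands, whose images are \<open>Y\<close> and
      \<open>Z\<close>.\<close>
    have comb: "?I 2 (X - Y - Z)"
      if "?I 2 (X - A - B)" "?I 2 (A - A1 - A2)" "?I 2 (B - B1 - B2)" "?I 2 (Y - A1 - B1)" "?I 2 (Z - A2 - B2)"
      for X Y Z A B A1 A2 B1 B2
      using B.ideal_diff[OF B.ideal_diff[OF B.ideal_add[OF B.ideal_add[OF that(1,2)] that(3)] that(4)] that(5)]
      by simp
    show ?thesis
      unfolding eq 1(1)
      by (rule comb[OF split tens_plus tens_plus split split]; intro P'(3) u v)
  next
    case 2
    obtain a b where u: "u = tens Prec a + tens Succ b" "a \<in> gen P" "b \<in> gen P" using 2(3) by auto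
    have cu: "lscale P c u = tens Prec (lscale P c a) + tens Succ (lscale P c b)"
      unfolding u using P'(1) by (simp add: tens_lscale lscale_add)
    have eq: "lc_map (map_ptree (bsu_map \<phi>) id) r =
        ?c (tens Prec (\<phi> (lscale P c a)) + tens Succ (\<phi> (lscale P c b))) -
        lc_scale c (?c (tens Prec (\<phi> a) + tens Succ (\<phi> b)))"
      unfolding 2(2) lc_map_diff lc_map_scale lc_map_corolla cu bsu_map_tens unfolding u bsu_map_tens ..
    have comb: "?I 2 (X - lc_scale c Y)"
      if "?I 2 (X - A - B)" "?I 2 (A - lc_scale c A1)" "?I 2 (B - lc_scale c B1)" "?I 2 (Y - A1 - B1)"
      for X Y A B A1 B1
      using B.ideal_diff[OF B.ideal_add[OF B.ideal_add[OF that(1,2)] that(3)] B.ideal_scale[OF that(4), of c]]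
      by (simp add: lc_scale_diff)
    show ?thesis
      unfolding eq 2(1)
      by (rule comb[OF split tens_scale tens_scale split]; intro P'(4) u)
  next
    case 3
    have "map_ptree (bsu_map \<phi>) id (bsu_tree x t) = bsu_tree x (map_ptree \<phi> id t)" for t
      by (rule map_ptree_bsu_tree) (simp_all only: bsu_map_tens bsu_map_tens_single[of \<phi>, OF zero])
    then have "lc_map (map_ptree (bsu_map \<phi>) id) r = lc_map (bsu_tree x) (lc_map (map_ptree \<phi> id) r')"
      unfolding 3(1) by (simp only: lc_map_lc_map)
    then show ?thesis
      using sym_rel_ideal_BSu[OF Q ideal[OF ns_rel_ideal_gen], of r' m] 3(2) by simp
  qed
qed

section \<open>Regularization and the choice of lifts\<close>

lemma reg_id_simps:
  "reg_id 0 = 0" "reg_id (a + b) = reg_id a + reg_id b" for a b :: "'v::ab_group_add label"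
  by (simp_all add: reg_id_def fun_eq_iff zero_prod_def)

lemma Reg_simps [simp]:
  "vscale (Reg P) = (\<lambda>c (a, b). (vscale P c a, vscale P c b))"
  "gen (Reg P) = {\<lambda>l. (a l, b l) | a b. a \<in> gen P \<and> b \<in> gen P}"
  "rel (Reg P) = (\<lambda>m. lc_map (map_ptree reg_id id) ` rel P m)"
  "twist (Reg P) = (\<lambda>w l. prod.swap (w l))"
  by (simp_all add: Reg_def)

lemma lscale_Reg: "lscale (Reg P) c (\<lambda>l. (a l, b l)) = (\<lambda>l. (lscale P c a l, lscale P c b l))"
  by (simp add: lscale_def)

lemma lscale_reg_id:
  assumes "vector_space (vscale P)"
  shows "lscale (Reg P) c (reg_id a) = reg_id (lscale P c a)"
  using fun_cong[OF lscale_zero[OF assms, of c]] by (auto simp: lscale_def reg_id_def)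

lemma reg_id_in_Reg: "0 \<in> gen P \<Longrightarrow> a \<in> gen P \<Longrightarrow> reg_id a \<in> gen (Reg P)"
  unfolding Reg_simps reg_id_def by (intro CollectI exI[of _ a] exI[of _ 0]) simp

lemma sym_presentation_Reg:
  assumes P: "ns_presentation P"
  shows "sym_presentation (Reg P)"
proof -
  note P' = ns_presentationD[OF P]
  have gens: "\<exists>a b. u = (\<lambda>l. (a l, b l)) \<and> a \<in> gen P \<and> b \<in> gen P" if "u \<in> gen (Reg P)" for u
    using that by auto
  have mem: "(\<lambda>l. (a l, b l)) \<in> gen (Reg P)" if "a \<in> gen P" "b \<in> gen P" for a b
    using that by auto
  have vs: "vector_space (vscale (Reg P))"
    using P'(1) by (auto simp: vector_space_def)
  have "0 \<in> gen (Reg P)"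
    using reg_id_in_Reg[OF P'(2) P'(2)] by (simp only: reg_id_simps)
  moreover have "u + v \<in> gen (Reg P)" if uv: "u \<in> gen (Reg P)" "v \<in> gen (Reg P)" for u v
  proof -
    obtain a b where u: "u = (\<lambda>l. (a l, b l))" "a \<in> gen P" "b \<in> gen P" using gens[OF uv(1)] by blast
    obtain a' b' where v: "v = (\<lambda>l. (a' l, b' l))" "a' \<in> gen P" "b' \<in> gen P" using gens[OF uv(2)] by blast
    have "u + v = (\<lambda>l. ((a + a') l, (b + b') l))" unfolding u v by (simp add: fun_eq_iff)
    then show ?thesis using mem[OF P'(3)[OF u(2) v(2)] P'(3)[OF u(3) v(3)]] by (simp only:)
  qed
  moreover have "lscale (Reg P) c u \<in> gen (Reg P)" if u: "u \<in> gen (Reg P)" for c u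
  proof -
    obtain a b where u: "u = (\<lambda>l. (a l, b l))" "a \<in> gen P" "b \<in> gen P" using gens[OF u] by blast
    show ?thesis unfolding u(1) lscale_Reg using mem[OF P'(4)[OF u(2)] P'(4)[OF u(3)]] .
  qed
  ultimately have subspace: "module.subspace (lscale (Reg P)) (gen (Reg P))"
    unfolding subspace_lscale_iff[OF vs] by blast
  have twist: "twist (Reg P) a \<in> gen (Reg P) \<and> twist (Reg P) (twist (Reg P) a) = a"
    if in_gen: "a \<in> gen (Reg P)" for a
  proof -
    obtain b c where a: "a = (\<lambda>l. (b l, c l))" "b \<in> gen P" "c \<in> gen P"
      using gens[OF in_gen] by blast
    have "twist (Reg P) a = (\<lambda>l. (c l, b l))" "twist (Reg P) (\<lambda>l. (c l, b l)) = a"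
      unfolding a by (simp_all del: Reg_simps(2))
    then show ?thesis using mem[OF a(3,2)] by (simp del: Reg_simps)
  qed
  have rel: "rel (Reg P) m \<subseteq> ops (sym_tree_operad (gen (Reg P))) m" for m
  proof
    fix r assume "r \<in> rel (Reg P) m"
    then obtain r' where r: "r = lc_map (map_ptree reg_id id) r'" "r' \<in> rel P m" by auto
    have "reg_id ` gen P \<subseteq> gen (Reg P)" using reg_id_in_Reg[OF P'(2)] by blast
    from lc_map_label_trees[OF this P'(5)[OF r(2)]] show "r \<in> ops (sym_tree_operad (gen (Reg P))) m"
      unfolding r(1) ops_sym_tree_operad using ns_trees_subset_sym_trees by blast
  qed
  have add: "twist (Reg P) (a + b) = twist (Reg P) a + twist (Reg P) b" for a b
    by (simp add: fun_eq_iff prod_eq_iff)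
  have scale: "twist (Reg P) (lscale (Reg P) c a) = lscale (Reg P) c (twist (Reg P) a)" for c a
    by (auto simp: fun_eq_iff lscale_def split: prod.splits)
  show ?thesis
    unfolding sym_presentation_def using vs subspace twist rel add scale by blast
qed

text \<open>The symmetric quotient only adds the action to the nonsymmetric one, so the results of
  \<open>tree_quotient\<close> apply to morphisms into it.\<close>

lemma ns_operad_hom_sym_presented:
  "ns_operad_hom R (sym_presented Q) F \<longleftrightarrow>
    ns_operad_hom R (ns_quotient (sym_tree_operad (gen Q)) (sym_rel_ideal Q)) F"
  by (simp add: ns_operad_hom_def sym_presented_def)

lemma ns_operad_hom_forget: "ns_operad_hom R (forget Q) F \<longleftrightarrow> ns_operad_hom R Q F"
  by (simp add: ns_operad_hom_def)

lemma sym_rel_ideal_corolla_zero: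
  assumes Q: "sym_presentation Q"
  shows "sym_rel_ideal Q 2 (corolla 0)"
proof -
  have "lscale Q 0 0 = 0" using lscale_zero[OF sym_presentationD(1)[OF Q]] .
  then show ?thesis
    using sym_rel_ideal_linear(2)[OF sym_presentationD(2)[OF Q] sym_presentationD(2)[OF Q], of 0] by simp
qed

text \<open>This supplies the lifts. A tree with two leaves has one vertex; the exchange relation
  brings its leaves into order at the cost of a twist, and linearity gathers a combination of
  corollas into one.\<close>

lemma sym_arity_two_class:
  fixes Q :: "('k::field, 'w::ab_group_add) sym_pres"
  assumes Q: "sym_presentation Q" and X: "X \<in> ops (sym_presented Q) 2"
  shows "\<exists>w\<in>gen Q. X = sym_gen_class Q w"
proof -
  interpret Q: tree_quotient "sym_tree_operad (gen Q)" "sym_rel_ideal Q"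
    using tree_quotient_sym[OF Q] .
  note Q' = sym_presentationD[OF Q]
  have "\<exists>w\<in>gen Q. sym_rel_ideal Q 2 (p - corolla w)" if "Poly_Mapping.keys p \<subseteq> sym_trees (gen Q) 2"
    for p :: "('k, 'w label) tcomb"
    using that
  proof (induction p rule: lc_induct)
    case zero
    have "sym_rel_ideal Q 2 (0 - corolla 0)"
      unfolding diff_0 by (rule Q.ideal_uminus[OF sym_rel_ideal_corolla_zero[OF Q]])
    then show ?case using Q'(2) by blast
  next
    case (add p q)
    then obtain a b where ab: "a \<in> gen Q" "sym_rel_ideal Q 2 (p - corolla a)"
      "b \<in> gen Q" "sym_rel_ideal Q 2 (q - corolla b)" by blast
    have "sym_rel_ideal Q 2 (p + q - corolla (a + b))"
      using Q.ideal_diff[OF Q.ideal_add[OF ab(2,4)] sym_rel_ideal_linear(1)[OF ab(1,3)]] by simp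
    then show ?case using Q'(3)[OF ab(1,3)] by blast
  next
    case (scale c t)
    have len: "length (leaves t) = 2" using sym_trees_length(1)[OF scale] .
    have "\<exists>w x y. t = Node w (Leaf x) (Leaf y)"
    proof (cases t)
      case (Node w l r)
      have "length (leaves l) > 0" "length (leaves r) > 0" by simp_all
      with len Node have "length (leaves l) = 1" "length (leaves r) = 1"
        by (simp_all del: length_greater_0_conv)
      moreover have "\<exists>x. t = Leaf x" if "length (leaves t) = 1" for t :: "('w label, nat) ptree"
      proof (cases t)
        case (Node w l r)
        have "length (leaves l) > 0" "length (leaves r) > 0" by simp_all
        with that Node show ?thesis by (simp del: length_greater_0_conv)
      qed simp
      ultimately show ?thesis using Node by blast
    qed (use len in simp)
    then obtain w x y where t: "t = Node w (Leaf x) (Leaf y)" by blast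
    have w: "w \<in> gen Q" and xy: "x \<noteq> y" "{x, y} = {1..2}" using scale t by (auto simp: sym_trees_def)
    have "{1..2} = {1, 2::nat}" by auto
    with xy have "x = 1 \<and> y = 2 \<or> x = 2 \<and> y = 1" by (auto simp: doubleton_eq_iff)
    then have "\<exists>v\<in>gen Q. sym_rel_ideal Q 2 (tree t - corolla v)"
    proof
      assume "x = 1 \<and> y = 2"
      then have "tree t = (corolla w :: ('k, 'w label) tcomb)" by (simp add: t corolla_def)
      then have "sym_rel_ideal Q 2 (tree t - corolla w)" using Q.ideal_zero by simp
      then show ?thesis using w by blast
    next
      assume xy: "x = 2 \<and> y = 1"
      \<comment> \<open>The exchange relation is taken at the twisted label, so that the second
        twist gives back \<open>w\<close> on the tree with leaves 2 and 1.\<close>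
      have "sym_rel_ideal Q 2 (corolla (twist Q w) - tree (Node (twist Q (twist Q w)) (Leaf 2) (Leaf 1)))"
        by (rule sym_rel_ideal_gen) (use Q'(6)[OF w] in \<open>auto simp: exchange_rel_def\<close>)
      then have "sym_rel_ideal Q 2 (corolla (twist Q w) - tree t)"
        using xy by (simp add: t Q'(7)[OF w])
      then show ?thesis using Q.ideal_uminus[of 2 "corolla (twist Q w) - tree t"] Q'(6)[OF w] by auto
    qed
    then obtain v where v: "v \<in> gen Q" "sym_rel_ideal Q 2 (tree t - corolla v)" by blast
    have "sym_rel_ideal Q 2 (lc_scale c (tree t) - corolla (lscale Q c v))"
      using Q.ideal_diff[OF Q.ideal_scale[OF v(2), of c] sym_rel_ideal_linear(2)[OF v(1) v(1), of c]]
      by (simp add: lc_scale_diff)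
    then show ?case using Q'(4)[OF v(1)] by blast
  qed
  moreover obtain p where "p \<in> ops (sym_tree_operad (gen Q)) 2" "X = Q.cl 2 p"
    using X by (auto simp: sym_presented_def Q.ops_quotient)
  ultimately show ?thesis
    unfolding sym_gen_class_def Q.cl_eq_iff[symmetric] by auto
qed

text \<open>As \<open>f\<close> lives on classes, \<phi> is chosen label by label. Compatibility
  with relations comes from comparing two morphisms out of the tree operad: one through
  \<open>Reg P\<close> and \<open>f\<close>, the other through \<phi>. They agree on corollas by
  choice, hence everywhere, and the first kills the relations of \<open>P\<close>.\<close>

lemma base_label_map:
  fixes P :: "('k::field, 'v::ab_group_add) ns_pres" and Q :: "('k, 'w::ab_group_add) sym_pres"
  assumes P: "ns_presentation P" and Q: "sym_presentation Q"
    and f: "ns_operad_hom (sym_presented (Reg P)) (sym_presented Q) f"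
  obtains \<phi> where "label_map P Q \<phi>"
    "\<And>v. v \<in> gen P \<Longrightarrow> f 2 (sym_gen_class (Reg P) (reg_id v)) = sym_gen_class Q (\<phi> v)"
proof -
  interpret Q: tree_quotient "sym_tree_operad (gen Q)" "sym_rel_ideal Q"
    using tree_quotient_sym[OF Q] .
  interpret R: tree_quotient "sym_tree_operad (gen (Reg P))" "sym_rel_ideal (Reg P)"
    using tree_quotient_sym[OF sym_presentation_Reg[OF P]] .
  note P' = ns_presentationD[OF P] and Q' = sym_presentationD[OF Q]
  let ?cls = "\<lambda>v. f 2 (sym_gen_class (Reg P) (reg_id v))"
  have reg: "reg_id ` gen P \<subseteq> gen (Reg P)" using reg_id_in_Reg[OF P'(2)] by blast
  have cls: "sym_gen_class (Reg P) (reg_id v) \<in> ops (sym_presented (Reg P)) 2" if "v \<in> gen P" for v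
    using keys_corolla_subset(2)[of "reg_id v" "gen (Reg P)"] that reg
    unfolding sym_gen_class_def sym_presented_def by (auto simp: R.ops_quotient simp del: Reg_simps)
  \<comment> \<open>The lift of 0 is prescribed, since an arbitrary choice could be any label whose
    corolla lies in the ideal.\<close>
  define \<phi> where "\<phi> v = (if v = 0 then 0 else SOME w. w \<in> gen Q \<and> ?cls v = sym_gen_class Q w)" for v
  have \<phi>: "\<phi> v \<in> gen Q \<and> ?cls v = sym_gen_class Q (\<phi> v)" if v: "v \<in> gen P" for v
  proof (cases "v = 0")
    case True
    let ?c = "sym_gen_class (Reg P) (reg_id v)"
    have c0: "?c = R.cl 2 0"
      using sym_rel_ideal_corolla_zero[OF sym_presentation_Reg[OF P]]
      unfolding True reg_id_simps sym_gen_class_def R.cl_eq_iff by simp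
    \<comment> \<open>The class of 0 is its own multiple by the scalar 0, so its image under
      \<open>f\<close> is the zero class, for which 0 is a lift.\<close>
    have "?c = oscale (sym_presented (Reg P)) 2 0 ?c"
      unfolding c0 sym_presented_def by (simp add: R.quotient_scale del: Reg_simps)
    then have "f 2 ?c = oscale (sym_presented Q) 2 0 (f 2 ?c)"
      using f cls[OF v] unfolding ns_operad_hom_def by metis
    also have "f 2 ?c \<in> ops (sym_presented Q) 2" using f cls[OF v] unfolding ns_operad_hom_def by blast
    then have "oscale (sym_presented Q) 2 0 (f 2 ?c) = Q.cl 2 0"
      using Q.quotient_scale_zero[of "f 2 ?c" 2] by (simp add: sym_presented_def Q.quotient_zero)
    also have "\<dots> = sym_gen_class Q 0"
      using Q.ideal_uminus[OF sym_rel_ideal_corolla_zero[OF Q]] by (simp add: sym_gen_class_def Q.cl_eq_iff)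
    finally show ?thesis using True Q'(2) by (simp add: \<phi>_def)
  next
    case False
    have "f 2 (sym_gen_class (Reg P) (reg_id v)) \<in> ops (sym_presented Q) 2"
      using f cls[OF v] unfolding ns_operad_hom_def by blast
    then have "\<exists>w. w \<in> gen Q \<and> ?cls v = sym_gen_class Q w"
      using sym_arity_two_class[OF Q] by blast
    then show ?thesis using someI_ex[of "\<lambda>w. w \<in> gen Q \<and> ?cls v = sym_gen_class Q w"] False
      by (simp add: \<phi>_def)
  qed
  have \<phi>_gen: "\<phi> ` gen P \<subseteq> gen Q" using \<phi> by blast
  let ?G = "\<lambda>m p. f m (R.cl m (lc_map (map_ptree reg_id id) p))"
  let ?H = "\<lambda>m p. Q.cl m (lc_map (map_ptree \<phi> id) p)"
  have G: "ns_operad_hom (ns_tree_operad (gen P)) (sym_presented Q) ?G"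
    using ns_operad_hom_comp[OF ns_operad_hom_comp[OF label_hom[OF reg] R.projection_hom]] f
    by (simp add: ns_operad_hom_def sym_presented_def del: Reg_simps)
  have H: "ns_operad_hom (ns_tree_operad (gen P)) (sym_presented Q) ?H"
    unfolding ns_operad_hom_sym_presented
    by (rule ns_operad_hom_comp[OF label_hom[OF \<phi>_gen] Q.projection_hom])
  have GH: "?G m p = ?H m p" if p: "p \<in> ops (ns_tree_operad (gen P)) m" for m p
  proof (rule ns_tree_operad_hom_unique[OF G H _ _ p])
    show "oscale (sym_presented Q) m 0 X = ozero (sym_presented Q) m"
      if "X \<in> ops (sym_presented Q) m" for m X
      using that Q.quotient_scale_zero by (simp add: sym_presented_def)
    show "?G 2 (corolla w) = ?H 2 (corolla w)" if "w \<in> gen P" for w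
      using \<phi>[OF that] by (simp only: lc_map_corolla sym_gen_class_def)
  qed
  have "label_map P Q \<phi>"
  proof (rule label_mapI[OF P Q \<phi>_gen])
    show "\<phi> 0 = 0" by (simp add: \<phi>_def)
    fix m r assume r: "r \<in> linearity_rel P m \<union> rel P m"
    have r_ops: "r \<in> ops (ns_tree_operad (gen P)) m"
      using tree_quotient.ideal_ops[OF tree_quotient_ns[OF P] ns_rel_ideal_gen[OF r]] .
    have "lc_map (map_ptree reg_id id) r \<in> linearity_rel (Reg P) m \<union> rel (Reg P) m"
      using r
    proof
      assume lin: "r \<in> linearity_rel P m"
      then consider
          a b where "m = 2" "r = corolla (a + b) - corolla a - corolla b" "a \<in> gen P" "b \<in> gen P"
        | c a where "m = 2" "r = corolla (lscale P c a) - lc_scale c (corolla a)" "a \<in> gen P"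
        by (auto simp: linearity_rel_def simp del: plus_fun_apply split: if_splits)
      then have "lc_map (map_ptree reg_id id) r \<in> linearity_rel (Reg P) m"
      proof cases
        case 1
        then have "reg_id a \<in> gen (Reg P)" "reg_id b \<in> gen (Reg P)" using reg by blast+
        then show ?thesis
          unfolding linearity_rel_def 1(1,2) lc_map_diff lc_map_corolla reg_id_simps
          by (simp del: Reg_simps plus_fun_apply) blast
      next
        case 2
        then have "reg_id a \<in> gen (Reg P)" using reg by blast
        then show ?thesis
          unfolding linearity_rel_def 2(1,2) lc_map_diff lc_map_scale lc_map_corolla lscale_reg_id[OF P'(1), symmetric]
          by (simp del: Reg_simps plus_fun_apply) blast
      qed
      then show ?thesis by blast
    qed simp
    then have "sym_rel_ideal (Reg P) m (lc_map (map_ptree reg_id id) r)"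
      by (intro sym_rel_ideal_gen) blast
    then have "R.cl m (lc_map (map_ptree reg_id id) r) = R.cl m (lc_map (map_ptree reg_id id) 0)"
      by (simp only: R.cl_eq_iff lc_map_zero diff_zero)
    \<comment> \<open>\<open>r\<close> and 0 have the same class in the regularization, hence the
      same image through \<open>f\<close>, and \<open>GH\<close> moves this to the side of
      \<phi>.\<close>
    then have "?H m r = ?H m 0" using GH[OF r_ops] GH[of 0 m] by simp
    then show "sym_rel_ideal Q m (lc_map (map_ptree \<phi> id) r)" unfolding Q.cl_eq_iff by simp
  qed
  then show ?thesis using that \<phi> by blast
qed

section \<open>The induced morphism\<close>

lemma tens_word_snoc: "tens_word w (\<mu> @ [s]) = tens s (tens_word w \<mu>)"
  by (simp add: tens_word_def)

lemma tens_word_Nil [simp]: "tens_word w [] = w"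
  by (simp add: tens_word_def)

lemma ns_presentation_iter: "ns_presentation P \<Longrightarrow> ns_presentation ((ns_BSu ^^ k) P)"
  by (induction k) (simp_all add: ns_presentation_BSu)

lemma sym_presentation_iter: "sym_presentation Q \<Longrightarrow> sym_presentation ((sym_BSu ^^ k) Q)"
  by (induction k) (simp_all add: sym_presentation_BSu)

lemma label_map_iter:
  assumes P: "ns_presentation P" and Q: "sym_presentation Q" and \<phi>: "label_map P Q \<phi>"
  shows "label_map ((ns_BSu ^^ k) P) ((sym_BSu ^^ k) Q) ((bsu_map ^^ k) \<phi>)"
proof (induction k)
  case (Suc k)
  then show ?case
    using label_map_BSu[OF ns_presentation_iter[OF P] sym_presentation_iter[OF Q]] by simp
qed (use \<phi> in simp)

lemma bsu_map_iter_tens_word: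
  assumes "\<phi> 0 = 0" "length \<mu> = k"
  shows "(bsu_map ^^ k) \<phi> (tens_word v \<mu>) = tens_word (\<phi> v) \<mu>"
proof -
  have zero: "(bsu_map ^^ k) \<phi> 0 = 0" for k
  proof (induction k)
    case (Suc k)
    show ?case
      using bsu_map_tens_single[where \<phi> = "(bsu_map ^^ k) \<phi>", OF Suc, of Prec 0, unfolded tens_zero Suc]
      by (simp only: funpow.simps o_apply)
  qed (use assms(1) in \<open>simp only: funpow_0\<close>)
  show ?thesis
    using assms(2)
  proof (induction \<mu> arbitrary: k rule: rev_induct)
    case (snoc s \<mu>)
    then obtain k' where k: "k = Suc k'" "length \<mu> = k'" by (cases k) auto
    show ?case
      using bsu_map_tens_single[where \<phi> = "(bsu_map ^^ k') \<phi>", OF zero] snoc.IH[OF k(2)] k(1)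
      by (simp add: tens_word_snoc)
  qed simp
qed

lemma tens_in_gen:
  assumes "0 \<in> gen P" "w \<in> gen P"
  shows "tens s w \<in> gen (ns_BSu P)"
  using tens_in_BSu[OF assms] by (cases s) (simp_all only:)

lemma tens_word_in_gen:
  assumes P: "ns_presentation P" and v: "v \<in> gen P" and \<mu>: "length \<mu> = k"
  shows "tens_word v \<mu> \<in> gen ((ns_BSu ^^ k) P)"
  using \<mu>
proof (induction \<mu> arbitrary: k rule: rev_induct)
  case (snoc s \<mu>)
  then obtain k' where k: "k = Suc k'" "length \<mu> = k'" by (cases k) auto
  show ?case
    using tens_in_gen[OF ns_presentationD(2)[OF ns_presentation_iter[OF P]] snoc.IH[OF k(2)], of s] k(1)
    by (simp add: tens_word_snoc del: ns_BSu_simps)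
qed (use v in simp)

text \<open>Independence of the lift. Each letter is added by a bisuccessor of the difference of
  corollas at leaf 1 or 2, which preserves the ideal.\<close>

lemma tens_word_cong:
  assumes Q: "sym_presentation Q" and \<mu>: "length \<mu> = k"
    and eq: "sym_rel_ideal Q 2 (corolla w - corolla w')"
  shows "sym_rel_ideal ((sym_BSu ^^ k) Q) 2 (corolla (tens_word w \<mu>) - corolla (tens_word w' \<mu>))"
  using \<mu>
proof (induction \<mu> arbitrary: k rule: rev_induct)
  case (snoc s \<mu>)
  then obtain k' where k: "k = Suc k'" "length \<mu> = k'" by (cases k) auto
  show ?case
    using sym_rel_ideal_BSu[OF sym_presentation_iter[OF Q] snoc.IH[OF k(2)], of "if s = Prec then 1 else 2"] k(1)
    by (cases s) (simp_all add: tens_word_snoc lc_map_diff lc_map_bsu_corolla bsu_label_def del: plus_fun_apply)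
qed (use eq in simp)

text \<open>The words span additively: a scalar can be absorbed into \<open>v\<close>, as the
  generators of \<open>P\<close> form a subspace. The property \<open>S\<close> varies in the
  induction.\<close>

lemma gen_iter_induct:
  assumes P: "ns_presentation P" and u: "u \<in> gen ((ns_BSu ^^ k) P)"
    and word: "\<And>v \<mu>. v \<in> gen P \<Longrightarrow> length \<mu> = k \<Longrightarrow> S (tens_word v \<mu>)"
    and add: "\<And>a b. a \<in> gen ((ns_BSu ^^ k) P) \<Longrightarrow> b \<in> gen ((ns_BSu ^^ k) P) \<Longrightarrow> S a \<Longrightarrow> S b \<Longrightarrow> S (a + b)"
  shows "S u"
  using u word add
proof (induction k arbitrary: S u)
  case 0
  then show ?case using 0(2)[of u "[]"] by simp
next
  case (Suc k)
  let ?P = "(ns_BSu ^^ k) P"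
  have zero: "0 \<in> gen ?P" using ns_presentationD(2)[OF ns_presentation_iter[OF P]] .
  have gen: "tens s a \<in> gen ((ns_BSu ^^ Suc k) P)" if "a \<in> gen ?P" for s a
    using tens_in_gen[OF zero that] by (simp del: ns_BSu_simps)
  have tens: "S (tens s a)" if "a \<in> gen ?P" for s a
  \<comment> \<open>The induction hypothesis is used for the property that \<open>S\<close> holds
    after tensoring with \<open>s\<close>; the last letter of a word is its outermost
    factor.\<close>
  proof (rule Suc.IH[OF that])
    show "S (tens s (tens_word v \<mu>))" if "v \<in> gen P" "length \<mu> = k" for v \<mu>
      using Suc.prems(2)[OF that(1), of "\<mu> @ [s]"] that(2) by (simp add: tens_word_snoc)
    show "S (tens s (a + b))" if "a \<in> gen ?P" "b \<in> gen ?P" "S (tens s a)" "S (tens s b)" for a b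
      unfolding tens_add by (rule Suc.prems(3)[OF gen gen]) (use that in simp_all)
  qed
  have "u \<in> gen (ns_BSu ?P)" using Suc.prems(1) by (simp del: ns_BSu_simps)
  then obtain a b where u: "u = tens Prec a + tens Succ b" and ab: "a \<in> gen ?P" "b \<in> gen ?P"
    unfolding ns_BSu_simps by blast
  show ?case
    unfolding u by (rule Suc.prems(3)[OF gen[OF ab(1)] gen[OF ab(2)] tens[OF ab(1)] tens[OF ab(2)]])
qed

lemma induced_morphism_ex:
  fixes P :: "('k::field, 'v::ab_group_add) ns_pres" and Q :: "('k, 'w::ab_group_add) sym_pres"
  assumes P: "ns_presentation P" and Q: "sym_presentation Q"
    and f: "ns_operad_hom (sym_presented (Reg P)) (sym_presented Q) f"
  shows "\<exists>F. induced_morphism k P Q f F"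
proof -
  let ?Pk = "(ns_BSu ^^ k) P" and ?Qk = "(sym_BSu ^^ k) Q"
  obtain \<phi> where \<phi>: "label_map P Q \<phi>"
    and f\<phi>: "\<And>v. v \<in> gen P \<Longrightarrow> f 2 (sym_gen_class (Reg P) (reg_id v)) = sym_gen_class Q (\<phi> v)"
    using base_label_map[OF P Q f] by blast
  define \<psi> where "\<psi> = (bsu_map ^^ k) \<phi>"
  have \<psi>: "label_map ?Pk ?Qk \<psi>" unfolding \<psi>_def using label_map_iter[OF P Q \<phi>] .
  interpret P: tree_quotient "ns_tree_operad (gen ?Pk)" "ns_rel_ideal ?Pk"
    using tree_quotient_ns[OF ns_presentation_iter[OF P]] .
  interpret Q: tree_quotient "sym_tree_operad (gen Q)" "sym_rel_ideal Q"
    using tree_quotient_sym[OF Q] .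
  interpret B: tree_quotient "sym_tree_operad (gen ?Qk)" "sym_rel_ideal ?Qk"
    using tree_quotient_sym[OF sym_presentation_iter[OF Q]] .
  have gen: "\<psi> ` gen ?Pk \<subseteq> gen ?Qk" using \<psi> by (simp add: label_map_def)
  have G: "ns_operad_hom (ns_tree_operad (gen ?Pk)) (sym_presented ?Qk)
      (\<lambda>m p. B.cl m (lc_map (map_ptree \<psi> id) p))"
    unfolding ns_operad_hom_sym_presented
    by (rule ns_operad_hom_comp[OF label_hom[OF gen] B.projection_hom])
  have compat: "B.cl m (lc_map (map_ptree \<psi> id) p) = B.cl m (lc_map (map_ptree \<psi> id) q)"
    if "ns_rel_ideal ?Pk m (p - q)" for m p q
    using \<psi> that unfolding B.cl_eq_iff lc_map_diff[symmetric] label_map_def by blast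
  obtain F where hom: "ns_operad_hom (ns_presented ?Pk) (sym_presented ?Qk) F"
    and ext: "\<And>m. F m \<in> extensional (ops (ns_presented ?Pk) m)"
    and F: "\<And>m p. p \<in> ops (ns_tree_operad (gen ?Pk)) m \<Longrightarrow>
      F m (P.cl m p) = B.cl m (lc_map (map_ptree \<psi> id) p)"
    by (rule P.quotient_hom_lift[OF G compat]) (assumption, rule that, simp_all only: ns_presented_def)
  have "F 2 (ns_gen_class ?Pk (tens_word v \<mu>)) = sym_gen_class ?Qk (tens_word w \<mu>)"
    if v: "v \<in> gen P" and \<mu>: "length \<mu> = k"
      and lift: "f 2 (sym_gen_class (Reg P) (reg_id v)) = sym_gen_class Q w" for v w \<mu>
  proof -
    \<comment> \<open>The lift \<open>w\<close> is arbitrary; it is congruent to the chosen one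
      because both represent the value of \<open>f\<close>.\<close>
    have "sym_rel_ideal Q 2 (corolla (\<phi> v) - corolla w)"
      using lift f\<phi>[OF v] unfolding sym_gen_class_def Q.cl_eq_iff[symmetric] by simp
    from tens_word_cong[OF Q \<mu> this]
    have "B.cl 2 (corolla (tens_word (\<phi> v) \<mu>)) = B.cl 2 (corolla (tens_word w \<mu>))"
      unfolding B.cl_eq_iff .
    moreover have "\<psi> (tens_word v \<mu>) = tens_word (\<phi> v) \<mu>"
      unfolding \<psi>_def using bsu_map_iter_tens_word[of \<phi>, OF _ \<mu>] \<phi> by (simp add: label_map_def)
    moreover have "(corolla (tens_word v \<mu>) :: ('k, 'v label) tcomb) \<in> ops (ns_tree_operad (gen ?Pk)) 2"
      using keys_corolla_subset(1)[OF tens_word_in_gen[OF P v \<mu>]] by simp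
    ultimately show ?thesis
      unfolding ns_gen_class_def sym_gen_class_def using F by (simp only: lc_map_corolla)
  qed
  then have "induced_morphism k P Q f F"
    unfolding induced_morphism_def ns_operad_hom_forget using hom ext by blast
  then show ?thesis by blast
qed

text \<open>The values are prescribed on words only. Linearity relations extend the agreement to all
  generators, and composition extends it to all trees.\<close>

lemma induced_morphism_unique:
  fixes P :: "('k::field, 'v::ab_group_add) ns_pres" and Q :: "('k, 'w::ab_group_add) sym_pres"
  assumes P: "ns_presentation P" and Q: "sym_presentation Q"
    and f: "ns_operad_hom (sym_presented (Reg P)) (sym_presented Q) f"
    and F: "induced_morphism k P Q f F" and F': "induced_morphism k P Q f F'"
  shows "F = F'"
proof -
  let ?Pk = "(ns_BSu ^^ k) P" and ?Qk = "(sym_BSu ^^ k) Q"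
  obtain \<phi> where \<phi>: "label_map P Q \<phi>"
    and f\<phi>: "\<And>v. v \<in> gen P \<Longrightarrow> f 2 (sym_gen_class (Reg P) (reg_id v)) = sym_gen_class Q (\<phi> v)"
    using base_label_map[OF P Q f] by blast
  interpret P: tree_quotient "ns_tree_operad (gen ?Pk)" "ns_rel_ideal ?Pk"
    using tree_quotient_ns[OF ns_presentation_iter[OF P]] .
  interpret B: tree_quotient "sym_tree_operad (gen ?Qk)" "sym_rel_ideal ?Qk"
    using tree_quotient_sym[OF sym_presentation_iter[OF Q]] .
  have hom: "ns_operad_hom (ns_quotient (ns_tree_operad (gen ?Pk)) (ns_rel_ideal ?Pk)) (sym_presented ?Qk) H"
    if "induced_morphism k P Q f H" for H
    using that by (simp add: induced_morphism_def ns_operad_hom_forget ns_presented_def)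
  have extensional: "H m \<in> extensional (P.cl m ` ops (ns_tree_operad (gen ?Pk)) m)"
    if "induced_morphism k P Q f H" for H m
    using that unfolding induced_morphism_def ns_presented_def P.ops_quotient by blast
  have word: "H 2 (P.cl 2 (corolla (tens_word v \<mu>))) = sym_gen_class ?Qk (tens_word (\<phi> v) \<mu>)"
    if "induced_morphism k P Q f H" "v \<in> gen P" "length \<mu> = k" for H v \<mu>
  proof -
    \<comment> \<open>The prescription speaks of lifts in \<open>gen Q\<close>; \<phi> provides one,
      so both morphisms take the same prescribed value.\<close>
    have "\<phi> v \<in> gen Q" using \<phi> that(2) by (auto simp: label_map_def)
    then show ?thesis
      using that f\<phi>[OF that(2)] unfolding induced_morphism_def ns_gen_class_def by blast
  qed
  have corolla: "F 2 (P.cl 2 (corolla u)) = F' 2 (P.cl 2 (corolla u))" if "u \<in> gen ?Pk" for u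
    using P that
  proof (rule gen_iter_induct)
    show "F 2 (P.cl 2 (corolla (tens_word v \<mu>))) = F' 2 (P.cl 2 (corolla (tens_word v \<mu>)))"
      if "v \<in> gen P" "length \<mu> = k" for v \<mu>
      using word[OF F that] word[OF F' that] by simp
    fix a b
    assume ab: "a \<in> gen ?Pk" "b \<in> gen ?Pk"
      and eq: "F 2 (P.cl 2 (corolla a)) = F' 2 (P.cl 2 (corolla a))"
        "F 2 (P.cl 2 (corolla b)) = F' 2 (P.cl 2 (corolla b))"
    have "ns_rel_ideal ?Pk 2 (corolla (a + b) - corolla a - corolla b)"
      by (rule ns_rel_ideal_gen) (use ab in \<open>auto simp: linearity_rel_def simp del: plus_fun_apply\<close>)
    then have cl: "P.cl 2 (corolla (a + b)) = oadd (ns_quotient (ns_tree_operad (gen ?Pk)) (ns_rel_ideal ?Pk)) 2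
        (P.cl 2 (corolla a)) (P.cl 2 (corolla b))"
      unfolding P.quotient_add P.cl_eq_iff by (simp add: diff_diff_eq)
    have mem: "P.cl 2 (corolla u) \<in> ops (ns_quotient (ns_tree_operad (gen ?Pk)) (ns_rel_ideal ?Pk)) 2"
      if "u \<in> gen ?Pk" for u
      unfolding P.ops_quotient using keys_corolla_subset(1)[OF that] by simp
    have plus: "H 2 (P.cl 2 (corolla (a + b))) = oadd (sym_presented ?Qk) 2 (H 2 (P.cl 2 (corolla a))) (H 2 (P.cl 2 (corolla b)))"
      if "induced_morphism k P Q f H" for H
      using hom[OF that] mem[OF ab(1)] mem[OF ab(2)] unfolding cl ns_operad_hom_def by blast
    show "F 2 (P.cl 2 (corolla (a + b))) = F' 2 (P.cl 2 (corolla (a + b)))"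
      unfolding plus[OF F] plus[OF F'] eq ..
  qed
  have eq: "F m (P.cl m p) = F' m (P.cl m p)" if p: "p \<in> ops (ns_tree_operad (gen ?Pk)) m" for m p
  proof (rule ns_tree_operad_hom_unique[where Q = "sym_presented ?Qk"
        and F = "\<lambda>m p. F m (P.cl m p)" and F' = "\<lambda>m p. F' m (P.cl m p)", OF _ _ _ _ p])
    show "ns_operad_hom (ns_tree_operad (gen ?Pk)) (sym_presented ?Qk) (\<lambda>m p. F m (P.cl m p))"
      "ns_operad_hom (ns_tree_operad (gen ?Pk)) (sym_presented ?Qk) (\<lambda>m p. F' m (P.cl m p))"
      using ns_operad_hom_comp[OF P.projection_hom hom] F F' by blast+
    show "oscale (sym_presented ?Qk) m 0 X = ozero (sym_presented ?Qk) m"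
      if "X \<in> ops (sym_presented ?Qk) m" for m X
      using that B.quotient_scale_zero by (simp add: sym_presented_def)
    show "F 2 (P.cl 2 (corolla w)) = F' 2 (P.cl 2 (corolla w))" if "w \<in> gen ?Pk" for w
      using that by (rule corolla)
  qed
  show ?thesis
  proof (rule ext)
    fix m
    show "F m = F' m"
      by (rule extensionalityI[OF extensional[OF F] extensional[OF F']]) (use eq in auto)
  qed
qed

section \<open>Matrices over an algebra\<close>

definition path_entries :: "('a^'n^'n) list \<Rightarrow> 'n list \<Rightarrow> 'a list" where
  "path_entries Ms vs = map (\<lambda>l. Ms ! l $ (vs ! l) $ (vs ! Suc l)) [0..<length Ms]"

text \<open>Both end points belong to the list, unlike in \<open>matrix_action\<close>, so that
  consecutive pieces of a path share a vertex and can be cut and joined uniformly.\<close>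

definition paths :: "nat \<Rightarrow> 'n \<Rightarrow> 'n \<Rightarrow> 'n::finite list set" where
  "paths m i j = {vs. length vs = Suc m \<and> vs ! 0 = i \<and> vs ! m = j}"

lemma finite_paths [simp]: "finite (paths m i j)"
  by (rule finite_subset[OF _ finite_lists_length_eq[of UNIV "Suc m"]]) (auto simp: paths_def)

lemma length_path_entries [simp]: "length (path_entries Ms vs) = length Ms"
  by (simp add: path_entries_def)

text \<open>For \<open>m = 0\<close> the two sums differ: \<open>m - 1\<close> is then 0 and the
  left one always has one term, while a path with no edge needs \<open>i = j\<close>.\<close>

lemma matrix_action_paths:
  fixes Ms :: "('a::ab_group_add^'n::finite^'n) list"
  assumes "length Ms = m" "m \<ge> 1"
  shows "matrix_action \<alpha> m \<mu> Ms $ i $ j = (\<Sum>vs\<in>paths m i j. \<alpha> m \<mu> (path_entries Ms vs))"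
proof -
  have "(\<Sum>ks | length ks = m - 1. \<alpha> m \<mu> (path_entries Ms (i # ks @ [j]))) =
      (\<Sum>vs\<in>paths m i j. \<alpha> m \<mu> (path_entries Ms vs))"
  proof (rule sum.reindex_bij_witness[where j = "\<lambda>ks. i # ks @ [j]" and i = "\<lambda>vs. butlast (tl vs)"])
    fix vs assume vs: "vs \<in> paths m i j"
    then obtain v ws where "vs = v # ws" by (cases vs) (auto simp: paths_def)
    moreover obtain ks w where "ws = ks @ [w]"
      using vs assms(2) calculation by (cases ws rule: rev_cases) (auto simp: paths_def)
    ultimately show "i # butlast (tl vs) @ [j] = vs" "butlast (tl vs) \<in> {ks. length ks = m - 1}"
      using vs by (auto simp: paths_def nth_append)
  next
    fix ks :: "'n list" assume "ks \<in> {ks. length ks = m - 1}"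
    then show "i # ks @ [j] \<in> paths m i j"
      using assms(2) by (cases m) (auto simp: paths_def nth_append)
  qed auto
  then show ?thesis using assms(1) by (simp add: matrix_action_def path_entries_def)
qed

section \<open>Cutting and splicing paths of indices\<close>

lemma path_entries_cong:
  "(\<And>l. l \<le> length Ms \<Longrightarrow> vs ! l = us ! l) \<Longrightarrow> path_entries Ms vs = path_entries Ms us"
  by (simp add: path_entries_def)

lemma path_entries_append:
  assumes "length xs \<le> length vs"
  shows "path_entries (xs @ ys) vs = path_entries xs vs @ path_entries ys (drop (length xs) vs)"
  by (rule nth_equalityI) (use assms in \<open>auto simp: path_entries_def nth_append\<close>)

lemma path_entries_update:
  assumes "i < length Ms"
  shows "path_entries (Ms[i := X]) vs = (path_entries Ms vs)[i := X $ (vs ! i) $ (vs ! Suc i)]"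
  by (rule nth_equalityI) (use assms in \<open>auto simp: path_entries_def nth_list_update\<close>)

text \<open>Replaces the edge from vertex \<open>a\<close> to vertex \<open>a + 1\<close> by the
  path \<open>ws\<close>. As \<open>ws\<close> brings both end points along, two vertices of
  \<open>us\<close> are removed, hence \<open>a + 2\<close>.\<close>

definition splice_path :: "nat \<Rightarrow> 'n list \<Rightarrow> 'n list \<Rightarrow> 'n list" where
  "splice_path a us ws = take a us @ ws @ drop (a + 2) us"

text \<open>The index ranges overlap at the ends of \<open>ws\<close>, where the descriptions agree
  because \<open>ws\<close> joins the end points of the replaced edge.\<close>

lemma splice_path_nth:
  assumes us: "us \<in> paths (a + 1 + b) i j" and ws: "ws \<in> paths n (us ! a) (us ! Suc a)"
  shows "l \<le> a \<Longrightarrow> splice_path a us ws ! l = us ! l"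
    and "l \<le> n \<Longrightarrow> splice_path a us ws ! (a + l) = ws ! l"
    and "l \<le> b \<Longrightarrow> splice_path a us ws ! (a + n + l) = us ! (Suc a + l)"
  using us ws by (auto simp: splice_path_def paths_def nth_append le_less) (cases l; simp)+

text \<open>Splicing is a bijection. Its inverse cuts out the \<open>n\<close> edges after vertex
  \<open>a\<close> as the inner path and joins their two ends by a single edge in the outer
  one.\<close>

lemma sum_paths_splice:
  assumes n: "n \<ge> 1"
  shows "(\<Sum>vs\<in>paths (a + n + b) i j. g vs) =
    (\<Sum>us\<in>paths (a + 1 + b) i j. \<Sum>ws\<in>paths n (us ! a) (us ! Suc a). g (splice_path a us ws))"
proof -
  let ?S = "SIGMA us:paths (a + 1 + b) i j. paths n (us ! a) (us ! Suc a)"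
  let ?us = "\<lambda>vs. take (Suc a) vs @ drop (a + n) vs" and ?ws = "\<lambda>vs. take (Suc n) (drop a vs)"
  have "(\<Sum>vs\<in>paths (a + n + b) i j. g vs) = (\<Sum>x\<in>?S. g (splice_path a (fst x) (snd x)))"
  proof (rule sum.reindex_bij_witness[where i = "\<lambda>x. splice_path a (fst x) (snd x)"
        and j = "\<lambda>vs. (?us vs, ?ws vs)"])
    fix vs assume vs: "vs \<in> paths (a + n + b) i j"
    have "length (splice_path a (?us vs) (?ws vs)) = length vs"
      using vs n by (simp add: splice_path_def paths_def)
    then have splice: "splice_path a (?us vs) (?ws vs) = vs"
      by (rule nth_equalityI) (use vs n in \<open>auto simp: splice_path_def paths_def nth_append\<close>)
    then show "splice_path a (fst (?us vs, ?ws vs)) (snd (?us vs, ?ws vs)) = vs"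
      "g (splice_path a (fst (?us vs, ?ws vs)) (snd (?us vs, ?ws vs))) = g vs"
      by simp_all
    show "(?us vs, ?ws vs) \<in> ?S"
      using vs n by (auto simp: paths_def nth_append)
  next
    fix x assume "x \<in> ?S"
    then obtain us ws where x: "x = (us, ws)" and us: "us \<in> paths (a + 1 + b) i j"
      and ws: "ws \<in> paths n (us ! a) (us ! Suc a)" by auto
    have len: "length us = a + 2 + b" "length ws = Suc n" using us ws by (auto simp: paths_def)
    have ends: "ws ! 0 = us ! a" "ws ! n = us ! Suc a" using ws by (auto simp: paths_def)
    have lv: "length (splice_path a us ws) = Suc (a + n + b)" using len by (simp add: splice_path_def)
    show "(splice_path a (fst x) (snd x)) \<in> paths (a + n + b) i j"
      using us ws n by (auto simp: x paths_def splice_path_def nth_append)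
    have "?us (splice_path a us ws) = us"
    proof (rule nth_equalityI)
      fix l assume "l < length (?us (splice_path a us ws))"
      moreover have "Suc (Suc (l - 2)) = l" if "\<not> l \<le> Suc a" using that by arith
      ultimately show "?us (splice_path a us ws) ! l = us ! l"
        using len lv ends by (cases "l = a"; cases "l = Suc a") (auto simp: splice_path_def nth_append)
    qed (use len lv in auto)
    moreover have "?ws (splice_path a us ws) = ws"
      using len by (simp add: splice_path_def)
    ultimately show "(?us (splice_path a (fst x) (snd x)), ?ws (splice_path a (fst x) (snd x))) = x"
      by (simp add: x)
  qed
  also have "\<dots> = (\<Sum>us\<in>paths (a + 1 + b) i j. \<Sum>ws\<in>paths n (us ! a) (us ! Suc a). g (splice_path a us ws))"
    by (simp add: sum.Sigma split_beta)
  finally show ?thesis .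
qed


lemma path_entries_splice:
  assumes us: "us \<in> paths (length xs + 1 + length zs) i j"
    and ws: "ws \<in> paths (length ys) (us ! length xs) (us ! Suc (length xs))"
  shows "path_entries (xs @ ys @ zs) (splice_path (length xs) us ws) =
    path_entries xs us @ path_entries ys ws @ path_entries zs (drop (Suc (length xs)) us)"
proof -
  let ?vs = "splice_path (length xs) us ws"
  have len: "length ?vs = Suc (length xs + length ys + length zs)" "length us = Suc (Suc (length xs + length zs))"
    using us ws by (simp_all add: paths_def splice_path_def)
  have "path_entries (xs @ ys @ zs) ?vs = path_entries xs ?vs @
      path_entries ys (drop (length xs) ?vs) @ path_entries zs (drop (length ys) (drop (length xs) ?vs))"
    using len by (simp add: path_entries_append)
  also have "path_entries xs ?vs = path_entries xs us"
    by (rule path_entries_cong) (rule splice_path_nth[OF us ws])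
  also have "path_entries ys (drop (length xs) ?vs) = path_entries ys ws"
    by (rule path_entries_cong) (use splice_path_nth(2)[OF us ws] len in simp)
  also have "path_entries zs (drop (length ys) (drop (length xs) ?vs)) =
      path_entries zs (drop (Suc (length xs)) us)"
  proof (rule path_entries_cong)
    fix l assume "l \<le> length zs"
    then show "drop (length ys) (drop (length xs) ?vs) ! l = drop (Suc (length xs)) us ! l"
      using splice_path_nth(3)[OF us ws, of l] len by (simp add: ac_simps)
  qed
  finally show ?thesis .
qed

lemma path_entries_middle:
  assumes "length us = Suc (Suc (length xs + length zs))"
  shows "path_entries (xs @ [X] @ zs) us = path_entries xs us @
    [X $ (us ! length xs) $ (us ! Suc (length xs))] @ path_entries zs (drop (Suc (length xs)) us)"
proof -
  have "path_entries (xs @ [X] @ zs) us = path_entries xs us @ path_entries [X] (drop (length xs) us) @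
      path_entries zs (drop 1 (drop (length xs) us))"
    using assms path_entries_append[of xs us "[X] @ zs"] path_entries_append[of "[X]" "drop (length xs) us" zs]
    by simp
  moreover have "path_entries [X] (drop (length xs) us) = [X $ (us ! length xs) $ (us ! Suc (length xs))]"
    using assms by (simp add: path_entries_def)
  ultimately show ?thesis by simp
qed

text \<open>In arity 0 the defining formula puts one value into every entry and is not a sum over
  paths. The hypothesis \<open>nullary\<close> makes this value 0, and then both sides of a
  composition with a nullary operation vanish.\<close>

lemma matrix_algebra:
  fixes s :: "'k::field \<Rightarrow> 'a::ab_group_add \<Rightarrow> 'a"
  assumes alg: "ns_algebra Q s \<alpha>" and nullary: "\<And>\<mu>. \<mu> \<in> ops Q 0 \<Longrightarrow> \<alpha> 0 \<mu> [] = 0"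
  shows "ns_algebra Q (matrix_scale s :: 'k \<Rightarrow> 'a^'n::finite^'n \<Rightarrow> 'a^'n^'n) (matrix_action \<alpha>)"
proof -
  let ?S = "matrix_scale s :: 'k \<Rightarrow> 'a^'n^'n \<Rightarrow> 'a^'n^'n"
  have vs: "vector_space s"
    and lin: "\<And>m \<mu> xs i. \<mu> \<in> ops Q m \<Longrightarrow> length xs = m \<Longrightarrow> i < m \<Longrightarrow>
      Vector_Spaces.linear s s (\<lambda>x. \<alpha> m \<mu> (xs[i := x]))"
    and add: "\<And>m \<mu> \<nu> xs. \<mu> \<in> ops Q m \<Longrightarrow> \<nu> \<in> ops Q m \<Longrightarrow> length xs = m \<Longrightarrow>
      \<alpha> m (oadd Q m \<mu> \<nu>) xs = \<alpha> m \<mu> xs + \<alpha> m \<nu> xs"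
    and scale: "\<And>m c \<mu> xs. \<mu> \<in> ops Q m \<Longrightarrow> length xs = m \<Longrightarrow>
      \<alpha> m (oscale Q m c \<mu>) xs = s c (\<alpha> m \<mu> xs)"
    and unit: "\<And>x. \<alpha> 1 (ounit Q) [x] = x"
    and comp: "\<And>m n i \<mu> \<nu> xs ys zs. i \<in> {1..m} \<Longrightarrow> \<mu> \<in> ops Q m \<Longrightarrow> \<nu> \<in> ops Q n \<Longrightarrow>
      length xs = i - 1 \<Longrightarrow> length ys = n \<Longrightarrow> length zs = m - i \<Longrightarrow>
      \<alpha> (m + n - 1) (pcomp Q m i n \<mu> \<nu>) (xs @ ys @ zs) = \<alpha> m \<mu> (xs @ [\<alpha> n \<nu> ys] @ zs)"
    using alg unfolding ns_algebra_def by simp_all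
  have s_sum: "s c (\<Sum>x\<in>A. g x) = (\<Sum>x\<in>A. s c (g x))" for c A and g :: "'x \<Rightarrow> 'a"
    using vs module.scale_sum_right[of s c g A] by (simp add: module_iff_vector_space)
  have slot_add: "\<alpha> m \<mu> (xs[i := x + y]) = \<alpha> m \<mu> (xs[i := x]) + \<alpha> m \<mu> (xs[i := y])"
    and slot_scale: "\<alpha> m \<mu> (xs[i := s c x]) = s c (\<alpha> m \<mu> (xs[i := x]))"
    if "\<mu> \<in> ops Q m" "length xs = m" "i < m" for m \<mu> xs i x y c
    using lin[OF that] unfolding Vector_Spaces.linear_iff by simp_all
  have slot_sum: "\<alpha> m \<mu> (xs @ [\<Sum>w\<in>A. g w] @ zs) = (\<Sum>w\<in>A. \<alpha> m \<mu> (xs @ [g w] @ zs))"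
    if "\<mu> \<in> ops Q m" "m = length xs + 1 + length zs" "finite A"
    for m \<mu> xs zs A and g :: "'x \<Rightarrow> 'a"
  proof -
    have len: "length (xs @ [0] @ zs) = m" "length xs < m" using that by simp_all
    have zero: "\<alpha> m \<mu> (xs @ [0] @ zs) = 0"
      using slot_add[OF that(1) len, of 0 0] by simp
    have plus: "\<alpha> m \<mu> (xs @ [x + y] @ zs) = \<alpha> m \<mu> (xs @ [x] @ zs) + \<alpha> m \<mu> (xs @ [y] @ zs)" for x y
      using slot_add[OF that(1) len, of x y] by simp
    from that(3) show ?thesis
      by (induction A rule: finite_induct) (simp_all only: sum.empty sum.insert zero plus not_False_eq_True)
  qed
  have action: "matrix_action \<alpha> m \<mu> Ms $ p $ q = (\<Sum>vs\<in>paths m p q. \<alpha> m \<mu> (path_entries Ms vs))"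
    if "length Ms = m" "m \<ge> 1" for m \<mu> p q and Ms :: "('a^'n^'n) list"
    using that by (rule matrix_action_paths)
  have vsS: "vector_space ?S"
    using vs unfolding vector_space_def by (simp add: matrix_scale_def vec_eq_iff)
  have linS: "Vector_Spaces.linear ?S ?S (\<lambda>X. matrix_action \<alpha> m \<mu> (Ms[i := X]))"
    if \<mu>: "\<mu> \<in> ops Q m" and len: "length Ms = m" "i < m" for m \<mu> i and Ms :: "('a^'n^'n) list"
  proof -
    have entry: "matrix_action \<alpha> m \<mu> (Ms[i := X]) $ p $ q =
        (\<Sum>vs\<in>paths m p q. \<alpha> m \<mu> ((path_entries Ms vs)[i := X $ (vs ! i) $ (vs ! Suc i)]))" for X p q
      using action[of "Ms[i := X]" m] len by (simp add: path_entries_update)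
    show ?thesis
      unfolding Vector_Spaces.linear_iff
      using vsS slot_add[OF \<mu>] slot_scale[OF \<mu>] len
      by (simp add: vec_eq_iff entry matrix_scale_def sum.distrib s_sum)
  qed
  have compS: "matrix_action \<alpha> (m + n - 1) (pcomp Q m i n \<mu> \<nu>) (xs @ ys @ zs) =
      matrix_action \<alpha> m \<mu> (xs @ [matrix_action \<alpha> n \<nu> ys] @ zs)"
    if i: "i \<in> {1..m}" and \<mu>: "\<mu> \<in> ops Q m" and \<nu>: "\<nu> \<in> ops Q n"
      and len: "length xs = i - 1" "length ys = n" "length zs = m - i"
    for m n i \<mu> \<nu> and xs ys zs :: "('a^'n^'n) list"
  proof -
    have m: "m = length xs + 1 + length zs" using i len by auto
    have rhs: "matrix_action \<alpha> m \<mu> (xs @ [matrix_action \<alpha> n \<nu> ys] @ zs) $ p $ q =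
        (\<Sum>us\<in>paths m p q. \<alpha> m \<mu> (path_entries xs us @
          [matrix_action \<alpha> n \<nu> ys $ (us ! length xs) $ (us ! Suc (length xs))] @
          path_entries zs (drop (Suc (length xs)) us)))" for p q
    proof -
      have "matrix_action \<alpha> m \<mu> (xs @ [matrix_action \<alpha> n \<nu> ys] @ zs) $ p $ q =
          (\<Sum>us\<in>paths m p q. \<alpha> m \<mu> (path_entries (xs @ [matrix_action \<alpha> n \<nu> ys] @ zs) us))"
        by (rule action) (use m in simp_all)
      also have "\<dots> = (\<Sum>us\<in>paths m p q. \<alpha> m \<mu> (path_entries xs us @
          [matrix_action \<alpha> n \<nu> ys $ (us ! length xs) $ (us ! Suc (length xs))] @
          path_entries zs (drop (Suc (length xs)) us)))"
        by (rule sum.cong[OF refl], subst path_entries_middle) (auto simp: m paths_def)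
      finally show ?thesis .
    qed
    show ?thesis
    proof (cases "n = 0")
      case True
      have zero: "\<alpha> m \<mu> (us @ [0] @ ws) = 0" if "m = length us + 1 + length ws" for us ws
        using slot_sum[OF \<mu> that, of "{}"] by simp
      have entry: "matrix_action \<alpha> n \<nu> ys $ p $ q = 0" for p q
        using nullary \<nu> True len by (simp add: matrix_action_def)
      have "matrix_action \<alpha> m \<mu> (xs @ [matrix_action \<alpha> n \<nu> ys] @ zs) $ p $ q = 0" for p q
        unfolding rhs entry by (intro sum.neutral ballI zero) (simp add: m)
      \<comment> \<open>Any argument list of the composite is cut at the slot with an empty middle,
        so that the algebra law applies with no inner arguments.\<close>
      moreover have "\<alpha> (m + n - 1) (pcomp Q m i n \<mu> \<nu>) us = 0" if us: "length us = m + n - 1" for us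
      proof -
        have "\<alpha> (m + n - 1) (pcomp Q m i n \<mu> \<nu>) (take (length xs) us @ [] @ drop (length xs) us) =
            \<alpha> m \<mu> (take (length xs) us @ [\<alpha> n \<nu> []] @ drop (length xs) us)"
          by (rule comp[OF i \<mu> \<nu>]) (use us len True i in auto)
        also have "\<alpha> n \<nu> [] = 0" using nullary \<nu> True by simp
        also have "\<alpha> m \<mu> (take (length xs) us @ [0] @ drop (length xs) us) = 0"
          by (rule zero) (use us m True in auto)
        finally show ?thesis by simp
      qed
      ultimately show ?thesis
        by (simp add: vec_eq_iff matrix_action_def)
    next
      case False
      have mn: "m + n - 1 = length xs + n + length zs" using m by simp
      have "matrix_action \<alpha> (m + n - 1) (pcomp Q m i n \<mu> \<nu>) (xs @ ys @ zs) $ p $ q =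
          matrix_action \<alpha> m \<mu> (xs @ [matrix_action \<alpha> n \<nu> ys] @ zs) $ p $ q" for p q
      proof -
        have "matrix_action \<alpha> (m + n - 1) (pcomp Q m i n \<mu> \<nu>) (xs @ ys @ zs) $ p $ q =
            (\<Sum>vs\<in>paths (length xs + n + length zs) p q.
              \<alpha> (m + n - 1) (pcomp Q m i n \<mu> \<nu>) (path_entries (xs @ ys @ zs) vs))"
          using action[of "xs @ ys @ zs" "m + n - 1"] len False unfolding mn by simp
        also have "\<dots> = (\<Sum>us\<in>paths m p q. \<Sum>ws\<in>paths n (us ! length xs) (us ! Suc (length xs)).
            \<alpha> (m + n - 1) (pcomp Q m i n \<mu> \<nu>) (path_entries (xs @ ys @ zs) (splice_path (length xs) us ws)))"
          unfolding m by (rule sum_paths_splice) (use False in simp)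
        also have "\<dots> = (\<Sum>us\<in>paths m p q. \<Sum>ws\<in>paths n (us ! length xs) (us ! Suc (length xs)).
            \<alpha> m \<mu> (path_entries xs us @ [\<alpha> n \<nu> (path_entries ys ws)] @
              path_entries zs (drop (Suc (length xs)) us)))"
        proof (intro sum.cong refl)
          fix us ws
          assume us: "us \<in> paths m p q" and ws: "ws \<in> paths n (us ! length xs) (us ! Suc (length xs))"
          have e: "path_entries (xs @ ys @ zs) (splice_path (length xs) us ws) =
              path_entries xs us @ path_entries ys ws @ path_entries zs (drop (Suc (length xs)) us)"
            by (rule path_entries_splice) (use us[unfolded m] ws len(2) in simp_all)
          show "\<alpha> (m + n - 1) (pcomp Q m i n \<mu> \<nu>) (path_entries (xs @ ys @ zs) (splice_path (length xs) us ws)) =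
              \<alpha> m \<mu> (path_entries xs us @ [\<alpha> n \<nu> (path_entries ys ws)] @
                path_entries zs (drop (Suc (length xs)) us))"
            unfolding e by (rule comp[OF i \<mu> \<nu>]) (simp_all add: len)
        qed
        \<comment> \<open>Linearity in the slot moves the sum over inner paths inside, where it
          becomes an entry of the inner matrix.\<close>
        also have "\<dots> = (\<Sum>us\<in>paths m p q. \<alpha> m \<mu> (path_entries xs us @
            [\<Sum>ws\<in>paths n (us ! length xs) (us ! Suc (length xs)). \<alpha> n \<nu> (path_entries ys ws)] @
            path_entries zs (drop (Suc (length xs)) us)))"
          by (rule sum.cong[OF refl], rule slot_sum[symmetric, OF \<mu>]) (simp_all add: m)
        also have "\<dots> = matrix_action \<alpha> m \<mu> (xs @ [matrix_action \<alpha> n \<nu> ys] @ zs) $ p $ q"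
          unfolding rhs using action[of ys n] len False by simp
        finally show ?thesis .
      qed
      then show ?thesis by (simp add: vec_eq_iff)
    qed
  qed
  have unitS: "matrix_action \<alpha> 1 (ounit Q) [X] = X" for X :: "'a^'n^'n"
    using unit by (simp add: matrix_action_def vec_eq_iff)
  have addS: "matrix_action \<alpha> m (oadd Q m \<mu> \<nu>) Ms = matrix_action \<alpha> m \<mu> Ms + matrix_action \<alpha> m \<nu> Ms"
    if "\<mu> \<in> ops Q m" "\<nu> \<in> ops Q m" for m \<mu> \<nu> and Ms :: "('a^'n^'n) list"
    using add[OF that] by (simp add: matrix_action_def vec_eq_iff sum.distrib)
  have scaleS: "matrix_action \<alpha> m (oscale Q m c \<mu>) Ms = ?S c (matrix_action \<alpha> m \<mu> Ms)"
    if "\<mu> \<in> ops Q m" for m \<mu> c and Ms :: "('a^'n^'n) list"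
    using scale[OF that] by (simp add: matrix_action_def matrix_scale_def vec_eq_iff s_sum)
  show ?thesis
    unfolding ns_algebra_def
    by (intro conjI allI ballI impI vsS linS addS scaleS unitS compS) auto
qed

lemma ns_algebra_pullback:
  assumes F: "ns_operad_hom P Q F" and alg: "ns_algebra Q s \<alpha>"
  shows "ns_algebra P s (pullback F \<alpha>)"
  using assms unfolding ns_algebra_def ns_operad_hom_def pullback_def by simp

theorem theorem4p2:
  fixes \<P> :: "('k::field, 'v::ab_group_add) ns_pres"
    and \<O> :: "('k, 'w::ab_group_add) sym_pres"
    and k :: nat
    and f :: "nat \<Rightarrow> ('k, ('v \<times> 'v) label) tcomb set \<Rightarrow> ('k, 'w label) tcomb set"
    and s :: "'k \<Rightarrow> 'a::ab_group_add \<Rightarrow> 'a"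
    and \<alpha> :: "nat \<Rightarrow> ('k, 'w label) tcomb set \<Rightarrow> 'a list \<Rightarrow> 'a"
  assumes "ns_presentation \<P>"
    and "sym_presentation \<O>"
    and "sym_operad_hom (sym_presented (Reg \<P>)) (sym_presented \<O>) f"
    and "sym_algebra (sym_presented ((sym_BSu ^^ k) \<O>)) s \<alpha>"
  shows "(\<exists>!F. induced_morphism k \<P> \<O> f F) \<and>
    (\<forall>F. induced_morphism k \<P> \<O> f F \<longrightarrow>
       ns_algebra (ns_presented ((ns_BSu ^^ k) \<P>))
         (matrix_scale s :: 'k \<Rightarrow> 'a^'n::finite^'n \<Rightarrow> 'a^'n^'n)
         (pullback F (matrix_action \<alpha>)))"
proof -
  let ?P = "(ns_BSu ^^ k) \<P>" and ?Q = "(sym_BSu ^^ k) \<O>"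
  have f: "ns_operad_hom (sym_presented (Reg \<P>)) (sym_presented \<O>) f"
    using assms(3) by (simp add: sym_operad_hom_def)
  have alg: "ns_algebra (sym_presented ?Q) s \<alpha>"
    using assms(4) by (simp add: sym_algebra_def)
  interpret Q: tree_quotient "sym_tree_operad (gen ?Q)" "sym_rel_ideal ?Q"
    using tree_quotient_sym[OF sym_presentation_iter[OF assms(2)]] .
  \<comment> \<open>A tree has at least one leaf, so the only operation of arity 0 is the zero
    class. It equals its multiple by the scalar 0, hence acts by 0.\<close>
  have nullary: "\<alpha> 0 \<mu> [] = 0" if \<mu>: "\<mu> \<in> ops (sym_presented ?Q) 0" for \<mu>
  proof -
    have "sym_trees (gen ?Q) 0 = {}" using sym_trees_length(2) by fastforce
    then have "\<mu> = Q.cl 0 0"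
      using \<mu> by (auto simp: sym_presented_def Q.ops_quotient)
    then have "oscale (sym_presented ?Q) 0 0 \<mu> = \<mu>"
      by (simp add: sym_presented_def Q.quotient_scale)
    then have "\<alpha> 0 \<mu> [] = s 0 (\<alpha> 0 \<mu> [])"
      using alg \<mu> unfolding ns_algebra_def by (metis list.size(3))
    moreover have "vector_space s" using alg by (simp add: ns_algebra_def)
    then have "s 0 x = 0" for x
      using module.scale_zero_left[of s x] by (simp add: module_iff_vector_space)
    ultimately show ?thesis by simp
  qed
  have "\<exists>!F. induced_morphism k \<P> \<O> f F"
    using induced_morphism_ex[OF assms(1,2) f] induced_morphism_unique[OF assms(1,2) f] by blast
  moreover have "ns_algebra (ns_presented ?P) (matrix_scale s :: 'k \<Rightarrow> 'a^'n^'n \<Rightarrow> 'a^'n^'n)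
      (pullback F (matrix_action \<alpha>))" if "induced_morphism k \<P> \<O> f F" for F
  proof (rule ns_algebra_pullback[OF _ matrix_algebra[OF alg nullary]])
    show "ns_operad_hom (ns_presented ?P) (sym_presented ?Q) F"
      using that by (simp add: induced_morphism_def ns_operad_hom_forget)
  qed
  ultimately show ?thesis by blast
qed

end
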